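(* Let $N\ge2$, let $\varphi\in L^2(\mathbb{R})$ be a scale-$N$ father function with function $m_0$, and let $\psi_1,\dots,\psi_{N-1}$ be corresponding mother functions with functions $m_1,\dots,m_{N-1}$, as in the context. For any $\xi\in L^2(\mathbb{R})$, let $$\xi=\sum_{i=1}^{N-1}\sum_{j,k\in\mathbb{Z}}a_{jk}^{(i)}(\xi)\,U_N^jT^k\psi_i$$ be the orthonormal decomposition of $\xi$ relative to the wavelet basis $\{U_N^jT^k\psi_i\}$, and if $\xi\in\mathcal{V}_0$ (i.e., $a_{jk}^{(i)}(\xi)=0$ for $j\le0$), let $f\in L^2(\mathbb{T})=L^2(\mathbb{R}/2\pi\mathbb{Z})$ be the unique function such that $$\hat\xi(t)=f(t)\hat\varphi(t).$$ Then $$a_{jk}^{(i)}(\xi)=\bigl(S_i^*S_0^{*\,j-1}f\bigr)^{\sim}(k)$$ for $i=1,\dots,N-1$, $j=1,2,\dots$, $k\in\mathbb{Z}$, where $\tilde g(k)=\frac1{2\pi}\int_{-\pi}^{\pi}e^{ikt}g(t)\,dt$ for $g\in L^2(\mathbb{R}/2\pi\mathbb{Z})$.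
   Context: Functions on $\mathbb{T}$ (normalized Haar measure) are viewed as $2\pi$-periodic functions of $t$ via $z=e^{-it}$. On $L^2(\mathbb{R})$: $(U_N\xi)(x)=N^{-1/2}\xi(x/N)$, $(T\xi)(x)=\xi(x-1)$, and $\hat f(t)=\frac1{\sqrt{2\pi}}\int_{\mathbb{R}}e^{-ixt}f(x)\,dx$. A scale-$N$ father function is $\varphi\in L^2(\mathbb{R})$ such that $\{\varphi(\cdot-k):k\in\mathbb{Z}\}$ is an orthonormal set; with $\mathcal{V}_0$ its closed linear span, $U_N\varphi\in\mathcal{V}_0$; and $\bigcap_nU_N^n\mathcal{V}_0=\{0\}$, $\overline{\bigcup_nU_N^n\mathcal{V}_0}=L^2(\mathbb{R})$. Writing $U_N\varphi=\sum_ka_k\varphi(\cdot-k)$, put $m_0=\sum_ka_kz^k$, so $\sqrt N\hat\varphi(Nt)=m_0(e^{-it})\hat\varphi(t)$. Corresponding mother functions: functions $m_1,\dots,m_{N-1}$ on $\mathbb{T}$ are chosen so that the matrix $N^{-1/2}[m_i(\rho^kz)]_{i,k=0}^{N-1}$, $\rho=e^{2\pi i/N}$, is unitary for almost all $z$, and $\psi_i$ is defined by $\sqrt N\hat\psi_i(Nt)=m_i(e^{-it})\hat\varphi(t)$. Then $\{U_N^jT^k\psi_i:j,k\in\mathbb{Z},\ 1\le i\le N-1\}$ is an orthonormal basis of $L^2(\mathbb{R})$. The operators $S_i$ on $L^2(\mathbb{T})$ are $(S_i\xi)(z)=m_i(z)\xi(z^N)$, $i=0,\dots,N-1$, with adjoints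 $(S_i^*\xi)(z)=\frac1N\sum_{w^N=z}\overline{m_i(w)}\xi(w)$. *)

theory Defs
  imports "HOL-Analysis.Analysis"
begin

section \<open>Square-integrable functions\<close>

text \<open>
  Elements of \<open>L\<^sup>2\<close> are represented by functions; equality in \<open>L\<^sup>2\<close> is equality almost everywhere.
\<close>

definition L2 :: "'a measure \<Rightarrow> ('a \<Rightarrow> complex) set" where
  "L2 M = {f. f \<in> borel_measurable M \<and> integrable M (\<lambda>x. (cmod (f x))\<^sup>2)}"

definition L2_inner :: "'a measure \<Rightarrow> ('a \<Rightarrow> complex) \<Rightarrow> ('a \<Rightarrow> complex) \<Rightarrow> complex" where
  "L2_inner M f g = (LINT x|M. f x * cnj (g x))"

definition L2_norm :: "'a measure \<Rightarrow> ('a \<Rightarrow> complex) \<Rightarrow> real" where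
  "L2_norm M f = sqrt (LINT x|M. (cmod (f x))\<^sup>2)"

definition L2_lim :: "'a measure \<Rightarrow> ('i \<Rightarrow> 'a \<Rightarrow> complex) \<Rightarrow> ('a \<Rightarrow> complex) \<Rightarrow> 'i filter \<Rightarrow> bool" where
  "L2_lim M F f net \<longleftrightarrow> (\<forall>n. F n \<in> L2 M) \<and> f \<in> L2 M \<and>
     ((\<lambda>n. L2_norm M (\<lambda>x. F n x - f x)) \<longlongrightarrow> 0) net"

definition L2_has_sum ::
  "'a measure \<Rightarrow> ('i \<Rightarrow> 'a \<Rightarrow> complex) \<Rightarrow> ('a \<Rightarrow> complex) \<Rightarrow> 'i set \<Rightarrow> bool" where
  "L2_has_sum M F f I \<longleftrightarrow> L2_lim M (\<lambda>X x. \<Sum>i\<in>X. F i x) f (finite_subsets_at_top I)"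

definition closed_span :: "'a measure \<Rightarrow> ('a \<Rightarrow> complex) set \<Rightarrow> ('a \<Rightarrow> complex) set" where
  "closed_span M B = {\<xi> \<in> L2 M. \<forall>e>0. \<exists>X c. finite X \<and> X \<subseteq> B \<and>
     L2_norm M (\<lambda>x. \<xi> x - (\<Sum>b\<in>X. c b * b x)) < e}"

section \<open>The Fourier transform on the line\<close>

definition fourier_L1 :: "(real \<Rightarrow> complex) \<Rightarrow> real \<Rightarrow> complex" where
  "fourier_L1 f t = (LINT x|lborel. cis (- (x * t)) * f x) / of_real (sqrt (2 * pi))"

text \<open>
  For \<open>f\<close> in \<open>L\<^sup>2\<close> the defining integral is taken in the sense of Plancherel, as the \<open>L\<^sup>2\<close>-limit of
  the transforms of the truncations of \<open>f\<close> to \<open>[-n, n]\<close>. This determines the value up to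
  almost everywhere equality only.
\<close>

definition fourier :: "(real \<Rightarrow> complex) \<Rightarrow> real \<Rightarrow> complex" where
  "fourier f = (SOME g. L2_lim lborel
     (\<lambda>n::nat. fourier_L1 (\<lambda>x. indicator {- real n..real n} x * f x)) g sequentially)"

section \<open>Functions on the circle\<close>

text \<open>
  Normalized Haar measure. A function \<open>g\<close> on the circle is read as the \<open>2\<pi>\<close>-periodic
  function \<open>t \<mapsto> g (cis (- t))\<close>, that is, \<open>z = exp (- \<i> t)\<close>.
\<close>

definition haar_circle :: "complex measure" where
  "haar_circle = distr (uniform_measure lborel {- pi..pi}) (restrict_space borel (sphere 0 1))
     (\<lambda>t. cis (- t))"

definition circle_coeff :: "(complex \<Rightarrow> complex) \<Rightarrow> int \<Rightarrow> complex" where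
  "circle_coeff g k =
     (LINT t:{- pi..pi}|lborel. cis (of_int k * t) * g (cis (- t))) / of_real (2 * pi)"

text \<open>
  The adjoint of the operator taking \<open>\<xi>\<close> to \<open>z \<mapsto> m z * \<xi> (z ^ N)\<close> on \<open>L\<^sup>2\<close> of the circle.
\<close>

definition S_adj :: "nat \<Rightarrow> (complex \<Rightarrow> complex) \<Rightarrow> (complex \<Rightarrow> complex) \<Rightarrow> complex \<Rightarrow> complex" where
  "S_adj N m \<xi> z = (\<Sum>w | w ^ N = z. cnj (m w) * \<xi> w) / of_nat N"

section \<open>Multiresolution analysis of scale N\<close>

definition dilate :: "nat \<Rightarrow> (real \<Rightarrow> complex) \<Rightarrow> real \<Rightarrow> complex" where
  "dilate N \<xi> x = \<xi> (x / real N) / of_real (sqrt (real N))"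

definition translate :: "(real \<Rightarrow> complex) \<Rightarrow> real \<Rightarrow> complex" where
  "translate \<xi> x = \<xi> (x - 1)"

text \<open>Integer powers of a bijection.\<close>

definition int_funpow :: "('a \<Rightarrow> 'a) \<Rightarrow> int \<Rightarrow> 'a \<Rightarrow> 'a" where
  "int_funpow f n = (if 0 \<le> n then f ^^ nat n else inv f ^^ nat (- n))"

definition V0 :: "(real \<Rightarrow> complex) \<Rightarrow> (real \<Rightarrow> complex) set" where
  "V0 \<phi> = closed_span lborel (range (\<lambda>(k::int) x. \<phi> (x - of_int k)))"

definition father_function :: "nat \<Rightarrow> (real \<Rightarrow> complex) \<Rightarrow> bool" where
  "father_function N \<phi> \<longleftrightarrow>
     \<phi> \<in> L2 lborel \<and>
     (\<forall>k l::int. L2_inner lborel (\<lambda>x. \<phi> (x - of_int k)) (\<lambda>x. \<phi> (x - of_int l)) =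
        (if k = l then 1 else 0)) \<and>
     dilate N \<phi> \<in> V0 \<phi> \<and>
     (\<forall>\<xi>. (\<forall>n. \<xi> \<in> int_funpow (dilate N) n ` V0 \<phi>) \<longrightarrow> (AE x in lborel. \<xi> x = 0)) \<and>
     (\<forall>\<xi>\<in>L2 lborel. \<forall>e>0. \<exists>n. \<exists>\<eta>\<in>int_funpow (dilate N) n ` V0 \<phi>.
        L2_norm lborel (\<lambda>x. \<xi> x - \<eta> x) < e)"

text \<open>\<open>m0\<close> is the function on the circle whose coefficients are those of \<open>dilate N \<phi>\<close>
  with respect to the integer translates of \<open>\<phi>\<close>.\<close>

definition father_filter :: "nat \<Rightarrow> (real \<Rightarrow> complex) \<Rightarrow> (complex \<Rightarrow> complex) \<Rightarrow> bool" where
  "father_filter N \<phi> m0 \<longleftrightarrow> (\<exists>a :: int \<Rightarrow> complex.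
     L2_has_sum lborel (\<lambda>k x. a k * \<phi> (x - of_int k)) (dilate N \<phi>) UNIV \<and>
     L2_has_sum haar_circle (\<lambda>k z. a k * z powi k) m0 UNIV)"

definition unitary_entries :: "nat \<Rightarrow> (nat \<Rightarrow> nat \<Rightarrow> complex) \<Rightarrow> bool" where
  "unitary_entries n A \<longleftrightarrow>
     (\<forall>i<n. \<forall>j<n. (\<Sum>k<n. A i k * cnj (A j k)) = (if i = j then 1 else 0)) \<and>
     (\<forall>i<n. \<forall>j<n. (\<Sum>k<n. cnj (A k i) * A k j) = (if i = j then 1 else 0))"

text \<open>\<open>m 0\<close> is the function belonging to \<open>\<phi>\<close>; the mother functions \<open>\<psi> i\<close> and
  their functions \<open>m i\<close> on the circle are indexed by \<open>1 \<le> i < N\<close>.\<close>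

definition mother_functions ::
  "nat \<Rightarrow> (real \<Rightarrow> complex) \<Rightarrow> (nat \<Rightarrow> complex \<Rightarrow> complex) \<Rightarrow> (nat \<Rightarrow> real \<Rightarrow> complex) \<Rightarrow> bool" where
  "mother_functions N \<phi> m \<psi> \<longleftrightarrow>
     (\<forall>i\<in>{1..<N}. m i \<in> borel_measurable haar_circle) \<and>
     (AE z in haar_circle.
        unitary_entries N (\<lambda>i k. m i (cis (2 * pi / real N) ^ k * z) / of_real (sqrt (real N)))) \<and>
     (\<forall>i\<in>{1..<N}. \<psi> i \<in> L2 lborel \<and>
        (AE t in lborel.
           of_real (sqrt (real N)) * fourier (\<psi> i) (real N * t) = m i (cis (- t)) * fourier \<phi> t))"

definition wavelet ::
  "nat \<Rightarrow> (nat \<Rightarrow> real \<Rightarrow> complex) \<Rightarrow> nat \<Rightarrow> int \<Rightarrow> int \<Rightarrow> real \<Rightarrow> complex" where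
  "wavelet N \<psi> i j k = int_funpow (dilate N) j (int_funpow translate k (\<psi> i))"

definition wavelet_expansion ::
  "nat \<Rightarrow> (nat \<Rightarrow> real \<Rightarrow> complex) \<Rightarrow> (real \<Rightarrow> complex) \<Rightarrow> (nat \<Rightarrow> int \<Rightarrow> int \<Rightarrow> complex) \<Rightarrow> bool"
where
  "wavelet_expansion N \<psi> \<xi> a \<longleftrightarrow>
     L2_has_sum lborel (\<lambda>(i, j, k) x. a i j k * wavelet N \<psi> i j k x) \<xi> ({1..<N} \<times> UNIV \<times> UNIV)"

end

theory Submission
  imports Defs
begin

text \<open>
  By Plancherel, \<open>f \<mapsto> f (cis (- t)) * fourier \<phi> t\<close> is an isometry from \<open>L\<^sup>2\<close> of the circle: the image of
  \<open>|fourier \<phi> t|\<^sup>2 dt\<close> under \<open>t \<mapsto> cis (- t)\<close> has the moments \<open>\<langle>\<phi>(\<cdot> - k), \<phi>\<rangle>\<close>, hence is Haar measure. Density of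
  trigonometric polynomials shows that its range is the Fourier image of \<open>V0 \<phi>\<close>. Dilation by
  \<open>N\<close> becomes \<open>S\<^sub>0\<close>, and the wavelet with indices \<open>i\<close>, \<open>j \<ge> 1\<close>, \<open>k\<close> corresponds to
  \<open>S\<^sub>0\<^sup>j\<^sup>-\<^sup>1 S\<^sub>i z\<^sup>k\<close>. Unitarity gives \<open>S\<^sub>i\<^sup>* S\<^sub>j = \<delta>\<^sub>i\<^sub>j\<close>, from which orthonormality of the wavelets, orthogonality of
  those with \<open>j \<le> 0\<close> to \<open>V0 \<phi>\<close>, and the coefficient formula follow.

  Plancherel itself comes from Parseval's identity on the circle: for \<open>f\<close> supported in \<open>[-1, 1]\<close> the
  transform sampled on \<open>s + \<int>\<close> consists of Fourier coefficients, so its square sum is independent of \<open>s\<close>,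
  and one integrates over \<open>s\<close> in \<open>[0, 1)\<close>.
\<close>

section \<open>Square-integrable functions\<close>

text \<open>\<open>fourier\<close> selects its value by choice and only up to null sets, so its
  algebraic rules hold almost everywhere and come from uniqueness of L2 limits. For the same reason
  the link between a function in \<open>V0 \<phi>\<close> and its multiplier on the circle is kept
  as a relation, \<open>has_symbol\<close>, stable under sums and limits.

  Wavelets of scale \<open>j \<le> 0\<close> lie outside \<open>V0 \<phi>\<close> and have no such
  multiplier. Since dilation is unitary, every inner product can be moved to scales where both
  factors lie in \<open>V0 \<phi>\<close>, and is then computed on the circle.

  The filters come without a bound. Unitarity of the filter matrix bounds them by
  \<open>sqrt N\<close> almost everywhere; this makes the operators act on L2 and lets the adjoint
  relation be stated for merely integrable functions, a class that \<open>S_adj\<close> preserves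
  and on which it can be iterated.

  One criterion, that Haar measure is determined by its moments, serves three times: for rotations,
  for \<open>z \<mapsto> z ^ n\<close>, and for the energy of \<open>fourier \<phi>\<close>.\<close>

lemma borel_measurable_cnj [measurable (raw)]:
  "f \<in> borel_measurable M \<Longrightarrow> (\<lambda>x. cnj (f x)) \<in> borel_measurable M"
  by (rule borel_measurable_continuous_on) (auto intro: continuous_intros)

lemma L2_borel: "f \<in> L2 M \<Longrightarrow> f \<in> borel_measurable M"
  by (simp add: L2_def)

lemma L2_integrable: "f \<in> L2 M \<Longrightarrow> integrable M (\<lambda>x. (cmod (f x))\<^sup>2)"
  by (simp add: L2_def)

lemma L2_mult_integrable:
  assumes "f \<in> L2 M" "g \<in> L2 M"
  shows "integrable M (\<lambda>x. f x * cnj (g x))"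
proof (rule Bochner_Integration.integrable_bound)
  show "integrable M (\<lambda>x. (cmod (f x))\<^sup>2 + (cmod (g x))\<^sup>2)"
    using assms by (simp add: L2_integrable)
  show "(\<lambda>x. f x * cnj (g x)) \<in> borel_measurable M"
    using L2_borel[OF assms(1), measurable] L2_borel[OF assms(2), measurable] by measurable
  show "AE x in M. norm (f x * cnj (g x)) \<le> norm ((cmod (f x))\<^sup>2 + (cmod (g x))\<^sup>2)"
  proof (rule AE_I2)
    fix x
    have "2 * (cmod (f x) * cmod (g x)) \<le> (cmod (f x))\<^sup>2 + (cmod (g x))\<^sup>2"
      using sum_squares_bound[of "cmod (f x)" "cmod (g x)"] by simp
    moreover have "0 \<le> cmod (f x) * cmod (g x)" by simp
    ultimately show "norm (f x * cnj (g x)) \<le> norm ((cmod (f x))\<^sup>2 + (cmod (g x))\<^sup>2)"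
      unfolding norm_mult complex_mod_cnj real_norm_def by linarith
  qed
qed

lemma L2_zero [simp]: "(\<lambda>x. 0) \<in> L2 M"
  by (simp add: L2_def)

lemma L2_cmult: "f \<in> L2 M \<Longrightarrow> (\<lambda>x. c * f x) \<in> L2 M"
  by (auto simp: L2_def norm_mult power_mult_distrib)

lemma L2_add:
  assumes "f \<in> L2 M" "g \<in> L2 M"
  shows "(\<lambda>x. f x + g x) \<in> L2 M"
proof -
  have m: "(\<lambda>x. f x + g x) \<in> borel_measurable M"
    using assms by (auto simp: L2_def)
  have "integrable M (\<lambda>x. (cmod (f x + g x))\<^sup>2)"
  proof (rule Bochner_Integration.integrable_bound)
    show "integrable M (\<lambda>x. 2 * (cmod (f x))\<^sup>2 + 2 * (cmod (g x))\<^sup>2)"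
      using assms by (simp add: L2_integrable)
    show "AE x in M. norm ((cmod (f x + g x))\<^sup>2) \<le> norm (2 * (cmod (f x))\<^sup>2 + 2 * (cmod (g x))\<^sup>2)"
    proof (rule AE_I2)
      fix x
      have "(cmod (f x + g x))\<^sup>2 \<le> (cmod (f x) + cmod (g x))\<^sup>2"
        by (simp add: norm_triangle_ineq power_mono)
      also have "\<dots> \<le> 2 * (cmod (f x))\<^sup>2 + 2 * (cmod (g x))\<^sup>2"
        using sum_squares_bound[of "cmod (f x)" "cmod (g x)"] by (simp add: power2_sum)
      finally show "norm ((cmod (f x + g x))\<^sup>2) \<le> norm (2 * (cmod (f x))\<^sup>2 + 2 * (cmod (g x))\<^sup>2)"
        by simp
    qed
  qed (use m in measurable)
  with m show ?thesis by (simp add: L2_def)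
qed

lemma L2_diff:
  assumes "f \<in> L2 M" "g \<in> L2 M"
  shows "(\<lambda>x. f x - g x) \<in> L2 M"
  using L2_add[OF assms(1) L2_cmult[OF assms(2), of "-1"]] by simp

lemma L2_sum: "(\<And>i. i \<in> I \<Longrightarrow> F i \<in> L2 M) \<Longrightarrow> (\<lambda>x. \<Sum>i\<in>I. F i x) \<in> L2 M"
  by (induction I rule: infinite_finite_induct) (auto intro: L2_add)

lemma L2_norm_nonneg [simp]: "0 \<le> L2_norm M f"
  by (simp add: L2_norm_def)

lemma L2_norm_sq: "(L2_norm M f)\<^sup>2 = (LINT x|M. (cmod (f x))\<^sup>2)"
  by (simp add: L2_norm_def)

lemma L2_norm_zero [simp]: "L2_norm M (\<lambda>x. 0) = 0"
  by (simp add: L2_norm_def)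

lemma L2_norm_cong_AE:
  assumes "AE x in M. f x = g x" "f \<in> borel_measurable M" "g \<in> borel_measurable M"
  shows "L2_norm M f = L2_norm M g"
  unfolding L2_norm_def
  by (intro arg_cong[where f=sqrt] integral_cong_AE) (use assms in \<open>auto elim: AE_mp\<close>)

lemma L2_norm_cmult: "L2_norm M (\<lambda>x. c * f x) = cmod c * L2_norm M f"
  by (simp add: L2_norm_def norm_mult power_mult_distrib real_sqrt_mult)

lemma L2_norm_minus: "L2_norm M (\<lambda>x. f x - g x) = L2_norm M (\<lambda>x. g x - f x)"
  by (simp add: L2_norm_def norm_minus_commute)

lemma L2_norm_eq_0:
  assumes "f \<in> L2 M" "L2_norm M f = 0"
  shows "AE x in M. f x = 0"
proof -
  have "AE x in M. (cmod (f x))\<^sup>2 = 0"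
    using assms integral_nonneg_eq_0_iff_AE[OF L2_integrable[OF assms(1)]]
    by (simp add: L2_norm_def)
  then show ?thesis by simp
qed

lemma nn_integral_L2:
  "f \<in> L2 M \<Longrightarrow> (\<integral>\<^sup>+x. ennreal ((cmod (f x))\<^sup>2) \<partial>M) = ennreal ((L2_norm M f)\<^sup>2)"
  unfolding L2_norm_sq by (rule nn_integral_eq_integral) (auto simp: L2_integrable)

lemma L2_I_nn_integral:
  assumes "f \<in> borel_measurable M" "(\<integral>\<^sup>+x. ennreal ((cmod (f x))\<^sup>2) \<partial>M) < \<infinity>"
  shows "f \<in> L2 M"
  using assms by (auto simp: L2_def integrable_iff_bounded)

lemma L2_norm_eq_nn_integral:
  assumes "f \<in> borel_measurable M" "(\<integral>\<^sup>+x. ennreal ((cmod (f x))\<^sup>2) \<partial>M) = ennreal (c\<^sup>2)" "0 \<le> c"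
  shows "f \<in> L2 M" "L2_norm M f = c"
proof -
  show *: "f \<in> L2 M" using assms by (intro L2_I_nn_integral) auto
  have "(L2_norm M f)\<^sup>2 = c\<^sup>2"
    using nn_integral_L2[OF *] assms(2) by simp
  then show "L2_norm M f = c" using assms(3) by (simp add: power2_eq_iff_nonneg)
qed

lemma L2_inner_add_left:
  assumes "f \<in> L2 M" "g \<in> L2 M" "h \<in> L2 M"
  shows "L2_inner M (\<lambda>x. f x + g x) h = L2_inner M f h + L2_inner M g h"
  unfolding L2_inner_def using assms
  by (simp add: distrib_right L2_mult_integrable)

lemma L2_inner_diff_left:
  assumes "f \<in> L2 M" "g \<in> L2 M" "h \<in> L2 M"
  shows "L2_inner M (\<lambda>x. f x - g x) h = L2_inner M f h - L2_inner M g h"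
  unfolding L2_inner_def using assms
  by (simp add: left_diff_distrib L2_mult_integrable)

lemma L2_inner_cmult_left: "L2_inner M (\<lambda>x. c * f x) h = c * L2_inner M f h"
  by (simp add: L2_inner_def mult.assoc)

lemma L2_inner_sum_left:
  assumes "\<And>i. i \<in> I \<Longrightarrow> F i \<in> L2 M" "h \<in> L2 M"
  shows "L2_inner M (\<lambda>x. \<Sum>i\<in>I. F i x) h = (\<Sum>i\<in>I. L2_inner M (F i) h)"
  using assms
proof (induction I rule: infinite_finite_induct)
  case (insert i I)
  then show ?case by (simp add: L2_inner_add_left L2_sum)
qed (auto simp: L2_inner_def)

lemma L2_inner_commute: "L2_inner M g f = cnj (L2_inner M f g)"
  unfolding L2_inner_def
  using Bochner_Integration.integral_cnj[of M "\<lambda>x. f x * cnj (g x)"] by (simp add: mult.commute del: Bochner_Integration.integral_cnj)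

lemma L2_inner_self: "L2_inner M f f = of_real ((L2_norm M f)\<^sup>2)"
  unfolding L2_inner_def L2_norm_sq
  by (simp only: integral_complex_of_real[symmetric] complex_norm_square)

lemma L2_inner_cong_AE:
  assumes "AE x in M. f x = f' x" "AE x in M. g x = g' x"
    and [measurable]: "f \<in> borel_measurable M" "f' \<in> borel_measurable M"
      "g \<in> borel_measurable M" "g' \<in> borel_measurable M"
  shows "L2_inner M f g = L2_inner M f' g'"
  unfolding L2_inner_def
  by (intro integral_cong_AE) (use assms(1,2) in \<open>auto elim: AE_mp\<close>)

lemma L2_Cauchy_Schwarz:
  assumes "f \<in> L2 M" "g \<in> L2 M"
  shows "cmod (L2_inner M f g) \<le> L2_norm M f * L2_norm M g"
proof -
  note [measurable] = L2_borel[OF assms(1)] L2_borel[OF assms(2)]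
  have "ennreal (cmod (L2_inner M f g)) \<le> (\<integral>\<^sup>+x. ennreal (cmod (f x * cnj (g x))) \<partial>M)"
    unfolding L2_inner_def by (intro integral_norm_bound_ennreal L2_mult_integrable assms)
  also have "\<dots> = (\<integral>\<^sup>+x. ennreal (cmod (f x)) * ennreal (cmod (g x)) \<partial>M)"
    by (simp add: norm_mult ennreal_mult)
  finally have "(ennreal (cmod (L2_inner M f g)))\<^sup>2 \<le> (\<integral>\<^sup>+x. ennreal (cmod (f x)) * ennreal (cmod (g x)) \<partial>M)\<^sup>2"
    by (intro power_mono) auto
  also have "\<dots> \<le> (\<integral>\<^sup>+x. (ennreal (cmod (f x)))\<^sup>2 \<partial>M) * (\<integral>\<^sup>+x. (ennreal (cmod (g x)))\<^sup>2 \<partial>M)"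
    by (rule Cauchy_Schwarz_nn_integral) measurable
  also have "\<dots> = ennreal ((L2_norm M f)\<^sup>2 * (L2_norm M g)\<^sup>2)"
    using assms by (simp add: ennreal_power nn_integral_L2 ennreal_mult)
  finally have "(cmod (L2_inner M f g))\<^sup>2 \<le> (L2_norm M f * L2_norm M g)\<^sup>2"
    by (simp add: ennreal_power power_mult_distrib)
  then show ?thesis by (rule power2_le_imp_le) simp
qed

text \<open>Gives the triangle inequality here and the completed square behind Parseval's identity;
  read backwards, it recovers real parts of inner products from norms.\<close>

lemma L2_norm_add_sq:
  assumes "f \<in> L2 M" "g \<in> L2 M"
  shows "(L2_norm M (\<lambda>x. f x + g x))\<^sup>2 = (L2_norm M f)\<^sup>2 + 2 * Re (L2_inner M f g) + (L2_norm M g)\<^sup>2"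
proof -
  let ?h = "\<lambda>x. f x + g x"
  have h: "?h \<in> L2 M" by (rule L2_add[OF assms])
  have "complex_of_real ((L2_norm M ?h)\<^sup>2) = L2_inner M f ?h + L2_inner M g ?h"
    unfolding L2_inner_self[symmetric] by (rule L2_inner_add_left[OF assms h])
  also have "\<dots> = cnj (L2_inner M ?h f) + cnj (L2_inner M ?h g)"
    by (metis L2_inner_commute)
  also have "\<dots> = cnj (L2_inner M f f) + cnj (L2_inner M g f) + cnj (L2_inner M f g) + cnj (L2_inner M g g)"
    by (simp add: L2_inner_add_left assms)
  also have "\<dots> = of_real ((L2_norm M f)\<^sup>2) + (L2_inner M f g + cnj (L2_inner M f g)) + of_real ((L2_norm M g)\<^sup>2)"
    using L2_inner_commute[of M f g] by (simp add: L2_inner_self)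
  also have "\<dots> = of_real ((L2_norm M f)\<^sup>2 + 2 * Re (L2_inner M f g) + (L2_norm M g)\<^sup>2)"
    by (simp add: complex_add_cnj)
  finally show ?thesis by (simp only: of_real_eq_iff)
qed

lemma L2_triangle:
  assumes "f \<in> L2 M" "g \<in> L2 M"
  shows "L2_norm M (\<lambda>x. f x + g x) \<le> L2_norm M f + L2_norm M g"
proof (rule power2_le_imp_le)
  have "Re (L2_inner M f g) \<le> L2_norm M f * L2_norm M g"
    using L2_Cauchy_Schwarz[OF assms] complex_Re_le_cmod[of "L2_inner M f g"] by linarith
  then show "(L2_norm M (\<lambda>x. f x + g x))\<^sup>2 \<le> (L2_norm M f + L2_norm M g)\<^sup>2"
    by (simp add: L2_norm_add_sq[OF assms] power2_sum)
qed simp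

lemma L2_triangle_diff:
  assumes "f \<in> L2 M" "g \<in> L2 M" "h \<in> L2 M"
  shows "L2_norm M (\<lambda>x. f x - h x) \<le> L2_norm M (\<lambda>x. f x - g x) + L2_norm M (\<lambda>x. g x - h x)"
  using L2_triangle[OF L2_diff[OF assms(1,2)] L2_diff[OF assms(2,3)]] by simp

lemma L2_triangle_sum:
  assumes "\<And>i. i \<in> I \<Longrightarrow> F i \<in> L2 M"
  shows "L2_norm M (\<lambda>x. \<Sum>i\<in>I. F i x) \<le> (\<Sum>i\<in>I. L2_norm M (F i))"
  using assms
proof (induction I rule: infinite_finite_induct)
  case (insert i I)
  then have "L2_norm M (\<lambda>x. F i x + (\<Sum>i\<in>I. F i x)) \<le> L2_norm M (F i) + L2_norm M (\<lambda>x. \<Sum>i\<in>I. F i x)"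
    by (intro L2_triangle) (auto intro: L2_sum)
  with insert show ?case by fastforce
qed auto

lemma L2_norm_diff_abs:
  assumes "f \<in> L2 M" "g \<in> L2 M"
  shows "\<bar>L2_norm M f - L2_norm M g\<bar> \<le> L2_norm M (\<lambda>x. f x - g x)"
  using L2_triangle_diff[OF assms L2_zero] L2_triangle_diff[OF assms(2,1) L2_zero]
  unfolding L2_norm_minus[of M g f] by simp

lemma L2_limD:
  assumes "L2_lim M F f net"
  shows "F n \<in> L2 M" "f \<in> L2 M" "((\<lambda>n. L2_norm M (\<lambda>x. F n x - f x)) \<longlongrightarrow> 0) net"
  using assms by (auto simp: L2_lim_def)

lemma L2_lim_unique:
  assumes "L2_lim M F f net" "L2_lim M F g net" "net \<noteq> bot"
  shows "AE x in M. f x = g x"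
proof -
  note F = L2_limD[OF assms(1)] and G = L2_limD[OF assms(2)]
  have "((\<lambda>n. L2_norm M (\<lambda>x. F n x - f x) + L2_norm M (\<lambda>x. F n x - g x)) \<longlongrightarrow> 0 + 0) net"
    by (intro tendsto_add F G)
  moreover have "L2_norm M (\<lambda>x. f x - g x) \<le> L2_norm M (\<lambda>x. F n x - f x) + L2_norm M (\<lambda>x. F n x - g x)" for n
    using L2_triangle_diff[OF F(2) F(1)[of n] G(2)] unfolding L2_norm_minus[of M f "F n"] .
  ultimately have "L2_norm M (\<lambda>x. f x - g x) \<le> 0"
    using assms(3) by (intro tendsto_lowerbound[where F=net]) (auto intro: always_eventually)
  then have "AE x in M. f x - g x = 0"
    by (intro L2_norm_eq_0 L2_diff F G antisym) auto
  then show ?thesis by simp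
qed

lemma L2_lim_norm:
  assumes "L2_lim M F f net"
  shows "((\<lambda>n. L2_norm M (F n)) \<longlongrightarrow> L2_norm M f) net"
proof -
  note F = L2_limD[OF assms]
  have "((\<lambda>n. L2_norm M (F n) - L2_norm M f) \<longlongrightarrow> 0) net"
    by (rule Lim_null_comparison[OF _ F(3)])
       (use L2_norm_diff_abs[OF F(1) F(2)] in \<open>auto intro: always_eventually\<close>)
  then show ?thesis by (simp add: LIM_zero_iff)
qed

lemma L2_lim_inner:
  assumes "L2_lim M F f net" "g \<in> L2 M"
  shows "((\<lambda>n. L2_inner M (F n) g) \<longlongrightarrow> L2_inner M f g) net"
proof -
  note F = L2_limD[OF assms(1)]
  have "((\<lambda>n. L2_norm M (\<lambda>x. F n x - f x) * L2_norm M g) \<longlongrightarrow> 0) net"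
    using tendsto_mult_right[OF F(3), of "L2_norm M g"] by simp
  then have "((\<lambda>n. L2_inner M (F n) g - L2_inner M f g) \<longlongrightarrow> 0) net"
    by (rule Lim_null_comparison[rotated])
       (use L2_Cauchy_Schwarz[OF L2_diff[OF F(1) F(2)] assms(2)]
        in \<open>auto intro!: always_eventually simp: L2_inner_diff_left F(1) F(2) assms(2)\<close>)
  then show ?thesis by (simp add: LIM_zero_iff)
qed

lemma L2_lim_cmult:
  assumes "L2_lim M F f net"
  shows "L2_lim M (\<lambda>n x. c * F n x) (\<lambda>x. c * f x) net"
proof -
  note F = L2_limD[OF assms]
  have "L2_norm M (\<lambda>x. c * F n x - c * f x) = cmod c * L2_norm M (\<lambda>x. F n x - f x)" for n
    by (simp flip: L2_norm_cmult right_diff_distrib)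
  then show ?thesis
    using tendsto_mult_left[OF F(3), of "cmod c"] F by (simp add: L2_lim_def L2_cmult)
qed

lemma L2_lim_add:
  assumes "L2_lim M F f net" "L2_lim M G g net"
  shows "L2_lim M (\<lambda>n x. F n x + G n x) (\<lambda>x. f x + g x) net"
proof -
  note F = L2_limD[OF assms(1)] and G = L2_limD[OF assms(2)]
  have lim: "((\<lambda>n. L2_norm M (\<lambda>x. F n x - f x) + L2_norm M (\<lambda>x. G n x - g x)) \<longlongrightarrow> 0) net"
    using tendsto_add[OF F(3) G(3)] by simp
  have "norm (L2_norm M (\<lambda>x. F n x + G n x - (f x + g x))) \<le>
      L2_norm M (\<lambda>x. F n x - f x) + L2_norm M (\<lambda>x. G n x - g x)" for n
    using L2_triangle[OF L2_diff[OF F(1,2)] L2_diff[OF G(1,2)], of n n]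
    by (simp add: algebra_simps)
  then have "((\<lambda>n. L2_norm M (\<lambda>x. F n x + G n x - (f x + g x))) \<longlongrightarrow> 0) net"
    by (rule Lim_null_comparison[OF always_eventually[OF allI] lim])
  then show ?thesis using F G by (simp add: L2_lim_def L2_add)
qed

section \<open>Completeness of L2 (Riesz-Fischer)\<close>

text \<open>A subsequence with summable consecutive distances converges almost everywhere. Fatou's
  lemma along it turns the Cauchy bound into a bound on the distance to the pointwise limit, for
  every index of the full sequence.\<close>

theorem L2_complete:
  fixes F :: "nat \<Rightarrow> 'a \<Rightarrow> complex"
  assumes F: "\<And>n. F n \<in> L2 M"
    and Cauchy: "\<And>e. 0 < e \<Longrightarrow> \<exists>N. \<forall>m\<ge>N. \<forall>n\<ge>N. L2_norm M (\<lambda>x. F m x - F n x) < e"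
  shows "\<exists>f. L2_lim M F f sequentially"
proof -
  note [measurable] = L2_borel[OF F]
  obtain N where N: "\<And>k m n. N k \<le> m \<Longrightarrow> N k \<le> n \<Longrightarrow> L2_norm M (\<lambda>x. F m x - F n x) < (1/2)^k"
    using Cauchy[of "(1/2)^_"] by (metis zero_less_divide_1_iff zero_less_numeral zero_less_power)
  \<comment> \<open>The maximum keeps \<open>r k\<close> beyond \<open>N k\<close> and makes
    \<open>r\<close> strictly increasing, so both \<open>r k\<close> and \<open>r (Suc k)\<close>
    lie past the threshold for \<open>(1/2)^k\<close>.\<close>
  define r where "r = rec_nat (N 0) (\<lambda>k r. max (N (Suc k)) (Suc r))"
  have r_ge: "N k \<le> r k" for k by (cases k) (auto simp: r_def)
  have r_Suc: "r k < r (Suc k)" for k by (auto simp: r_def)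
  have r_mono: "strict_mono r" by (rule strict_mono_Suc_iff[THEN iffD2]) (use r_Suc in auto)
  \<comment> \<open>The moduli are cast back to complex numbers so that the triangle inequality for
    \<open>L2_norm\<close> applies to their sums.\<close>
  define g where "g k x = complex_of_real (cmod (F (r (Suc k)) x - F (r k) x))" for k x
  have g_L2: "g k \<in> L2 M" for k
    using L2_integrable[OF L2_diff[OF F F]] unfolding L2_def g_def by simp
  have g_norm: "L2_norm M (g k) \<le> (1/2)^k" for k
  proof -
    have "L2_norm M (g k) = L2_norm M (\<lambda>x. F (r (Suc k)) x - F (r k) x)"
      by (simp add: L2_norm_def g_def)
    also have "\<dots> < (1/2)^k"
      by (rule N) (use r_ge[of k] r_Suc[of k] in auto)
    finally show ?thesis by simp
  qed
  have part: "L2_norm M (\<lambda>x. \<Sum>k<K. g k x) \<le> 2" for K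
  proof -
    have "L2_norm M (\<lambda>x. \<Sum>k<K. g k x) \<le> (\<Sum>k<K. L2_norm M (g k))"
      by (rule L2_triangle_sum) (rule g_L2)
    also have "\<dots> \<le> (\<Sum>k<K. (1/2)^k)" by (rule sum_mono) (rule g_norm)
    also have "\<dots> \<le> (\<Sum>k. (1/2::real)^k)" by (rule sum_le_suminf) auto
    also have "\<dots> = 2" by (simp add: suminf_geometric)
    finally show ?thesis .
  qed
  define S where "S K x = ennreal ((cmod (\<Sum>k<K. g k x))\<^sup>2)" for K x
  have gsum: "cmod (\<Sum>k<K. g k x) = (\<Sum>k<K. cmod (F (r (Suc k)) x - F (r k) x))" for K x
  proof -
    have "(\<Sum>k<K. g k x) = of_real (\<Sum>k<K. cmod (F (r (Suc k)) x - F (r k) x))"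
      by (simp add: g_def)
    moreover have "0 \<le> (\<Sum>k<K. cmod (F (r (Suc k)) x - F (r k) x))"
      by (simp add: sum_nonneg)
    ultimately show ?thesis by (simp only: norm_of_real abs_of_nonneg)
  qed
  have [measurable]: "S K \<in> borel_measurable M" for K
    unfolding S_def g_def by measurable
  have "incseq S"
  proof (rule incseq_SucI, rule le_funI)
    fix K x show "S K x \<le> S (Suc K) x"
      unfolding S_def gsum by (intro ennreal_leI power_mono) (auto intro: sum_nonneg)
  qed
  then have "(\<integral>\<^sup>+x. (SUP K. S K x) \<partial>M) = (SUP K. \<integral>\<^sup>+x. S K x \<partial>M)"
    by (intro nn_integral_monotone_convergence_SUP) auto
  also have "\<dots> \<le> ennreal 4"
  proof (rule SUP_least)
    fix K
    have "(\<integral>\<^sup>+x. S K x \<partial>M) = ennreal ((L2_norm M (\<lambda>x. \<Sum>k<K. g k x))\<^sup>2)"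
      unfolding S_def by (intro nn_integral_L2 L2_sum g_L2)
    also have "\<dots> \<le> ennreal (2\<^sup>2)" using part[of K] by (intro ennreal_leI power_mono) auto
    finally show "(\<integral>\<^sup>+x. S K x \<partial>M) \<le> ennreal 4" by simp
  qed
  finally have "(\<integral>\<^sup>+x. (SUP K. S K x) \<partial>M) \<noteq> \<infinity>" by (auto simp: top_unique)
  then have fin: "AE x in M. (SUP K. S K x) \<noteq> \<infinity>"
    by (intro nn_integral_PInf_AE) auto
  have conv: "AE x in M. convergent (\<lambda>k. F (r k) x)"
    using fin
  proof eventually_elim
    fix x assume "(SUP K. S K x) \<noteq> \<infinity>"
    then obtain c where c: "0 \<le> c" "(SUP K. S K x) = ennreal c" by (cases "SUP K. S K x") auto
    have "(\<Sum>k<K. cmod (F (r (Suc k)) x - F (r k) x)) \<le> sqrt c" for K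
    proof -
      have "S K x \<le> ennreal c" unfolding c(2)[symmetric] by (rule SUP_upper) simp
      then have "(\<Sum>k<K. cmod (F (r (Suc k)) x - F (r k) x))\<^sup>2 \<le> c"
        unfolding S_def gsum using c(1) by simp
      then show ?thesis by (rule real_le_rsqrt)
    qed
    then have "summable (\<lambda>k. cmod (F (r (Suc k)) x - F (r k) x))"
      by (intro summableI_nonneg_bounded) auto
    then have "summable (\<lambda>k. F (r (Suc k)) x - F (r k) x)"
      by (rule summable_norm_cancel)
    then have "convergent (\<lambda>K. \<Sum>k<K. F (r (Suc k)) x - F (r k) x)"
      by (simp add: summable_iff_convergent)
    then have "convergent (\<lambda>K. F (r K) x - F (r 0) x)"
      by (simp only: sum_lessThan_telescope[of "\<lambda>k. F (r k) x"])
    then have "convergent (\<lambda>K. (F (r K) x - F (r 0) x) + F (r 0) x)"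
      by (intro convergent_add convergent_const)
    then show "convergent (\<lambda>k. F (r k) x)" by simp
  qed
  define f where "f x = lim (\<lambda>k. F (r k) x)" for x
  have [measurable]: "f \<in> borel_measurable M"
    unfolding f_def by (rule borel_measurable_lim_metric) simp
  \<comment> \<open>Fatou's lemma. The bound is stated for arbitrary \<open>m\<close> and
    \<open>e\<close> because it is used twice: for \<open>f\<close> being in L2, and for the
    convergence itself.\<close>
  have close: "(\<integral>\<^sup>+x. ennreal ((cmod (F m x - f x))\<^sup>2) \<partial>M) \<le> ennreal (e\<^sup>2)"
    if m: "\<And>n. K \<le> n \<Longrightarrow> L2_norm M (\<lambda>x. F m x - F n x) \<le> e" for m e K
  proof -
    have "(\<integral>\<^sup>+x. ennreal ((cmod (F m x - f x))\<^sup>2) \<partial>M) =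
        (\<integral>\<^sup>+x. liminf (\<lambda>k. ennreal ((cmod (F m x - F (r k) x))\<^sup>2)) \<partial>M)"
    proof (rule nn_integral_cong_AE, use conv in eventually_elim)
      fix x assume "convergent (\<lambda>k. F (r k) x)"
      then have "(\<lambda>k. F (r k) x) \<longlonglongrightarrow> f x" by (simp add: f_def convergent_LIMSEQ_iff)
      then have "(\<lambda>k. ennreal ((cmod (F m x - F (r k) x))\<^sup>2)) \<longlonglongrightarrow> ennreal ((cmod (F m x - f x))\<^sup>2)"
        by (intro tendsto_intros)
      then show "ennreal ((cmod (F m x - f x))\<^sup>2) = liminf (\<lambda>k. ennreal ((cmod (F m x - F (r k) x))\<^sup>2))"
        by (rule lim_imp_Liminf[OF sequentially_bot, symmetric])
    qed
    also have "\<dots> \<le> liminf (\<lambda>k. \<integral>\<^sup>+x. ennreal ((cmod (F m x - F (r k) x))\<^sup>2) \<partial>M)"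
      by (rule nn_integral_liminf) measurable
    also have "\<dots> \<le> ennreal (e\<^sup>2)"
    proof -
      have "\<forall>\<^sub>F k in sequentially. (\<integral>\<^sup>+x. ennreal ((cmod (F m x - F (r k) x))\<^sup>2) \<partial>M) \<le> ennreal (e\<^sup>2)"
        using eventually_ge_at_top[of K]
      proof eventually_elim
        fix k assume "K \<le> k"
        then have "K \<le> r k" using seq_suble[OF r_mono, of k] by simp
        then have "(L2_norm M (\<lambda>x. F m x - F (r k) x))\<^sup>2 \<le> e\<^sup>2" by (intro power_mono m) auto
        then show "(\<integral>\<^sup>+x. ennreal ((cmod (F m x - F (r k) x))\<^sup>2) \<partial>M) \<le> ennreal (e\<^sup>2)"
          by (subst nn_integral_L2) (auto intro: L2_diff F ennreal_leI)
      qed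
      then have "limsup (\<lambda>k. \<integral>\<^sup>+x. ennreal ((cmod (F m x - F (r k) x))\<^sup>2) \<partial>M) \<le> ennreal (e\<^sup>2)"
        by (rule Limsup_bounded)
      then show ?thesis
        using Liminf_le_Limsup[OF sequentially_bot, of "\<lambda>k. \<integral>\<^sup>+x. ennreal ((cmod (F m x - F (r k) x))\<^sup>2) \<partial>M"]
        by (rule order_trans[rotated])
    qed
    finally show ?thesis .
  qed
  \<comment> \<open>The tolerance 1 is \<open>(1/2)^0\<close>; any finite bound would do for
    membership of \<open>f\<close> in L2.\<close>
  have "\<And>n. N 0 \<le> n \<Longrightarrow> L2_norm M (\<lambda>x. F (N 0) x - F n x) \<le> 1"
    using N[of 0 "N 0"] by (simp add: less_imp_le)
  then have "(\<integral>\<^sup>+x. ennreal ((cmod (F (N 0) x - f x))\<^sup>2) \<partial>M) \<le> ennreal (1\<^sup>2)" by (rule close)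
  then have "(\<integral>\<^sup>+x. ennreal ((cmod (F (N 0) x - f x))\<^sup>2) \<partial>M) < \<infinity>"
    by (rule order.strict_trans1) simp
  then have "(\<lambda>x. F (N 0) x - f x) \<in> L2 M" by (intro L2_I_nn_integral) auto
  from L2_diff[OF F[of "N 0"] this] have f: "f \<in> L2 M" by simp
  have "(\<lambda>n. L2_norm M (\<lambda>x. F n x - f x)) \<longlonglongrightarrow> 0"
  proof (rule LIMSEQ_I)
    fix e :: real assume e: "0 < e"
    then obtain K where K: "\<forall>m\<ge>K. \<forall>n\<ge>K. L2_norm M (\<lambda>x. F m x - F n x) < e/2"
      using Cauchy[of "e/2"] by auto
    have "norm (L2_norm M (\<lambda>x. F m x - f x) - 0) < e" if "K \<le> m" for m
    proof -
      have "(\<integral>\<^sup>+x. ennreal ((cmod (F m x - f x))\<^sup>2) \<partial>M) \<le> ennreal ((e/2)\<^sup>2)"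
        by (rule close[of K]) (use K that in \<open>auto intro: less_imp_le\<close>)
      then have "(L2_norm M (\<lambda>x. F m x - f x))\<^sup>2 \<le> (e/2)\<^sup>2"
        by (subst (asm) nn_integral_L2) (auto intro: L2_diff F f)
      then have "L2_norm M (\<lambda>x. F m x - f x) \<le> e/2"
        by (rule power2_le_imp_le) (use e in auto)
      with e show ?thesis by simp
    qed
    then show "\<exists>no. \<forall>n\<ge>no. norm (L2_norm M (\<lambda>x. F n x - f x) - 0) < e" by blast
  qed
  with f F show ?thesis by (auto simp: L2_lim_def)
qed

section \<open>Trigonometric polynomials on the circle\<close>

definition trig_poly :: "int set \<Rightarrow> (int \<Rightarrow> complex) \<Rightarrow> complex \<Rightarrow> complex" where
  "trig_poly X c z = (\<Sum>k\<in>X. c k * z powi k)"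

text \<open>Agreement is asked on the circle only: there conjugation is inversion, so polynomials in
  the real coordinates qualify although they differ from Laurent polynomials elsewhere.\<close>

definition is_trig :: "(complex \<Rightarrow> complex) \<Rightarrow> bool" where
  "is_trig f \<longleftrightarrow> (\<exists>X c. finite X \<and> (\<forall>z. cmod z = 1 \<longrightarrow> f z = trig_poly X c z))"

lemma borel_measurable_power_int [measurable]:
  "(\<lambda>z::complex. z powi k) \<in> borel_measurable borel"
  unfolding power_int_def by (cases "0 \<le> k") auto

lemma borel_measurable_trig_poly [measurable]: "trig_poly X c \<in> borel_measurable borel"
  unfolding trig_poly_def by measurable

lemma norm_power_int_circle [simp]: "cmod z = 1 \<Longrightarrow> cmod (z powi k) = 1"
  by (simp add: norm_power_int)

lemma cnj_power_int_circle: "cmod z = 1 \<Longrightarrow> cnj (z powi k) = z powi (-k)"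
proof -
  assume z: "cmod z = 1"
  then have "z * cnj z = 1" by (simp add: complex_norm_square[symmetric])
  then have "cnj z = inverse z" by (metis inverse_unique)
  then show ?thesis by (simp add: power_int_inverse power_int_minus flip: power_int_def)
qed

lemma is_trig_power_int: "is_trig (\<lambda>z. z powi k)"
  unfolding is_trig_def trig_poly_def by (rule exI[of _ "{k}"], rule exI[of _ "\<lambda>_. 1"]) auto

lemma is_trig_cmult: "is_trig f \<Longrightarrow> is_trig (\<lambda>z. c * f z)"
proof -
  assume "is_trig f"
  then obtain X d where "finite X" "\<And>z. cmod z = 1 \<Longrightarrow> f z = trig_poly X d z"
    by (auto simp: is_trig_def)
  then show ?thesis
    unfolding is_trig_def trig_poly_def
    by (intro exI[of _ X] exI[of _ "\<lambda>k. c * d k"]) (auto simp: sum_distrib_left mult.assoc)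
qed

lemma is_trig_add: "is_trig f \<Longrightarrow> is_trig g \<Longrightarrow> is_trig (\<lambda>z. f z + g z)"
proof -
  assume "is_trig f" "is_trig g"
  then obtain X c Y d where *: "finite X" "\<And>z. cmod z = 1 \<Longrightarrow> f z = trig_poly X c z"
    "finite Y" "\<And>z. cmod z = 1 \<Longrightarrow> g z = trig_poly Y d z"
    unfolding is_trig_def by blast
  have "trig_poly X c z + trig_poly Y d z =
      trig_poly (X \<union> Y) (\<lambda>k. (if k \<in> X then c k else 0) + (if k \<in> Y then d k else 0)) z" for z
  proof -
    have "trig_poly X c z = (\<Sum>k\<in>X\<union>Y. (if k \<in> X then c k else 0) * z powi k)"
      unfolding trig_poly_def by (rule sum.mono_neutral_cong_left) (use * in auto)
    moreover have "trig_poly Y d z = (\<Sum>k\<in>X\<union>Y. (if k \<in> Y then d k else 0) * z powi k)"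
      unfolding trig_poly_def by (rule sum.mono_neutral_cong_left) (use * in auto)
    ultimately show ?thesis
      unfolding trig_poly_def[of "X \<union> Y"] distrib_right sum.distrib by simp
  qed
  with * show ?thesis
    unfolding is_trig_def by (intro exI[of _ "X \<union> Y"]) auto
qed

lemma is_trig_cong: "is_trig f \<Longrightarrow> (\<And>z. cmod z = 1 \<Longrightarrow> f z = g z) \<Longrightarrow> is_trig g"
  unfolding is_trig_def by metis

lemma is_trig_sum: "(\<And>i. i \<in> I \<Longrightarrow> is_trig (F i)) \<Longrightarrow> is_trig (\<lambda>z. \<Sum>i\<in>I. F i z)"
proof (induction I rule: infinite_finite_induct)
  case (insert i I)
  then show ?case using is_trig_add by auto
qed (use is_trig_cmult[OF is_trig_power_int, of 0] in auto)

lemma is_trig_mult: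
  assumes "is_trig f" "is_trig g"
  shows "is_trig (\<lambda>z. f z * g z)"
proof -
  obtain X c Y d where *: "finite X" "\<And>z. cmod z = 1 \<Longrightarrow> f z = trig_poly X c z"
    "finite Y" "\<And>z. cmod z = 1 \<Longrightarrow> g z = trig_poly Y d z"
    using assms unfolding is_trig_def by blast
  have "is_trig (\<lambda>z. \<Sum>k\<in>X. \<Sum>l\<in>Y. (c k * d l) * z powi (k + l))"
    by (intro is_trig_sum is_trig_cmult is_trig_power_int)
  then show ?thesis
  proof (rule is_trig_cong)
    fix z :: complex assume z: "cmod z = 1"
    then have "z \<noteq> 0" by auto
    then show "(\<Sum>k\<in>X. \<Sum>l\<in>Y. (c k * d l) * z powi (k + l)) = f z * g z"
      by (simp add: * z trig_poly_def sum_product power_int_add mult_ac)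
  qed
qed

text \<open>On the circle \<open>cnj z = inverse z\<close>, so \<open>Re z\<close> and
  \<open>Im z\<close> are combinations of \<open>z\<close> and its inverse. Sums and products
  preserve \<open>is_trig\<close>.\<close>

lemma is_trig_real_polynomial:
  "real_polynomial_function p \<Longrightarrow> is_trig (\<lambda>z. of_real (p z))"
proof (induction p rule: real_polynomial_function.induct)
  case (linear h)
  \<comment> \<open>A real-linear form on the plane is determined by its values at \<open>1\<close>
    and \<open>\<i>\<close>, which reduces the linear case to the two coordinates.\<close>
  have "h z = Re z * h 1 + Im z * h \<i>" for z
  proof -
    interpret bounded_linear h by fact
    have "h z = h (Re z *\<^sub>R 1 + Im z *\<^sub>R \<i>)"
      by (rule arg_cong[where f=h]) (simp add: complex_eq_iff)
    then show ?thesis by (simp only: add scaleR real_scaleR_def)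
  qed
  then have h: "complex_of_real (h z) = of_real (h 1) * of_real (Re z) + of_real (h \<i>) * of_real (Im z)" for z
    by (metis mult.commute of_real_add of_real_mult)
  have re: "is_trig (\<lambda>z. of_real (Re z))"
  proof (rule is_trig_cong)
    show "is_trig (\<lambda>z. (1/2) * z powi 1 + (1/2) * z powi (-1))"
      by (intro is_trig_add is_trig_cmult is_trig_power_int)
    fix z :: complex assume "cmod z = 1"
    then show "(1/2) * z powi 1 + (1/2) * z powi (-1) = of_real (Re z)"
      using cnj_power_int_circle[of z 1] complex_add_cnj[of z] by (simp add: field_simps)
  qed
  have im: "is_trig (\<lambda>z. of_real (Im z))"
  proof (rule is_trig_cong)
    show "is_trig (\<lambda>z. (1/(2*\<i>)) * z powi 1 + (-1/(2*\<i>)) * z powi (-1))"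
      by (intro is_trig_add is_trig_cmult is_trig_power_int)
    fix z :: complex assume "cmod z = 1"
    then show "(1/(2*\<i>)) * z powi 1 + (-1/(2*\<i>)) * z powi (-1) = of_real (Im z)"
      using cnj_power_int_circle[of z 1] complex_diff_cnj[of z] by (simp add: field_simps)
  qed
  have "is_trig (\<lambda>z. of_real (h 1) * of_real (Re z) + of_real (h \<i>) * of_real (Im z))"
    by (intro is_trig_add is_trig_cmult re im)
  then show ?case by (rule is_trig_cong) (rule h[symmetric])
next
  case (const c)
  show ?case using is_trig_cmult[OF is_trig_power_int, of "of_real c" 0] by simp
qed (simp_all add: is_trig_add is_trig_mult)

text \<open>Stone-Weierstrass in the two real coordinates, after which the approximating polynomial
  is rewritten on the circle.\<close>

lemma trig_poly_approx_continuous: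
  fixes u :: "complex \<Rightarrow> real"
  assumes "continuous_on (sphere 0 1) u" "0 < e"
  obtains X c where "finite X" "\<And>z. cmod z = 1 \<Longrightarrow> cmod (of_real (u z) - trig_poly X c z) < e"
proof -
  obtain p where p: "real_polynomial_function p" "\<And>z. z \<in> sphere 0 1 \<Longrightarrow> \<bar>u z - p z\<bar> < e"
    using Stone_Weierstrass_real_polynomial_function[OF compact_sphere assms] by blast
  obtain X c where X: "finite X" "\<And>z. cmod z = 1 \<Longrightarrow> of_real (p z) = trig_poly X c z"
    using is_trig_real_polynomial[OF p(1)] unfolding is_trig_def by blast
  have "cmod (of_real (u z) - trig_poly X c z) < e" if z: "cmod z = 1" for z
  proof -
    have "of_real (u z) - trig_poly X c z = of_real (u z - p z)" by (simp add: X(2)[OF z, symmetric])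
    then show ?thesis using p(2)[of z] z by (simp only: norm_of_real) simp
  qed
  with X(1) show ?thesis using that by blast
qed

section \<open>Continuous approximation of indicators of closed sets\<close>

text \<open>Equal to 1 on \<open>K\<close> and, for positive \<open>n\<close>, to 0 at distance at
  least \<open>1 / n\<close> from \<open>K\<close>: for closed nonempty \<open>K\<close> these
  functions tend to the indicator of \<open>K\<close>.\<close>

definition bump :: "complex set \<Rightarrow> nat \<Rightarrow> complex \<Rightarrow> real" where
  "bump K n z = max 0 (1 - real n * infdist z K)"

lemma continuous_bump: "continuous_on S (bump K n)"
  unfolding bump_def by (intro continuous_intros)

lemma bump_measurable [measurable]: "bump K n \<in> borel_measurable borel"
  by (intro borel_measurable_continuous_onI continuous_bump)

lemma bump_bounds: "0 \<le> bump K n z" "bump K n z \<le> 1"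
  by (auto simp: bump_def infdist_nonneg)

lemma bump_tendsto:
  assumes "closed K" "K \<noteq> {}"
  shows "(\<lambda>n. bump K n z) \<longlonglongrightarrow> indicator K z"
proof (cases "z \<in> K")
  case True
  then show ?thesis by (simp add: bump_def)
next
  case False
  then have pos: "0 < infdist z K" using assms infdist_pos_not_in_closed by blast
  obtain m where "1 / infdist z K < real m" using reals_Archimedean2 by blast
  then have m: "1 < real m * infdist z K" using pos by (simp add: field_simps)
  have "\<forall>\<^sub>F n in sequentially. bump K n z = 0"
    using eventually_ge_at_top[of m]
  proof eventually_elim
    fix n assume "m \<le> n"
    then have "real m * infdist z K \<le> real n * infdist z K"
      using pos by (intro mult_right_mono) auto
    with m show "bump K n z = 0" by (simp add: bump_def)
  qed
  then show ?thesis using False by (simp add: tendsto_eventually)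
qed

section \<open>Finite measures carried by the circle: density and uniqueness\<close>

text \<open>Such measures are taken on the Borel sets of the plane and only concentrated on the
  circle, so inner regularity applies directly. \<open>haar_circle\<close>, which lives on the
  subspace, is brought here by its image under the identity.\<close>

locale circle_measure = finite_measure M for M :: "complex measure" +
  assumes sets_borel [measurable_cong, simp]: "sets M = sets borel"
    and AE_circle: "AE z in M. cmod z = 1"
begin

lemma space_UNIV [simp]: "space M = UNIV"
  using sets_eq_imp_space_eq[OF sets_borel] by simp

lemma integrable_circle_bound:
  assumes "f \<in> borel_measurable borel" "\<And>z. cmod z = 1 \<Longrightarrow> cmod (f z) \<le> B"
  shows "integrable M f"
proof (rule integrable_const_bound)
  show "AE z in M. norm (f z) \<le> B" using AE_circle by eventually_elim (use assms in auto)
qed (use assms(1) in measurable)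

lemma trig_poly_bound:
  assumes "cmod z = 1" "finite X"
  shows "cmod (trig_poly X c z) \<le> (\<Sum>k\<in>X. cmod (c k))"
  unfolding trig_poly_def by (rule sum_norm_le) (use assms in \<open>simp add: norm_mult\<close>)

lemma integrable_trig_poly [simp]: "finite X \<Longrightarrow> integrable M (trig_poly X c)"
  by (rule integrable_circle_bound[OF _ trig_poly_bound]) auto

lemma L2_circle_bound:
  assumes "f \<in> borel_measurable borel" "\<And>z. cmod z = 1 \<Longrightarrow> cmod (f z) \<le> B"
  shows "f \<in> L2 M"
proof -
  have "integrable M (\<lambda>z. (cmod (f z))\<^sup>2)"
  proof (rule integrable_const_bound)
    show "AE z in M. norm ((cmod (f z))\<^sup>2) \<le> B\<^sup>2"
      using AE_circle by eventually_elim (use assms in \<open>auto intro: power_mono\<close>)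
  qed (use assms(1) in measurable)
  then show ?thesis using assms(1) by (simp add: L2_def measurable_cong_sets[OF sets_borel refl])
qed

lemma L2_trig_poly [simp]: "finite X \<Longrightarrow> trig_poly X c \<in> L2 M"
  by (rule L2_circle_bound[OF _ trig_poly_bound]) auto

lemma L2_norm_circle_bound:
  assumes "f \<in> borel_measurable borel" "\<And>z. cmod z = 1 \<Longrightarrow> cmod (f z) \<le> B" "0 \<le> B"
  shows "L2_norm M f \<le> B * sqrt (measure M UNIV)"
proof (rule power2_le_imp_le)
  have "(L2_norm M f)\<^sup>2 \<le> (LINT z|M. B\<^sup>2)"
    unfolding L2_norm_sq
  proof (rule integral_mono_AE)
    show "integrable M (\<lambda>z. (cmod (f z))\<^sup>2)"
      using L2_circle_bound[OF assms(1,2)] by (rule L2_integrable)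
    show "AE z in M. (cmod (f z))\<^sup>2 \<le> B\<^sup>2"
      using AE_circle by eventually_elim (use assms in \<open>auto intro: power_mono\<close>)
  qed auto
  then show "(L2_norm M f)\<^sup>2 \<le> (B * sqrt (measure M UNIV))\<^sup>2"
    by (simp add: power_mult_distrib mult.commute)
qed (use assms in auto)

definition approximable :: "(complex \<Rightarrow> complex) \<Rightarrow> bool" where
  "approximable f \<longleftrightarrow> f \<in> L2 M \<and> (\<forall>e>0. \<exists>X c. finite X \<and> L2_norm M (\<lambda>z. f z - trig_poly X c z) < e)"

lemma approximable_closed:
  assumes "f \<in> L2 M" "\<And>e. 0 < e \<Longrightarrow> \<exists>g. approximable g \<and> L2_norm M (\<lambda>z. f z - g z) < e"
  shows "approximable f"
  unfolding approximable_def
proof (intro conjI allI impI assms)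
  fix e :: real assume "0 < e"
  then obtain g where g: "approximable g" "L2_norm M (\<lambda>z. f z - g z) < e/2"
    using assms(2)[of "e/2"] by auto
  then obtain X c where X: "finite X" "L2_norm M (\<lambda>z. g z - trig_poly X c z) < e/2"
    using \<open>0 < e\<close> unfolding approximable_def by (metis half_gt_zero)
  have "L2_norm M (\<lambda>z. f z - trig_poly X c z) < e"
    using L2_triangle_diff[OF assms(1), of g "trig_poly X c"] g X by (auto simp: approximable_def)
  with X show "\<exists>X c. finite X \<and> L2_norm M (\<lambda>z. f z - trig_poly X c z) < e" by blast
qed

lemma approximable_lim:
  assumes "L2_lim M F f net" "net \<noteq> bot" "\<And>n. approximable (F n)"
  shows "approximable f"
proof (rule approximable_closed)
  show "f \<in> L2 M" using assms by (simp add: L2_lim_def)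
  fix e :: real assume e: "0 < e"
  have "\<forall>\<^sub>F n in net. L2_norm M (\<lambda>x. F n x - f x) < e"
    using L2_limD(3)[OF assms(1)] e by (rule order_tendstoD)
  then obtain n where "L2_norm M (\<lambda>x. F n x - f x) < e"
    using eventually_happens' assms(2) by blast
  then show "\<exists>g. approximable g \<and> L2_norm M (\<lambda>z. f z - g z) < e"
    using assms(3) unfolding L2_norm_minus[of M f "F n"] by (auto simp: L2_norm_minus[of M f])
qed

lemma approximable_add:
  assumes "approximable f" "approximable g"
  shows "approximable (\<lambda>z. f z + g z)"
  unfolding approximable_def
proof (intro conjI allI impI)
  have fg: "f \<in> L2 M" "g \<in> L2 M" using assms by (auto simp: approximable_def)
  then show "(\<lambda>z. f z + g z) \<in> L2 M" by (rule L2_add)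
  fix e :: real assume "0 < e"
  then obtain X c Y d where *: "finite X" "L2_norm M (\<lambda>z. f z - trig_poly X c z) < e/2"
     "finite Y" "L2_norm M (\<lambda>z. g z - trig_poly Y d z) < e/2"
    using assms unfolding approximable_def by (metis half_gt_zero)
  have "is_trig (\<lambda>z. trig_poly X c z + trig_poly Y d z)"
    by (intro is_trig_add) (use * in \<open>auto simp: is_trig_def\<close>)
  then obtain Z b where Z: "finite Z" "\<And>z. cmod z = 1 \<Longrightarrow> trig_poly X c z + trig_poly Y d z = trig_poly Z b z"
    unfolding is_trig_def by blast
  have "L2_norm M (\<lambda>z. f z + g z - trig_poly Z b z) =
      L2_norm M (\<lambda>z. (f z - trig_poly X c z) + (g z - trig_poly Y d z))"
  proof (rule L2_norm_cong_AE)
    show "AE z in M. f z + g z - trig_poly Z b z = (f z - trig_poly X c z) + (g z - trig_poly Y d z)"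
      using AE_circle by eventually_elim (simp flip: Z(2))
  qed (use fg[THEN L2_borel] in measurable)
  also have "\<dots> \<le> L2_norm M (\<lambda>z. f z - trig_poly X c z) + L2_norm M (\<lambda>z. g z - trig_poly Y d z)"
    by (intro L2_triangle L2_diff fg L2_trig_poly *)
  also have "\<dots> < e" using * by simp
  finally show "\<exists>X c. finite X \<and> L2_norm M (\<lambda>z. f z + g z - trig_poly X c z) < e"
    using Z(1) by blast
qed

lemma approximable_cmult:
  assumes "approximable f"
  shows "approximable (\<lambda>z. a * f z)"
  unfolding approximable_def
proof (intro conjI allI impI)
  have f: "f \<in> L2 M" using assms by (auto simp: approximable_def)
  then show "(\<lambda>z. a * f z) \<in> L2 M" by (rule L2_cmult)
  fix e :: real assume e: "0 < e"
  have pos: "0 < cmod a + 1" using norm_ge_zero[of a] by linarith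
  then obtain X c where *: "finite X" "L2_norm M (\<lambda>z. f z - trig_poly X c z) < e / (cmod a + 1)"
    using assms e unfolding approximable_def by (metis divide_pos_pos)
  have "(\<lambda>z. a * f z - trig_poly X (\<lambda>k. a * c k) z) = (\<lambda>z. a * (f z - trig_poly X c z))"
    by (rule ext) (simp add: trig_poly_def sum_distrib_left right_diff_distrib mult.assoc)
  then have "L2_norm M (\<lambda>z. a * f z - trig_poly X (\<lambda>k. a * c k) z) = cmod a * L2_norm M (\<lambda>z. f z - trig_poly X c z)"
    by (simp add: L2_norm_cmult)
  also have "\<dots> \<le> cmod a * (e / (cmod a + 1))" using * by (intro mult_left_mono) auto
  also have "\<dots> < (cmod a + 1) * (e / (cmod a + 1))" using e pos by (intro mult_strict_right_mono) auto
  also have "\<dots> = e" using pos by simp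
  finally show "\<exists>X c. finite X \<and> L2_norm M (\<lambda>z. a * f z - trig_poly X c z) < e" using * by blast
qed

lemma approximable_sum: "(\<And>i. i \<in> I \<Longrightarrow> approximable (F i)) \<Longrightarrow> approximable (\<lambda>z. \<Sum>i\<in>I. F i z)"
proof (induction I rule: infinite_finite_induct)
  case (insert i I)
  then show ?case using approximable_add by auto
next
  have "approximable (\<lambda>z. 0)"
    by (auto simp: approximable_def trig_poly_def intro!: exI[of _ "{}"])
  then show "approximable (\<lambda>z. \<Sum>i\<in>I. F i z)" if "infinite I" for I :: "'i set" and F using that by simp
  show "approximable (\<lambda>z. \<Sum>i\<in>{}. F i z)" by (simp add: \<open>approximable (\<lambda>z. 0)\<close>)
qed

lemma approximable_bump: "approximable (\<lambda>z. of_real (bump K n z))"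
  unfolding approximable_def
proof (intro conjI allI impI)
  show "(\<lambda>z. complex_of_real (bump K n z)) \<in> L2 M"
    by (rule L2_circle_bound[where B=1]) (auto simp: bump_bounds)
  fix e :: real assume e: "0 < e"
  \<comment> \<open>The summand 1 keeps the quotient defined and the final estimate strict even for
    the zero measure.\<close>
  define B where "B = e / (sqrt (measure M UNIV) + 1)"
  have pos: "0 < sqrt (measure M UNIV) + 1" using real_sqrt_ge_zero[of "measure M UNIV"] by (simp add: add_nonneg_pos)
  then have B: "0 < B" using e by (simp add: B_def)
  then obtain X c where X: "finite X" "\<And>z. cmod z = 1 \<Longrightarrow> cmod (of_real (bump K n z) - trig_poly X c z) < B"
    using trig_poly_approx_continuous[OF continuous_bump] by blast
  have "L2_norm M (\<lambda>z. of_real (bump K n z) - trig_poly X c z) \<le> B * sqrt (measure M UNIV)"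
    by (rule L2_norm_circle_bound) (use X B in \<open>auto intro: less_imp_le\<close>)
  also have "\<dots> < B * (sqrt (measure M UNIV) + 1)" using B by simp
  also have "\<dots> = e" using pos by (simp add: B_def)
  finally show "\<exists>X c. finite X \<and> L2_norm M (\<lambda>z. of_real (bump K n z) - trig_poly X c z) < e"
    using X by blast
qed

lemma bump_L2_lim:
  assumes "closed K" "K \<noteq> {}"
  shows "L2_lim M (\<lambda>n z. of_real (bump K n z)) (indicator K) sequentially"
  unfolding L2_lim_def
proof (intro conjI allI)
  have K: "K \<in> sets borel" using assms by (simp add: borel_closed)
  show "(\<lambda>z. complex_of_real (bump K n z)) \<in> L2 M" for n
    by (rule L2_circle_bound[where B=1]) (auto simp: bump_bounds)
  show "indicator K \<in> L2 M"
    by (rule L2_circle_bound[where B=1]) (use K in \<open>auto simp: indicator_def\<close>)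
  have "(\<lambda>n. LINT z|M. (cmod (of_real (bump K n z) - indicator K z))\<^sup>2) \<longlonglongrightarrow> (LINT z|M. 0)"
  proof (rule integral_dominated_convergence)
    show "AE z in M. (\<lambda>n. (cmod (of_real (bump K n z) - indicator K z))\<^sup>2) \<longlonglongrightarrow> 0"
    proof (rule AE_I2)
      fix z
      have "(\<lambda>n. (cmod (of_real (bump K n z) - of_real (indicator K z)))\<^sup>2) \<longlonglongrightarrow> (cmod (of_real (indicator K z) - of_real (indicator K z)))\<^sup>2"
        by (intro tendsto_intros bump_tendsto assms)
      then show "(\<lambda>n. (cmod (of_real (bump K n z) - indicator K z))\<^sup>2) \<longlonglongrightarrow> 0"
        by (simp add: of_real_indicator)
    qed
    show "integrable M (\<lambda>z. 4::real)" by simp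
    fix n show "AE z in M. norm ((cmod (of_real (bump K n z) - indicator K z))\<^sup>2) \<le> 4"
    proof (rule AE_I2)
      fix z
      have "cmod (of_real (bump K n z) - indicator K z) \<le> cmod (of_real (bump K n z)) + cmod (indicator K z)"
        by (rule norm_triangle_ineq4)
      also have "\<dots> \<le> 1 + 1" using bump_bounds[of K n z] by (intro add_mono) (auto simp: indicator_def)
      finally have "(cmod (of_real (bump K n z) - indicator K z))\<^sup>2 \<le> 2\<^sup>2" by (intro power_mono) auto
      then show "norm ((cmod (of_real (bump K n z) - indicator K z))\<^sup>2) \<le> 4" by simp
    qed
  qed (use K in measurable)
  then show "(\<lambda>n. L2_norm M (\<lambda>z. of_real (bump K n z) - indicator K z)) \<longlonglongrightarrow> 0"
    unfolding L2_norm_def using tendsto_real_sqrt by fastforce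
qed

text \<open>Inner regularity replaces the Borel set by a compact subset of nearly full measure,
  whose indicator is an L2 limit of bumps.\<close>

lemma approximable_indicator:
  assumes A: "A \<in> sets borel"
  shows "approximable (indicator A)"
proof (rule approximable_closed)
  show "indicator A \<in> L2 M"
    by (rule L2_circle_bound[where B=1]) (use A in \<open>auto simp: indicator_def\<close>)
  fix e :: real assume e: "0 < e"
  \<comment> \<open>The tolerance is \<open>e\<^sup>2\<close> because the squared L2 distance of the
    two indicators is the measure of \<open>A - K\<close>. Null sets are treated apart:
    \<open>ennreal\<close> truncates negative numbers to 0, which is not strictly below their
    measure.\<close>
  obtain K where K: "K \<subseteq> A" "compact K" "measure M A - e\<^sup>2 < measure M K"
  proof (cases "measure M A = 0")
    case True
    then show thesis using that[of "{}"] e by simp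
  next
    case False
    then have "ennreal (measure M A - e\<^sup>2) < emeasure M A"
      using e by (simp add: emeasure_eq_measure zero_less_measure_iff ennreal_lessI)
    also have "emeasure M A = (SUP K\<in>{K. K \<subseteq> A \<and> compact K}. emeasure M K)"
      by (rule inner_regular) (use A in \<open>auto simp: emeasure_eq_measure\<close>)
    finally obtain K where K: "K \<subseteq> A" "compact K" "ennreal (measure M A - e\<^sup>2) < emeasure M K"
      by (auto simp: less_SUP_iff)
    then have "measure M A - e\<^sup>2 < measure M K"
      by (metis emeasure_eq_measure ennreal_leI not_le)
    with K show thesis using that by blast
  qed
  have Kb: "K \<in> sets borel" using K by (simp add: borel_compact)
  have appK: "approximable (indicator K)"
  proof (cases "K = {}")
    case True
    then have "(indicator K :: complex \<Rightarrow> complex) = (\<lambda>z. 0)" by auto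
    then show ?thesis using approximable_sum[of "{}"] by simp
  next
    case False
    then show ?thesis
      using approximable_lim[OF bump_L2_lim sequentially_bot approximable_bump] K compact_imp_closed by blast
  qed
  have "(L2_norm M (\<lambda>z. indicator A z - indicator K z))\<^sup>2 = (LINT z|M. indicator (A - K) z)"
    unfolding L2_norm_sq by (intro Bochner_Integration.integral_cong) (use K in \<open>auto simp: indicator_def\<close>)
  also have "\<dots> = measure M (A - K)" using A Kb by simp
  also have "\<dots> = measure M A - measure M K" using A Kb K by (intro finite_measure_Diff) auto
  also have "\<dots> < e\<^sup>2" using K by simp
  finally have "L2_norm M (\<lambda>z. indicator A z - indicator K z) < e"
    by (rule power2_less_imp_less) (use e in auto)
  with appK show "\<exists>g. approximable g \<and> L2_norm M (\<lambda>z. indicator A z - g z) < e" by blast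
qed

text \<open>Simple functions dominated by \<open>2 * cmod (f z)\<close> converge to \<open>f\<close>
  pointwise, hence in L2, and each is a finite combination of indicators of Borel sets.\<close>

theorem trig_poly_dense:
  assumes f: "f \<in> L2 M" and e: "0 < e"
  obtains X c where "finite X" "L2_norm M (\<lambda>z. f z - trig_poly X c z) < e"
proof -
  note [measurable] = L2_borel[OF f]
  obtain s where s: "\<And>i. simple_function M (s i)" "\<And>z. (\<lambda>i. s i z) \<longlonglongrightarrow> f z"
    "\<And>i z. dist (s i z) 0 \<le> 2 * dist (f z) 0"
    using borel_measurable_implies_sequence_metric[of f M 0] by auto
  have [measurable]: "s i \<in> borel_measurable M" for i using s(1) by (rule borel_measurable_simple_function)
  have sf: "cmod (s i z) \<le> 2 * cmod (f z)" for i z using s(3)[of i z] by simp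
  have sL2: "s i \<in> L2 M" for i
  proof -
    have "integrable M (\<lambda>z. (cmod (s i z))\<^sup>2)"
    proof (rule Bochner_Integration.integrable_bound)
      show "integrable M (\<lambda>z. 4 * (cmod (f z))\<^sup>2)" using f by (simp add: L2_integrable)
      show "AE z in M. norm ((cmod (s i z))\<^sup>2) \<le> norm (4 * (cmod (f z))\<^sup>2)"
        using power_mono[OF sf, of _ _ 2] by (auto simp: power_mult_distrib)
    qed measurable
    then show ?thesis by (simp add: L2_def)
  qed
  have app: "approximable (s i)" for i
  proof -
    have "s i = (\<lambda>z. \<Sum>y\<in>s i ` space M. y * indicator (s i -` {y} \<inter> space M) z)"
    proof (rule ext)
      fix z
      have "s i z = (\<Sum>y\<in>s i ` space M. indicator (s i -` {y} \<inter> space M) z *\<^sub>R y)"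
        by (rule simple_function_indicator_representation_banach[OF s(1)]) simp
      also have "\<dots> = (\<Sum>y\<in>s i ` space M. y * indicator (s i -` {y} \<inter> space M) z)"
        by (rule sum.cong) (auto simp: indicator_def)
      finally show "s i z = (\<Sum>y\<in>s i ` space M. y * indicator (s i -` {y} \<inter> space M) z)" .
    qed
    moreover have "approximable (\<lambda>z. \<Sum>y\<in>s i ` space M. y * indicator (s i -` {y} \<inter> space M) z)"
    proof (intro approximable_sum approximable_cmult approximable_indicator)
      fix y
      have "s i -` {y} \<inter> space M \<in> sets M" by (rule simple_functionD(2)[OF s(1)])
      then show "s i -` {y} \<inter> space M \<in> sets borel" by simp
    qed
    ultimately show ?thesis by simp
  qed
  have "(\<lambda>n. LINT z|M. (cmod (s n z - f z))\<^sup>2) \<longlonglongrightarrow> (LINT z|M. 0)"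
  proof (rule integral_dominated_convergence)
    show "AE z in M. (\<lambda>n. (cmod (s n z - f z))\<^sup>2) \<longlonglongrightarrow> 0"
    proof (rule AE_I2)
      fix z
      have "(\<lambda>n. (cmod (s n z - f z))\<^sup>2) \<longlonglongrightarrow> (cmod (f z - f z))\<^sup>2"
        by (intro tendsto_intros s)
      then show "(\<lambda>n. (cmod (s n z - f z))\<^sup>2) \<longlonglongrightarrow> 0" by simp
    qed
    \<comment> \<open>From \<open>cmod (s n z) \<le> 2 * cmod (f z)\<close> the difference has
      modulus at most three times that of \<open>f\<close>; the 9 is its square.\<close>
    show "integrable M (\<lambda>z. 9 * (cmod (f z))\<^sup>2)" using f by (simp add: L2_integrable)
    fix n show "AE z in M. norm ((cmod (s n z - f z))\<^sup>2) \<le> 9 * (cmod (f z))\<^sup>2"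
    proof (rule AE_I2)
      fix z
      have "cmod (s n z - f z) \<le> 3 * cmod (f z)"
        using norm_triangle_ineq4[of "s n z" "f z"] sf[of n z] by simp
      then have "(cmod (s n z - f z))\<^sup>2 \<le> (3 * cmod (f z))\<^sup>2" by (intro power_mono) auto
      then show "norm ((cmod (s n z - f z))\<^sup>2) \<le> 9 * (cmod (f z))\<^sup>2" by (simp add: power_mult_distrib)
    qed
  qed measurable
  then have "(\<lambda>n. L2_norm M (\<lambda>z. s n z - f z)) \<longlonglongrightarrow> 0"
    unfolding L2_norm_def using tendsto_real_sqrt by fastforce
  then have "L2_lim M s f sequentially" using sL2 f by (simp add: L2_lim_def)
  then have "approximable f" by (rule approximable_lim) (auto intro: app)
  then show ?thesis using e that unfolding approximable_def by blast
qed

end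

text \<open>The moments fix the integrals of trigonometric polynomials, hence by uniform
  approximation those of the bumps, and in the limit the masses of closed sets, an
  intersection-stable generator of the Borel sets.\<close>

theorem circle_measure_eqI:
  assumes "circle_measure M" "circle_measure N"
    and mom: "\<And>k. (LINT z|M. z powi k) = (LINT z|N. z powi k)"
  shows "M = N"
proof -
  interpret M: circle_measure M by fact
  interpret N: circle_measure N by fact
  have int_powi: "integrable M (\<lambda>z. z powi k)" "integrable N (\<lambda>z. z powi k)" for k
    by (rule M.integrable_circle_bound[of _ 1] N.integrable_circle_bound[of _ 1]; simp)+
  have trig: "(LINT z|M. trig_poly X c z) = (LINT z|N. trig_poly X c z)" for X c
    unfolding trig_poly_def by (simp add: int_powi mom)
  have bump: "(LINT z|M. complex_of_real (bump K n z)) = (LINT z|N. complex_of_real (bump K n z))" for K n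
  proof -
    let ?u = "\<lambda>z. complex_of_real (bump K n z)"
    \<comment> \<open>Dividing the tolerance by both total masses together makes the two errors add
      up to at most \<open>e\<close>; the 1 guards against two zero measures.\<close>
    let ?C = "measure M UNIV + measure N UNIV + 1"
    have C: "0 < ?C" by (simp add: add_nonneg_pos)
    have "cmod ((LINT z|M. ?u z) - (LINT z|N. ?u z)) \<le> 0 + e" if e: "0 < e" for e
    proof -
      obtain X c where X: "finite X" "\<And>z. cmod z = 1 \<Longrightarrow> cmod (?u z - trig_poly X c z) < e / ?C"
        using trig_poly_approx_continuous[OF continuous_bump divide_pos_pos[OF e C]] by blast
      have est: "cmod ((LINT z|P. ?u z) - (LINT z|P. trig_poly X c z)) \<le> e / ?C * measure P UNIV"
        if "circle_measure P" for P
      proof -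
        interpret P: circle_measure P by fact
        have u: "integrable P ?u"
          by (rule P.integrable_circle_bound[of _ 1]) (auto simp: bump_bounds)
        have "cmod (LINT z|P. ?u z - trig_poly X c z) \<le> (LINT z|P. cmod (?u z - trig_poly X c z))"
          by (rule integral_norm_bound)
        also have "\<dots> \<le> (LINT z|P. e / ?C)"
        proof (rule integral_mono_AE)
          show "AE z in P. cmod (?u z - trig_poly X c z) \<le> e / ?C"
            using P.AE_circle by eventually_elim (use X in \<open>auto intro: less_imp_le\<close>)
        qed (use u X in auto)
        finally show ?thesis using u X by (simp add: mult.commute)
      qed
      have "(LINT z|M. ?u z) - (LINT z|N. ?u z) =
          ((LINT z|M. ?u z) - (LINT z|M. trig_poly X c z)) - ((LINT z|N. ?u z) - (LINT z|N. trig_poly X c z))"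
        by (simp add: trig)
      also have "cmod \<dots> \<le> e / ?C * measure M UNIV + e / ?C * measure N UNIV"
        by (intro order_trans[OF norm_triangle_ineq4] add_mono est assms)
      also have "\<dots> = e / ?C * (?C - 1)" by (simp add: distrib_left)
      also have "\<dots> \<le> e / ?C * ?C" using e C by (intro mult_left_mono) auto
      also have "\<dots> = e" using C by simp
      finally show ?thesis by simp
    qed
    then have "cmod ((LINT z|M. ?u z) - (LINT z|N. ?u z)) \<le> 0" by (rule field_le_epsilon)
    then show ?thesis by simp
  qed
  have closed: "measure M K = measure N K" if "closed K" for K
  proof (cases "K = {}")
    case False
    have lim: "(\<lambda>n. LINT z|P. complex_of_real (bump K n z)) \<longlonglongrightarrow> of_real (measure P K)"
      if "circle_measure P" for P
    proof -
      interpret P: circle_measure P by fact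
      \<comment> \<open>Integration against a finite measure is the inner product with the constant
        1, so L2 convergence of the bumps passes to their integrals.\<close>
      have one: "(\<lambda>z. 1) \<in> L2 P" by (rule P.L2_circle_bound[where B=1]) auto
      have "(\<lambda>n. L2_inner P (\<lambda>z. of_real (bump K n z)) (\<lambda>z. 1)) \<longlonglongrightarrow> L2_inner P (indicator K) (\<lambda>z. 1)"
        by (rule L2_lim_inner[OF P.bump_L2_lim one]) fact+
      moreover have "L2_inner P (indicator K) (\<lambda>z. 1) = of_real (measure P K)"
      proof -
        have "L2_inner P (indicator K) (\<lambda>z. 1) = (LINT z|P. complex_of_real (indicator K z))"
          by (simp add: L2_inner_def of_real_indicator)
        then show ?thesis using \<open>closed K\<close> by (simp only: integral_complex_of_real) simp
      qed
      ultimately show ?thesis by (simp add: L2_inner_def)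
    qed
    have "complex_of_real (measure M K) = of_real (measure N K)"
      using LIMSEQ_unique[OF lim[OF assms(1)] lim[OF assms(2), folded bump]] .
    then show ?thesis by simp
  qed simp
  show ?thesis
  proof (rule measure_eqI_generator_eq[where E="Collect closed" and \<Omega>=UNIV and A="\<lambda>_. UNIV"])
    show "sets M = sigma_sets UNIV (Collect closed)" "sets N = sigma_sets UNIV (Collect closed)"
      by (simp_all add: borel_eq_closed)
    show "emeasure M X = emeasure N X" if "X \<in> Collect closed" for X
      using that closed by (simp add: M.emeasure_eq_measure N.emeasure_eq_measure)
  qed (auto simp: Int_stable_def)
qed

section \<open>Haar measure on the circle\<close>

lemma sets_haar [simp, measurable_cong]: "sets haar_circle = sets (restrict_space borel (sphere 0 1))"
  by (simp add: haar_circle_def)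

lemma space_haar [simp]: "space haar_circle = sphere 0 1"
  by (simp add: haar_circle_def space_restrict_space)

lemma measurable_cis_neg [measurable]: "(\<lambda>t::real. cis (- t)) \<in> borel \<rightarrow>\<^sub>M restrict_space borel (sphere 0 1)"
  by (intro measurable_restrict_space2 borel_measurable_continuous_onI continuous_intros) auto

lemma borel_measurable_cis [measurable (raw)]:
  "f \<in> borel_measurable M \<Longrightarrow> (\<lambda>x. cis (f x)) \<in> borel_measurable M"
  by (rule borel_measurable_continuous_on) (auto intro: continuous_intros)

lemma borel_measurable_haar_iff:
  fixes f :: "complex \<Rightarrow> 'b::topological_space"
  shows "f \<in> borel_measurable haar_circle \<longleftrightarrow> f \<in> borel_measurable (restrict_space borel (sphere 0 1))"
  unfolding measurable_cong_sets[OF sets_haar refl] ..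

lemma borel_measurable_haarI:
  "f \<in> borel_measurable borel \<Longrightarrow> f \<in> borel_measurable haar_circle"
  unfolding borel_measurable_haar_iff by (rule measurable_restrict_space1)

lemma borel_measurable_haar_cis:
  assumes "f \<in> borel_measurable haar_circle"
  shows "(\<lambda>t::real. f (cis (- t))) \<in> borel_measurable borel"
  using measurable_compose[OF measurable_cis_neg] assms unfolding borel_measurable_haar_iff by blast

text \<open>Trades the normalised uniform measure for an explicit real density, the form in which
  integrals over the circle are pulled back to \<open>{-pi..pi}\<close>.\<close>

lemma haar_eq:
  "haar_circle = distr (density lborel (\<lambda>t. ennreal (indicator {-pi..pi} t / (2*pi))))
     (restrict_space borel (sphere 0 1)) (\<lambda>t. cis (- t))"
proof -
  have "indicator {-pi..pi} t / emeasure lborel {-pi..pi} = ennreal (indicator {-pi..pi} t / (2*pi))" for t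
    by (simp add: indicator_def divide_ennreal flip: ennreal_1)
  then show ?thesis unfolding haar_circle_def uniform_measure_def by simp
qed

lemma integrable_haar_iff:
  fixes f :: "complex \<Rightarrow> 'b::{banach, second_countable_topology}"
  assumes f: "f \<in> borel_measurable haar_circle"
  shows "integrable haar_circle f \<longleftrightarrow> integrable lborel (\<lambda>t. (indicator {-pi..pi} t / (2*pi)) *\<^sub>R f (cis (- t)))"
proof -
  note [measurable] = borel_measurable_haar_cis[OF f] f[unfolded borel_measurable_haar_iff]
  have "integrable haar_circle f \<longleftrightarrow> integrable (density lborel (\<lambda>t. ennreal (indicator {-pi..pi} t / (2*pi)))) (\<lambda>t. f (cis (- t)))"
    unfolding haar_eq by (rule integrable_distr_eq) measurable
  also have "\<dots> \<longleftrightarrow> integrable lborel (\<lambda>t. (indicator {-pi..pi} t / (2*pi)) *\<^sub>R f (cis (- t)))"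
    by (rule integrable_density) auto
  finally show ?thesis .
qed

lemma integral_haar:
  fixes f :: "complex \<Rightarrow> 'b::{banach, second_countable_topology}"
  assumes f: "f \<in> borel_measurable haar_circle"
  shows "(LINT z|haar_circle. f z) = (LINT t|lborel. (indicator {-pi..pi} t / (2*pi)) *\<^sub>R f (cis (- t)))"
proof -
  note [measurable] = borel_measurable_haar_cis[OF f] f[unfolded borel_measurable_haar_iff]
  have "(LINT z|haar_circle. f z) = (LINT t|density lborel (\<lambda>t. ennreal (indicator {-pi..pi} t / (2*pi))). f (cis (- t)))"
    unfolding haar_eq by (rule integral_distr) measurable
  also have "\<dots> = (LINT t|lborel. (indicator {-pi..pi} t / (2*pi)) *\<^sub>R f (cis (- t)))"
    by (rule integral_density) auto
  finally show ?thesis .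
qed

text \<open>With \<open>z = cis (- t)\<close> the conjugate of \<open>z powi k\<close> is
  \<open>cis (k * t)\<close>: the positive sign in the exponent of \<open>circle_coeff\<close> is
  what makes it the inner product with \<open>z powi k\<close>.\<close>

lemma circle_coeff_eq:
  assumes f: "f \<in> borel_measurable haar_circle"
  shows "circle_coeff f k = (LINT z|haar_circle. f z * cnj (z powi k))"
proof -
  have "(\<lambda>z. f z * cnj (z powi k)) \<in> borel_measurable haar_circle"
    by (intro borel_measurable_times borel_measurable_cnj f borel_measurable_haarI) measurable
  then have "(LINT z|haar_circle. f z * cnj (z powi k)) =
      (LINT t|lborel. (indicator {-pi..pi} t *\<^sub>R (cis (of_int k * t) * f (cis (- t)))) / of_real (2*pi))"
    by (simp add: integral_haar cis_power_int cis_cnj scaleR_conv_of_real mult_ac)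
  then show ?thesis by (simp add: circle_coeff_def set_lebesgue_integral_def)
qed

lemma emeasure_haar: "emeasure haar_circle (sphere 0 1) = 1"
proof -
  have "emeasure (density lborel (\<lambda>t. ennreal (indicator {-pi..pi} t / (2*pi)))) UNIV = 
      (\<integral>\<^sup>+t. ennreal (1/(2*pi)) * indicator {-pi..pi} t \<partial>lborel)"
    by (simp add: emeasure_density) (auto intro!: nn_integral_cong simp: indicator_def)
  also have "\<dots> = ennreal (1/(2*pi)) * ennreal (2 * pi)"
    by (simp add: nn_integral_cmult)
  also have "\<dots> = 1" by (simp flip: ennreal_mult)
  moreover have "cis (- t) \<in> sphere 0 1" for t by simp
  then have "(\<lambda>t. cis (-t)) -` sphere 0 1 = UNIV" by blast
  moreover have "sphere 0 1 \<in> sets (restrict_space borel (sphere (0::complex) 1))"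
    by (simp add: sets_restrict_space_iff)
  ultimately show ?thesis
    unfolding haar_eq by (subst emeasure_distr) (auto simp: space_restrict_space)
qed

interpretation haar: finite_measure haar_circle
  by standard (simp add: emeasure_haar)

lemma haar_moment: "(LINT z|haar_circle. z powi k) = (if k = 0 then 1 else 0)"
proof (cases "k = 0")
  case True
  then show ?thesis using emeasure_haar by (simp add: measure_def)
next
  case False
  have m: "(\<lambda>z. z powi k) \<in> borel_measurable haar_circle"
    by (rule borel_measurable_haarI) measurable
  let ?F = "\<lambda>t. \<i> * cis (- (of_int k * t)) / of_int k"
  have "(?F has_vector_derivative cis (- (of_int k * x))) (at x within {-pi..pi})" for x
  proof -
    have "((\<lambda>w. \<i> * exp (- (\<i> * of_int k * w)) / of_int k) has_field_derivative exp (- (\<i> * of_int k * of_real x))) (at (of_real x))"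
      using False by (auto intro!: derivative_eq_intros simp: field_simps)
    from has_vector_derivative_real_field[OF this] show ?thesis
      by (simp add: cis_conv_exp mult.assoc)
  qed
  then have "(LINT t|lborel. indicator {-pi..pi} t *\<^sub>R cis (- (of_int k * t))) = ?F pi - ?F (-pi)"
    by (intro integral_FTC_Icc) (auto intro!: continuous_intros)
  also have "\<dots> = 0"
    using sin_zero_iff_int2[of "of_int k * pi"] by (auto simp: complex_eq_iff)
  finally have "(LINT t|lborel. indicator {-pi..pi} t *\<^sub>R cis (- (of_int k * t))) = 0" .
  then have "(LINT t|lborel. (indicator {-pi..pi} t *\<^sub>R cis (- (of_int k * t))) / of_real (2*pi)) = 0"
    by (simp only: integral_divide_zero) simp
  moreover have "(LINT z|haar_circle. z powi k) = (LINT t|lborel. (indicator {-pi..pi} t *\<^sub>R cis (- (of_int k * t))) / of_real (2*pi))"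
    by (simp add: integral_haar[OF m] cis_power_int scaleR_conv_of_real)
  ultimately show ?thesis using False by simp
qed

lemma borel_measurable_ident_haar:
  assumes "sets M = sets haar_circle"
  shows "(\<lambda>z. z) \<in> borel_measurable M"
  unfolding measurable_cong_sets[OF assms[unfolded sets_haar] refl]
  by (rule measurable_restrict_space1) simp

lemma circle_measure_distr:
  assumes "finite_measure M" "sets M = sets haar_circle"
  shows "circle_measure (distr M borel (\<lambda>z. z))"
proof -
  interpret M: finite_measure M by fact
  have m: "(\<lambda>z. z) \<in> M \<rightarrow>\<^sub>M borel"
    using assms(2) by (rule borel_measurable_ident_haar)
  have sp: "space M = sphere 0 1" using sets_eq_imp_space_eq[OF assms(2)] by simp
  have "AE z in distr M borel (\<lambda>z. z). cmod z = 1"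
    by (subst AE_distr_iff[OF m]) (auto simp: sp)
  moreover have "finite_measure (distr M borel (\<lambda>z. z))" by (rule M.finite_measure_distr[OF m])
  ultimately show ?thesis by (simp add: circle_measure_def circle_measure_axioms_def)
qed

text \<open>Both measures are pushed to the plane, where moments determine them. No information is
  lost, as the measurable subsets of the circle are Borel in the plane.\<close>

lemma haar_eqI:
  assumes "finite_measure M" "sets M = sets haar_circle"
    and mom: "\<And>k. (LINT z|M. z powi k) = (if k = 0 then 1 else 0)"
  shows "M = haar_circle"
proof -
  have id: "(\<lambda>z. z) \<in> P \<rightarrow>\<^sub>M borel" if "sets P = sets haar_circle" for P :: "complex measure"
    using that by (rule borel_measurable_ident_haar)
  have eq: "distr M borel (\<lambda>z. z) = distr haar_circle borel (\<lambda>z. z)"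
  proof (rule circle_measure_eqI)
    fix k
    show "(LINT z|distr M borel (\<lambda>z. z). z powi k) = (LINT z|distr haar_circle borel (\<lambda>z. z). z powi k)"
      by (simp add: integral_distr id assms mom haar_moment del: sets_haar)
  qed (intro circle_measure_distr assms haar.finite_measure_axioms refl)+
  show ?thesis
  proof (rule measure_eqI)
    fix A assume A: "A \<in> sets M"
    then have A': "A \<in> sets borel" "A \<subseteq> sphere 0 1"
      using assms(2) by (auto simp: sets_restrict_space_iff)
    have "emeasure (distr P borel (\<lambda>z. z)) A = emeasure P A" if P: "sets P = sets haar_circle" for P
      using A' sets_eq_imp_space_eq[OF P] by (subst emeasure_distr[OF id[OF P]]) (auto simp: Int_absorb2)
    then show "emeasure M A = emeasure haar_circle A"
      using eq assms(2) by metis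
  qed (fact assms)
qed

lemma L2_haar_bound:
  assumes "f \<in> borel_measurable haar_circle" "AE z in haar_circle. cmod (f z) \<le> B"
  shows "f \<in> L2 haar_circle"
proof -
  have "integrable haar_circle (\<lambda>z. (cmod (f z))\<^sup>2)"
  proof (rule haar.integrable_const_bound)
    show "AE z in haar_circle. norm ((cmod (f z))\<^sup>2) \<le> B\<^sup>2"
      using assms(2) by eventually_elim (auto intro: power_mono)
  qed (use assms(1) in measurable)
  then show ?thesis using assms(1) by (simp add: L2_def)
qed

lemma L2_haar_integrable:
  assumes "f \<in> L2 haar_circle"
  shows "integrable haar_circle f"
  using L2_mult_integrable[OF assms L2_haar_bound[of "\<lambda>z. 1" 1]] by simp

lemma borel_measurable_power_int_haar [measurable]: "(\<lambda>z. z powi k) \<in> borel_measurable haar_circle"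
  by (rule borel_measurable_haarI) measurable

lemma AE_haarI: "(\<And>z. cmod z = 1 \<Longrightarrow> P z) \<Longrightarrow> AE z in haar_circle. P z"
  by (rule AE_I2) simp

lemma L2_power_int [simp]: "(\<lambda>z. z powi k) \<in> L2 haar_circle"
  by (rule L2_haar_bound[of _ 1]) (auto intro: AE_haarI)

lemma L2_haar_trig_poly [simp]: "trig_poly X c \<in> L2 haar_circle"
  unfolding trig_poly_def by (intro L2_sum L2_cmult) simp

lemma inner_power_int:
  "L2_inner haar_circle (\<lambda>z. z powi k) (\<lambda>z. z powi l) = (if k = l then 1 else 0)"
proof -
  have "L2_inner haar_circle (\<lambda>z. z powi k) (\<lambda>z. z powi l) = (LINT z|haar_circle. z powi (k - l))"
    unfolding L2_inner_def
  proof (rule Bochner_Integration.integral_cong[OF refl])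
    fix z assume "z \<in> space haar_circle"
    then have "cmod z = 1" "z \<noteq> 0" by auto
    then show "z powi k * cnj (z powi l) = z powi (k - l)"
      by (subst cnj_power_int_circle) (auto simp: power_int_diff power_int_minus field_simps)
  qed
  then show ?thesis by (simp add: haar_moment)
qed

theorem haar_trig_poly_dense:
  assumes f: "f \<in> L2 haar_circle" and e: "0 < e"
  obtains X c where "finite X" "L2_norm haar_circle (\<lambda>z. f z - trig_poly X c z) < e"
proof -
  let ?M = "distr haar_circle borel (\<lambda>z. z)"
  interpret M: circle_measure ?M
    by (intro circle_measure_distr haar.finite_measure_axioms refl)
  have id: "(\<lambda>z. z) \<in> haar_circle \<rightarrow>\<^sub>M borel"
    by (rule borel_measurable_ident_haar) simp
  \<comment> \<open>Extension by zero: \<open>f\<close> is known to be measurable on the circle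
    only, while density was proved for Borel functions on the plane.\<close>
  define g where "g z = indicator (sphere 0 1) z *\<^sub>R f z" for z
  have g: "g \<in> borel_measurable borel"
    using L2_borel[OF f] unfolding g_def borel_measurable_haar_iff
    by (subst (asm) borel_measurable_restrict_space_iff) auto
  have norm_eq: "(LINT z|?M. (cmod (h z))\<^sup>2) = (LINT z|haar_circle. (cmod (h z))\<^sup>2)"
    and int_eq: "integrable ?M (\<lambda>z. (cmod (h z))\<^sup>2) \<longleftrightarrow> integrable haar_circle (\<lambda>z. (cmod (h z))\<^sup>2)"
    if [measurable]: "h \<in> borel_measurable borel" for h
    by (simp_all add: integral_distr[OF id] integrable_distr_eq[OF id])
  have "integrable haar_circle (\<lambda>z. (cmod (g z))\<^sup>2)"
    using L2_integrable[OF f] by (rule Bochner_Integration.integrable_cong[OF refl, THEN iffD1, rotated]) (simp add: g_def)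
  then have "g \<in> L2 ?M" using g by (simp add: L2_def int_eq)
  from M.trig_poly_dense[OF this e] obtain X c
    where X: "finite X" "L2_norm ?M (\<lambda>z. g z - trig_poly X c z) < e" by blast
  have "L2_norm ?M (\<lambda>z. g z - trig_poly X c z) = L2_norm haar_circle (\<lambda>z. g z - trig_poly X c z)"
    unfolding L2_norm_def by (subst norm_eq) (use g in auto)
  also have "\<dots> = L2_norm haar_circle (\<lambda>z. f z - trig_poly X c z)"
    unfolding L2_norm_def by (intro arg_cong[where f=sqrt] Bochner_Integration.integral_cong) (auto simp: g_def)
  finally show ?thesis using X that by simp
qed

lemma inner_trig_poly:
  assumes f: "f \<in> L2 haar_circle"
  shows "L2_inner haar_circle f (trig_poly X d) = (\<Sum>k\<in>X. cnj (d k) * L2_inner haar_circle f (\<lambda>z. z powi k))"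
proof -
  have "L2_inner haar_circle (trig_poly X d) f = (\<Sum>k\<in>X. d k * L2_inner haar_circle (\<lambda>z. z powi k) f)"
    unfolding trig_poly_def using f
    by (subst L2_inner_sum_left) (auto simp: L2_inner_cmult_left intro: L2_cmult)
  then have "cnj (L2_inner haar_circle (trig_poly X d) f) = (\<Sum>k\<in>X. cnj (d k) * cnj (L2_inner haar_circle (\<lambda>z. z powi k) f))"
    by simp
  then show ?thesis by (simp only: L2_inner_commute[of haar_circle f])
qed

lemma norm_trig_poly_sq:
  assumes "finite X"
  shows "(L2_norm haar_circle (trig_poly X d))\<^sup>2 = (\<Sum>k\<in>X. (cmod (d k))\<^sup>2)"
proof -
  have "complex_of_real ((L2_norm haar_circle (trig_poly X d))\<^sup>2) =
      (\<Sum>k\<in>X. cnj (d k) * L2_inner haar_circle (trig_poly X d) (\<lambda>z. z powi k))"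
    unfolding L2_inner_self[symmetric] by (rule inner_trig_poly) simp
  also have "\<dots> = (\<Sum>k\<in>X. cnj (d k) * (\<Sum>l\<in>X. d l * (if l = k then 1 else 0)))"
    unfolding trig_poly_def
    by (subst L2_inner_sum_left) (auto simp: L2_inner_cmult_left inner_power_int intro: L2_cmult)
  also have "\<dots> = (\<Sum>k\<in>X. d k * cnj (d k))"
    using assms by (intro sum.cong refl) (simp add: if_distrib sum.delta cong: if_cong)
  also have "\<dots> = complex_of_real (\<Sum>k\<in>X. (cmod (d k))\<^sup>2)"
    by (simp add: complex_norm_square del: of_real_power)
  finally show ?thesis by (simp only: of_real_eq_iff)
qed

text \<open>Completing the square. When \<open>d\<close> consists of the Fourier coefficients the
  last sum vanishes, which yields Bessel's inequality; for other \<open>d\<close> that sum is the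
  price of a non-optimal choice.\<close>

lemma norm_diff_trig_poly:
  assumes f: "f \<in> L2 haar_circle" and X: "finite X"
  shows "(L2_norm haar_circle (\<lambda>z. f z - trig_poly X d z))\<^sup>2 = (L2_norm haar_circle f)\<^sup>2
    - (\<Sum>k\<in>X. (cmod (L2_inner haar_circle f (\<lambda>z. z powi k)))\<^sup>2)
    + (\<Sum>k\<in>X. (cmod (L2_inner haar_circle f (\<lambda>z. z powi k) - d k))\<^sup>2)"
proof -
  let ?c = "\<lambda>k. L2_inner haar_circle f (\<lambda>z. z powi k)"
  have neg: "(\<lambda>z. f z - trig_poly X d z) = (\<lambda>z. f z + trig_poly X (\<lambda>k. - d k) z)"
    by (simp add: trig_poly_def sum_negf)
  have "(cmod (?c k - d k))\<^sup>2 = (cmod (?c k))\<^sup>2 - 2 * Re (cnj (d k) * ?c k) + (cmod (d k))\<^sup>2" for k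
    unfolding cmod_power2 by (simp add: power2_eq_square algebra_simps)
  then show ?thesis
    unfolding neg L2_norm_add_sq[OF f L2_haar_trig_poly] norm_trig_poly_sq[OF X] inner_trig_poly[OF f]
    by (simp add: sum.distrib sum_subtractf sum_distrib_left sum_negf)
qed

text \<open>A trigonometric polynomial within \<open>sqrt e\<close> of \<open>f\<close>, extended by
  zero coefficients to any larger index set, bounds the deficit in Bessel's inequality by
  \<open>e\<close> on that set.\<close>

theorem Parseval:
  assumes f: "f \<in> L2 haar_circle"
  shows "((\<lambda>k. (cmod (L2_inner haar_circle f (\<lambda>z. z powi k)))\<^sup>2) has_sum (L2_norm haar_circle f)\<^sup>2) UNIV"
  unfolding has_sum_def tendsto_iff
proof (intro allI impI)
  let ?c = "\<lambda>k. L2_inner haar_circle f (\<lambda>z. z powi k)"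
  fix e :: real assume e: "0 < e"
  then obtain X d where X: "finite X" "L2_norm haar_circle (\<lambda>z. f z - trig_poly X d z) < sqrt e"
    using haar_trig_poly_dense[OF f, of "sqrt e"] by auto
  have close: "(L2_norm haar_circle (\<lambda>z. f z - trig_poly X d z))\<^sup>2 < e"
    using X(2) e by (metis L2_norm_nonneg abs_of_nonneg real_less_rsqrt real_sqrt_less_iff real_sqrt_abs)
  show "\<forall>\<^sub>F Y in finite_subsets_at_top UNIV. dist (\<Sum>k\<in>Y. (cmod (?c k))\<^sup>2) ((L2_norm haar_circle f)\<^sup>2) < e"
    unfolding eventually_finite_subsets_at_top
  proof (intro exI[of _ X] conjI allI impI)
    fix Y :: "int set" assume Y: "finite Y \<and> X \<subseteq> Y \<and> Y \<subseteq> UNIV"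
    let ?d = "\<lambda>k. if k \<in> X then d k else 0"
    have "trig_poly Y ?d = trig_poly X d"
      unfolding trig_poly_def using Y X by (intro ext sum.mono_neutral_cong_right) auto
    then have "(L2_norm haar_circle f)\<^sup>2 - (\<Sum>k\<in>Y. (cmod (?c k))\<^sup>2) + (\<Sum>k\<in>Y. (cmod (?c k - ?d k))\<^sup>2) < e"
      using close norm_diff_trig_poly[OF f, of Y ?d] Y by simp
    moreover have "0 \<le> (\<Sum>k\<in>Y. (cmod (?c k - ?d k))\<^sup>2)" by (simp add: sum_nonneg)
    moreover have "0 \<le> (L2_norm haar_circle f)\<^sup>2 - (\<Sum>k\<in>Y. (cmod (?c k))\<^sup>2)"
      using norm_diff_trig_poly[OF f, of Y ?c] Y zero_le_power2[of "L2_norm haar_circle (\<lambda>z. f z - trig_poly Y ?c z)"] by simp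
    ultimately show "dist (\<Sum>k\<in>Y. (cmod (?c k))\<^sup>2) ((L2_norm haar_circle f)\<^sup>2) < e"
      by (simp add: dist_real_def)
  qed (use X in auto)
qed

section \<open>Averages over roots and filter operators\<close>

text \<open>\<open>Arg\<close> is continuous off the nonpositive reals; on them it is
  \<open>pi\<close>, and 0 at the origin by convention. It supplies a measurable choice of roots and
  of angles below.\<close>

lemma borel_measurable_Arg [measurable]: "Arg \<in> borel_measurable borel"
proof -
  have cont: "(\<lambda>z. indicat_real (- \<real>\<^sub>\<le>\<^sub>0) z *\<^sub>R Arg z) \<in> borel_measurable borel"
    by (intro borel_measurable_continuous_on_indicator continuous_intros) auto
  have "(\<lambda>z. if z \<in> \<real>\<^sub>\<le>\<^sub>0 then (if z = 0 then 0 else pi) else indicator (- \<real>\<^sub>\<le>\<^sub>0) z *\<^sub>R Arg z) \<in> borel_measurable borel"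
    (is "?f \<in> _") by (rule measurable_If_set[OF _ cont]) auto
  moreover have "?f = Arg"
  proof (rule ext)
    fix z show "?f z = Arg z"
    proof (cases "z = 0")
      case True
      then show ?thesis by (simp add: Arg_zero)
    next
      case False
      then show ?thesis
        using Arg_eq_pi[of z] by (auto simp: complex_nonpos_Reals_iff complex_eq_iff)
    qed
  qed
  ultimately show ?thesis by simp
qed

lemma measurable_haar_mult [measurable]:
  assumes "cmod u = 1"
  shows "(\<lambda>z. u * z) \<in> haar_circle \<rightarrow>\<^sub>M haar_circle"
proof -
  have "(\<lambda>z. u * z) \<in> haar_circle \<rightarrow>\<^sub>M restrict_space borel (sphere 0 1)"
    by (intro measurable_restrict_space2 borel_measurable_haarI) (use assms in \<open>auto simp: norm_mult\<close>)
  then show ?thesis by (simp add: measurable_cong_sets[OF refl sets_haar])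
qed

lemma measurable_haar_power [measurable]: "(\<lambda>z. z ^ n) \<in> haar_circle \<rightarrow>\<^sub>M haar_circle"
proof -
  have "(\<lambda>z::complex. z ^ n) \<in> haar_circle \<rightarrow>\<^sub>M restrict_space borel (sphere 0 1)"
    by (intro measurable_restrict_space2 borel_measurable_haarI) (auto simp: norm_power)
  then show ?thesis by (simp add: measurable_cong_sets[OF refl sets_haar])
qed

text \<open>Rotation multiplies the \<open>k\<close>-th moment by \<open>u powi k\<close>, which
  leaves 1 at \<open>k = 0\<close> and 0 elsewhere. The power map treated next replaces
  \<open>k\<close> by \<open>n * k\<close>, to the same effect.\<close>

lemma haar_distr_mult:
  assumes u: "cmod u = 1"
  shows "distr haar_circle haar_circle (\<lambda>z. u * z) = haar_circle"
proof (rule haar_eqI)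
  note [measurable] = measurable_haar_mult[OF u]
  show "finite_measure (distr haar_circle haar_circle (\<lambda>z. u * z))"
    by (rule haar.finite_measure_distr) measurable
  fix k
  have "(LINT z|distr haar_circle haar_circle (\<lambda>z. u * z). z powi k) = (LINT z|haar_circle. u powi k * z powi k)"
    by (subst integral_distr) (auto simp: power_int_mult_distrib)
  then show "(LINT z|distr haar_circle haar_circle (\<lambda>z. u * z). z powi k) = (if k = 0 then 1 else 0)"
    by (simp add: haar_moment)
qed simp

lemma haar_distr_power:
  assumes n: "0 < n"
  shows "distr haar_circle haar_circle (\<lambda>z. z ^ n) = haar_circle"
proof (rule haar_eqI)
  show "finite_measure (distr haar_circle haar_circle (\<lambda>z. z ^ n))"
    by (rule haar.finite_measure_distr) measurable
  fix k
  have "(LINT z|distr haar_circle haar_circle (\<lambda>z. z ^ n). z powi k) = (LINT z|haar_circle. z powi (int n * k))"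
    by (subst integral_distr) (auto simp: power_int_mult)
  then show "(LINT z|distr haar_circle haar_circle (\<lambda>z. z ^ n). z powi k) = (if k = 0 then 1 else 0)"
    using n by (simp add: haar_moment)
qed simp

lemma haar_integral_mult:
  fixes h :: "complex \<Rightarrow> 'b::{banach, second_countable_topology}"
  assumes "cmod u = 1" "h \<in> borel_measurable haar_circle"
  shows "(LINT z|haar_circle. h (u * z)) = (LINT z|haar_circle. h z)"
    "integrable haar_circle (\<lambda>z. h (u * z)) \<longleftrightarrow> integrable haar_circle h"
  using integral_distr[OF measurable_haar_mult[OF assms(1)] assms(2)]
    integrable_distr_eq[OF measurable_haar_mult[OF assms(1)] assms(2)]
  by (simp_all add: haar_distr_mult[OF assms(1)])

lemma haar_integral_power:
  fixes h :: "complex \<Rightarrow> 'b::{banach, second_countable_topology}"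
  assumes "0 < n" "h \<in> borel_measurable haar_circle"
  shows "(LINT z|haar_circle. h (z ^ n)) = (LINT z|haar_circle. h z)"
    "integrable haar_circle (\<lambda>z. h (z ^ n)) \<longleftrightarrow> integrable haar_circle h"
  using integral_distr[OF measurable_haar_power assms(2), of n]
    integrable_distr_eq[OF measurable_haar_power assms(2), of n]
  by (simp_all add: haar_distr_power[OF assms(1)])

lemma AE_haar_power:
  assumes "0 < n" "AE z in haar_circle. P z"
  shows "AE z in haar_circle. P (z ^ n)"
  using assms(2) AE_distrD[OF measurable_haar_power[of n]] haar_distr_power[OF assms(1)] by metis

section \<open>Averaging over the fibres of the power map\<close>

text \<open>The transfer operator of \<open>z \<mapsto> z ^ N\<close>; \<open>S_adj N m\<close> is
  this operator preceded by multiplication with \<open>cnj (m w)\<close>.\<close>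

definition root_average :: "nat \<Rightarrow> (complex \<Rightarrow> complex) \<Rightarrow> complex \<Rightarrow> complex" where
  "root_average N h z = (\<Sum>w | w ^ N = z. h w) / of_nat N"

abbreviation root_one :: "nat \<Rightarrow> complex" where
  "root_one N \<equiv> cis (2 * pi / real N)"

text \<open>Evaluated at \<open>z ^ N\<close>, the average has \<open>z\<close> itself as base point
  of the fibre and becomes a mean over rotations by roots of unity, the shape in which the unitary
  matrix enters.\<close>

lemma root_average_power:
  assumes "0 < N" "cmod z = 1"
  shows "root_average N h (z ^ N) = (\<Sum>k<N. h (root_one N ^ k * z)) / of_nat N"
proof -
  have z: "z \<noteq> 0" using assms by auto
  have "bij_betw (\<lambda>u. u * z) {u. u ^ N = 1} {w. w ^ N = z ^ N}"
    by (rule bij_betwI[where g="\<lambda>w. w / z"]) (use z in \<open>auto simp: power_mult_distrib power_divide\<close>)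
  from bij_betw_trans[OF Complex.bij_betw_roots_unity[OF assms(1)] this]
  have "bij_betw (\<lambda>k. root_one N ^ k * z) {..<N} {w. w ^ N = z ^ N}"
    by (simp add: o_def Complex.DeMoivre mult_ac)
  from sum.reindex_bij_betw[OF this, of h] show ?thesis
    by (simp add: root_average_def)
qed

text \<open>The fibre varies with \<open>z\<close>, so one root is chosen measurably,
  \<open>cis (Arg z / N)\<close>; its rotations list the others and leave a finite sum of measurable
  functions.\<close>

lemma borel_measurable_root_average:
  assumes N: "0 < N" and h: "h \<in> borel_measurable haar_circle"
  shows "root_average N h \<in> borel_measurable haar_circle"
proof -
  have eq: "root_average N h z = (\<Sum>k<N. h (root_one N ^ k * cis (Arg z / real N))) / of_nat N"
    if z: "z \<in> space haar_circle" for z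
  proof -
    have "cis (Arg z / real N) ^ N = cis (Arg z)"
      using N by (simp add: Complex.DeMoivre)
    also have "\<dots> = z" using z by (subst cis_Arg) (auto simp: sgn_div_norm)
    finally show ?thesis using root_average_power[OF N, of "cis (Arg z / real N)" h] by simp
  qed
  have "(\<lambda>z. root_one N ^ k * cis (Arg z / real N)) \<in> haar_circle \<rightarrow>\<^sub>M restrict_space borel (sphere 0 1)" for k
    by (intro measurable_restrict_space2 borel_measurable_haarI) (auto simp: norm_mult norm_power)
  then have "(\<lambda>z. h (root_one N ^ k * cis (Arg z / real N))) \<in> borel_measurable haar_circle" for k
    using measurable_compose h unfolding borel_measurable_haar_iff[of h] by blast
  then have "(\<lambda>z. (\<Sum>k<N. h (root_one N ^ k * cis (Arg z / real N))) / of_nat N) \<in> borel_measurable haar_circle"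
    by measurable
  then show ?thesis by (subst measurable_cong[OF eq])
qed

lemma haar_integral_average_rotations:
  fixes h :: "complex \<Rightarrow> complex"
  assumes N: "0 < N" and h: "integrable haar_circle h"
  shows "(LINT z|haar_circle. (\<Sum>k<N. h (root_one N ^ k * z)) / of_nat N) = (LINT z|haar_circle. h z)"
    "integrable haar_circle (\<lambda>z. (\<Sum>k<N. h (root_one N ^ k * z)) / of_nat N)"
proof -
  have rot: "integrable haar_circle (\<lambda>z. h (root_one N ^ k * z))"
    "(LINT z|haar_circle. h (root_one N ^ k * z)) = (LINT z|haar_circle. h z)" for k
    using haar_integral_mult[of "root_one N ^ k" h] h by (auto simp: norm_power)
  show "integrable haar_circle (\<lambda>z. (\<Sum>k<N. h (root_one N ^ k * z)) / of_nat N)"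
    using rot by simp
  show "(LINT z|haar_circle. (\<Sum>k<N. h (root_one N ^ k * z)) / of_nat N) = (LINT z|haar_circle. h z)"
    using N by (simp add: rot)
qed

text \<open>Invariance under \<open>z \<mapsto> z ^ N\<close> allows the average to be evaluated at
  \<open>z ^ N\<close>, where it is a mean of rotations, each of which preserves the
  integral.\<close>

lemma haar_integral_root_average:
  assumes N: "0 < N" and h: "integrable haar_circle h"
  shows "(LINT z|haar_circle. root_average N h z) = (LINT z|haar_circle. h z)"
    "integrable haar_circle (root_average N h)"
proof -
  note m = borel_measurable_root_average[OF N borel_measurable_integrable[OF h]]
  have eq: "root_average N h (z ^ N) = (\<Sum>k<N. h (root_one N ^ k * z)) / of_nat N"
    if "z \<in> space haar_circle" for z using that root_average_power[OF N] by simp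
  have "(LINT z|haar_circle. root_average N h z) = (LINT z|haar_circle. root_average N h (z ^ N))"
    by (rule haar_integral_power(1)[OF N m, symmetric])
  also have "\<dots> = (LINT z|haar_circle. h z)"
    unfolding haar_integral_average_rotations(1)[OF N h, symmetric]
    by (rule Bochner_Integration.integral_cong[OF refl eq])
  finally show "(LINT z|haar_circle. root_average N h z) = (LINT z|haar_circle. h z)" .
  have "integrable haar_circle (\<lambda>z. root_average N h (z ^ N))"
    using haar_integral_average_rotations(2)[OF N h]
    by (simp only: Bochner_Integration.integrable_cong[OF refl eq])
  then show "integrable haar_circle (root_average N h)"
    by (simp add: haar_integral_power(2)[OF N m])
qed

text \<open>The bound holds almost everywhere because unitarity of the filter matrix is given only
  almost everywhere.\<close>

definition bounded_haar :: "(complex \<Rightarrow> complex) \<Rightarrow> bool" where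
  "bounded_haar g \<longleftrightarrow> g \<in> borel_measurable haar_circle \<and> (\<exists>B. AE z in haar_circle. cmod (g z) \<le> B)"

lemma bounded_haar_borel: "bounded_haar g \<Longrightarrow> g \<in> borel_measurable haar_circle"
  by (simp add: bounded_haar_def)

lemma bounded_haar_power_int: "bounded_haar (\<lambda>z. z powi k)"
  unfolding bounded_haar_def by (auto intro!: exI[of _ 1] AE_haarI)

lemma bounded_haar_cnj: "bounded_haar g \<Longrightarrow> bounded_haar (\<lambda>z. cnj (g z))"
  by (auto simp: bounded_haar_def)

lemma bounded_haar_integrable_mult:
  assumes f: "integrable haar_circle f" and g: "bounded_haar g"
  shows "integrable haar_circle (\<lambda>z. f z * g z)"
proof -
  obtain B where B: "AE z in haar_circle. cmod (g z) \<le> B" using g by (auto simp: bounded_haar_def)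
  show ?thesis
  proof (rule Bochner_Integration.integrable_bound)
    show "integrable haar_circle (\<lambda>z. \<bar>B\<bar> * norm (f z))" using f by simp
    show "(\<lambda>z. f z * g z) \<in> borel_measurable haar_circle"
      using borel_measurable_integrable[OF f] bounded_haar_borel[OF g] by measurable
    show "AE z in haar_circle. norm (f z * g z) \<le> norm (\<bar>B\<bar> * norm (f z))"
      using B
    proof eventually_elim
      fix z assume "cmod (g z) \<le> B"
      then have "cmod (f z) * cmod (g z) \<le> cmod (f z) * \<bar>B\<bar>" by (intro mult_left_mono) auto
      then show "norm (f z * g z) \<le> norm (\<bar>B\<bar> * norm (f z))" by (simp add: norm_mult mult.commute)
    qed
  qed
qed

lemma bounded_haar_mult:
  assumes "bounded_haar f" "bounded_haar g"
  shows "bounded_haar (\<lambda>z. f z * g z)"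
proof -
  obtain A B where A: "AE z in haar_circle. cmod (f z) \<le> A" and B: "AE z in haar_circle. cmod (g z) \<le> B"
    using assms by (auto simp: bounded_haar_def)
  have "AE z in haar_circle. cmod (f z * g z) \<le> A * B"
    using A B
  proof eventually_elim
    fix z assume "cmod (f z) \<le> A" "cmod (g z) \<le> B"
    then show "cmod (f z * g z) \<le> A * B"
      by (auto simp: norm_mult intro!: mult_mono order_trans[OF norm_ge_zero])
  qed
  then show ?thesis using assms by (auto simp: bounded_haar_def)
qed

lemma bounded_haar_compose_power:
  assumes "0 < n" "bounded_haar g"
  shows "bounded_haar (\<lambda>z. g (z ^ n))"
proof -
  obtain B where "AE z in haar_circle. cmod (g z) \<le> B" using assms by (auto simp: bounded_haar_def)
  then have "AE z in haar_circle. cmod (g (z ^ n)) \<le> B" by (rule AE_haar_power[OF assms(1)])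
  moreover have "(\<lambda>z. g (z ^ n)) \<in> borel_measurable haar_circle"
    by (rule measurable_compose[OF measurable_haar_power bounded_haar_borel[OF assms(2)]])
  ultimately show ?thesis by (auto simp: bounded_haar_def)
qed

lemma bounded_haar_L2_mult:
  assumes f: "f \<in> L2 haar_circle" and g: "bounded_haar g"
  shows "(\<lambda>z. g z * f z) \<in> L2 haar_circle"
proof -
  obtain B where B: "AE z in haar_circle. cmod (g z) \<le> B" using g by (auto simp: bounded_haar_def)
  note [measurable] = L2_borel[OF f] bounded_haar_borel[OF g]
  have "integrable haar_circle (\<lambda>z. (cmod (g z * f z))\<^sup>2)"
  proof (rule Bochner_Integration.integrable_bound)
    show "integrable haar_circle (\<lambda>z. B\<^sup>2 * (cmod (f z))\<^sup>2)" using L2_integrable[OF f] by simp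
    show "AE z in haar_circle. norm ((cmod (g z * f z))\<^sup>2) \<le> norm (B\<^sup>2 * (cmod (f z))\<^sup>2)"
      using B
    proof eventually_elim
      fix z assume "cmod (g z) \<le> B"
      then have "(cmod (g z))\<^sup>2 \<le> B\<^sup>2" by (intro power_mono) auto
      then show "norm ((cmod (g z * f z))\<^sup>2) \<le> norm (B\<^sup>2 * (cmod (f z))\<^sup>2)"
        by (simp add: norm_mult power_mult_distrib mult_right_mono)
    qed
  qed measurable
  then show ?thesis by (simp add: L2_def)
qed

lemma L2_compose_power:
  assumes "0 < n" "f \<in> L2 haar_circle"
  shows "(\<lambda>z. f (z ^ n)) \<in> L2 haar_circle"
proof -
  note [measurable] = L2_borel[OF assms(2)]
  have "(\<lambda>z. f (z ^ n)) \<in> borel_measurable haar_circle"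
    by (rule measurable_compose[OF measurable_haar_power]) measurable
  moreover have "integrable haar_circle (\<lambda>z. (cmod (f (z ^ n)))\<^sup>2)"
    using haar_integral_power(2)[OF assms(1), of "\<lambda>z. (cmod (f z))\<^sup>2"] L2_integrable[OF assms(2)] by simp
  ultimately show ?thesis by (simp add: L2_def)
qed

section \<open>The filter operators and their adjoints\<close>

definition S_op :: "nat \<Rightarrow> (complex \<Rightarrow> complex) \<Rightarrow> (complex \<Rightarrow> complex) \<Rightarrow> complex \<Rightarrow> complex" where
  "S_op N m g z = m z * g (z ^ N)"

lemma S_op_bounded: "0 < N \<Longrightarrow> bounded_haar m \<Longrightarrow> bounded_haar g \<Longrightarrow> bounded_haar (S_op N m g)"
  unfolding S_op_def by (intro bounded_haar_mult bounded_haar_compose_power)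

lemma S_op_L2: "0 < N \<Longrightarrow> bounded_haar m \<Longrightarrow> g \<in> L2 haar_circle \<Longrightarrow> S_op N m g \<in> L2 haar_circle"
  unfolding S_op_def by (intro bounded_haar_L2_mult L2_compose_power)

lemma S_op_funpow_L2: "0 < N \<Longrightarrow> bounded_haar m \<Longrightarrow> g \<in> L2 haar_circle \<Longrightarrow> (S_op N m ^^ n) g \<in> L2 haar_circle"
  by (induction n) (auto intro: S_op_L2)

text \<open>On the fibre over \<open>z\<close> the factor \<open>g (w ^ N)\<close> is the constant
  \<open>g z\<close> and moves out of the average. Taking \<open>f\<close> integrable and
  \<open>g\<close> bounded gives a statement that reproduces its own hypotheses and can be
  iterated.\<close>

lemma S_adj_adjoint:
  assumes N: "0 < N" and f: "integrable haar_circle f" and m: "bounded_haar m" and g: "bounded_haar g"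
  shows "integrable haar_circle (S_adj N m f)"
    "(LINT z|haar_circle. S_adj N m f z * cnj (g z)) = (LINT z|haar_circle. f z * cnj (S_op N m g z))"
proof -
  have "S_adj N m f = root_average N (\<lambda>w. f w * cnj (m w))"
    by (rule ext) (simp add: S_adj_def root_average_def mult.commute)
  then show "integrable haar_circle (S_adj N m f)"
    by (simp add: haar_integral_root_average(2) N f m bounded_haar_integrable_mult bounded_haar_cnj)
  have "S_adj N m f z * cnj (g z) = root_average N (\<lambda>w. f w * cnj (S_op N m g w)) z" for z
  proof -
    have "(\<Sum>w | w ^ N = z. f w * cnj (S_op N m g w)) = (\<Sum>w | w ^ N = z. cnj (m w) * f w * cnj (g z))"
      by (rule sum.cong) (auto simp: S_op_def)
    then show ?thesis by (simp add: S_adj_def root_average_def sum_distrib_right)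
  qed
  then show "(LINT z|haar_circle. S_adj N m f z * cnj (g z)) = (LINT z|haar_circle. f z * cnj (S_op N m g z))"
    using haar_integral_root_average(1)[OF N bounded_haar_integrable_mult[OF f bounded_haar_cnj[OF S_op_bounded[OF N m g]]]]
    by simp
qed

text \<open>Each step moves the outermost adjoint onto \<open>g\<close>, so \<open>g\<close> has to
  vary in the induction; it stays bounded under \<open>S_op\<close>.\<close>

lemma S_adj_funpow_adjoint:
  assumes N: "0 < N" and f: "integrable haar_circle f" and m: "bounded_haar m" and g: "bounded_haar g"
  shows "integrable haar_circle ((S_adj N m ^^ n) f)"
    "(LINT z|haar_circle. (S_adj N m ^^ n) f z * cnj (g z)) = (LINT z|haar_circle. f z * cnj ((S_op N m ^^ n) g z))"
proof -
  show int: "integrable haar_circle ((S_adj N m ^^ n) f)" for n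
    by (induction n) (auto intro: S_adj_adjoint(1)[OF N _ m g] f)
  show "(LINT z|haar_circle. (S_adj N m ^^ n) f z * cnj (g z)) = (LINT z|haar_circle. f z * cnj ((S_op N m ^^ n) g z))"
    using g
  proof (induction n arbitrary: g)
    case (Suc n)
    have "(LINT z|haar_circle. (S_adj N m ^^ Suc n) f z * cnj (g z)) =
        (LINT z|haar_circle. (S_adj N m ^^ n) f z * cnj (S_op N m g z))"
      using S_adj_adjoint(2)[OF N int m Suc.prems] by simp
    also have "\<dots> = (LINT z|haar_circle. f z * cnj ((S_op N m ^^ n) (S_op N m g) z))"
      by (rule Suc.IH) (rule S_op_bounded[OF N m Suc.prems])
    finally show ?case by (simp add: funpow_swap1)
  qed simp
qed

section \<open>Orthogonality relations of a unitary filter bank\<close>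

locale filter_bank =
  fixes N :: nat and m :: "nat \<Rightarrow> complex \<Rightarrow> complex"
  assumes N_pos: "0 < N"
    and m_borel: "\<And>i. i < N \<Longrightarrow> m i \<in> borel_measurable haar_circle"
    and unitary: "AE z in haar_circle.
        unitary_entries N (\<lambda>i k. m i (cis (2 * pi / real N) ^ k * z) / of_real (sqrt (real N)))"
begin

lemma m_orth:
  assumes "i < N" "j < N"
  shows "AE z in haar_circle. (\<Sum>k<N. m i (root_one N ^ k * z) * cnj (m j (root_one N ^ k * z))) / of_nat N = (if i = j then 1 else 0)"
  using unitary
proof eventually_elim
  case (elim z)
  have s: "complex_of_real (sqrt (real N)) * complex_of_real (sqrt (real N)) = of_nat N"
    by (simp flip: of_real_mult)
  have "(\<Sum>k<N. m i (root_one N ^ k * z) / of_real (sqrt (real N)) * cnj (m j (root_one N ^ k * z) / of_real (sqrt (real N))))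
      = (if i = j then 1 else 0)"
    using elim assms unfolding unitary_entries_def by blast
  then show ?case by (simp add: s flip: sum_divide_distrib)
qed

text \<open>The diagonal case of the row relations: the squared moduli over the \<open>N\<close>
  rotations add up to \<open>N\<close>, and the value at \<open>z\<close> itself is the summand with
  \<open>k = 0\<close>.\<close>

lemma m_bounded:
  assumes "i < N"
  shows "bounded_haar (m i)"
proof -
  have "AE z in haar_circle. cmod (m i z) \<le> sqrt (real N)"
    using m_orth[OF assms assms]
  proof eventually_elim
    case (elim z)
    then have "(\<Sum>k<N. m i (root_one N ^ k * z) * cnj (m i (root_one N ^ k * z))) = of_nat N"
      using N_pos by (simp add: field_simps)
    then have "complex_of_real (\<Sum>k<N. (cmod (m i (root_one N ^ k * z)))\<^sup>2) = of_real (real N)"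
      by (simp add: complex_norm_square del: of_real_power)
    then have "(\<Sum>k<N. (cmod (m i (root_one N ^ k * z)))\<^sup>2) = real N" by (simp only: of_real_eq_iff)
    moreover have "(cmod (m i (root_one N ^ 0 * z)))\<^sup>2 \<le> (\<Sum>k<N. (cmod (m i (root_one N ^ k * z)))\<^sup>2)"
      by (rule member_le_sum) (use N_pos in auto)
    ultimately show "cmod (m i z) \<le> sqrt (real N)" by (simp add: real_le_rsqrt)
  qed
  then show ?thesis using m_borel[OF assms] by (auto simp: bounded_haar_def)
qed

text \<open>Rotation by an \<open>N\<close>-th root of unity leaves \<open>g (z ^ N)\<close>
  unchanged, so averaging over these rotations acts on the filters alone and turns their product
  into a row relation.\<close>

lemma m_integral:
  assumes ij: "i < N" "j < N" and g: "integrable haar_circle g"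
  shows "(LINT z|haar_circle. m i z * cnj (m j z) * g (z ^ N)) = (if i = j then LINT z|haar_circle. g z else 0)"
proof -
  let ?h = "\<lambda>z. m i z * cnj (m j z) * g (z ^ N)"
  have gN: "integrable haar_circle (\<lambda>z. g (z ^ N))"
    using g by (simp add: haar_integral_power N_pos)
  have h: "integrable haar_circle ?h"
    using bounded_haar_integrable_mult[OF gN bounded_haar_mult[OF m_bounded[OF ij(1)] bounded_haar_cnj[OF m_bounded[OF ij(2)]]]]
    by (simp add: mult_ac)
  have root: "(root_one N ^ k * z) ^ N = z ^ N" for k z
  proof -
    have "(root_one N ^ k) ^ N = (root_one N ^ N) ^ k" by (simp flip: power_mult add: mult.commute)
    also have "root_one N ^ N = 1" using N_pos by (simp add: Complex.DeMoivre)
    finally show ?thesis by (simp add: power_mult_distrib)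
  qed
  have "(LINT z|haar_circle. ?h z) = (LINT z|haar_circle. (\<Sum>k<N. ?h (root_one N ^ k * z)) / of_nat N)"
    by (rule haar_integral_average_rotations(1)[OF N_pos h, symmetric])
  also have "\<dots> = (LINT z|haar_circle. (if i = j then 1 else 0) * g (z ^ N))"
  proof (rule integral_cong_AE)
    show "AE z in haar_circle. (\<Sum>k<N. ?h (root_one N ^ k * z)) / of_nat N = (if i = j then 1 else 0) * g (z ^ N)"
      using m_orth[OF ij]
    proof eventually_elim
      case (elim z)
      have "(\<Sum>k<N. ?h (root_one N ^ k * z)) / of_nat N =
          ((\<Sum>k<N. m i (root_one N ^ k * z) * cnj (m j (root_one N ^ k * z))) / of_nat N) * g (z ^ N)"
        by (simp add: root sum_distrib_right)
      then show ?case unfolding elim .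
    qed
  qed (use haar_integral_average_rotations(2)[OF N_pos h] gN in \<open>auto intro: borel_measurable_integrable\<close>)
  also have "\<dots> = (if i = j then LINT z|haar_circle. g z else 0)"
    using haar_integral_power(1)[OF N_pos borel_measurable_integrable[OF g]] by simp
  finally show ?thesis .
qed

text \<open>The relations between the filter operators in weak form: each is an isometry, and
  different ones have orthogonal ranges.\<close>

lemma S_op_inner:
  assumes ij: "i < N" "j < N" and "f \<in> L2 haar_circle" "g \<in> L2 haar_circle"
  shows "L2_inner haar_circle (S_op N (m i) f) (S_op N (m j) g) = (if i = j then L2_inner haar_circle f g else 0)"
  using m_integral[OF ij L2_mult_integrable[OF assms(3,4)]]
  by (simp add: L2_inner_def S_op_def mult_ac)

end

section \<open>The Plancherel theorem\<close>

text \<open>The line is cut into unit intervals. They are numbered through \<open>int_decode\<close>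
  because series of extended nonnegative numbers run over the naturals; a point \<open>t\<close>
  lies only in the interval with number \<open>int_encode \<lfloor>t\<rfloor>\<close>.\<close>

lemma nn_integral_periodize:
  fixes f :: "real \<Rightarrow> ennreal"
  assumes [measurable]: "f \<in> borel_measurable borel"
  shows "(\<integral>\<^sup>+t. f t \<partial>lborel) = (\<Sum>n. \<integral>\<^sup>+t. f (t + of_int (int_decode n)) * indicator {0..<1} t \<partial>lborel)"
proof -
  let ?d = "\<lambda>n. of_int (int_decode n) :: real"
  let ?I = "\<lambda>n. {?d n..<?d n + 1}"
  have "f t = (\<Sum>n. f t * indicator (?I n) t)" for t
  proof -
    have *: "t \<in> ?I n \<longleftrightarrow> n = int_encode \<lfloor>t\<rfloor>" for n
    proof -
      have "t \<in> ?I n \<longleftrightarrow> \<lfloor>t\<rfloor> = int_decode n" by (auto simp: floor_eq_iff)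
      then show ?thesis by (metis int_decode_inverse int_encode_inverse)
    qed
    have ind: "indicator (?I n) t = (if n = int_encode \<lfloor>t\<rfloor> then 1 else 0 :: ennreal)" for n
      unfolding indicator_def of_bool_def * ..
    have "(\<Sum>n. f t * indicator (?I n) t) = (\<Sum>n\<in>{int_encode \<lfloor>t\<rfloor>}. f t * indicator (?I n) t)"
      unfolding ind by (rule suminf_finite) auto
    also have "\<dots> = f t" unfolding ind by simp
    finally show ?thesis by simp
  qed
  then have "(\<integral>\<^sup>+t. f t \<partial>lborel) = (\<integral>\<^sup>+t. (\<Sum>n. f t * indicator (?I n) t) \<partial>lborel)" by simp
  also have "\<dots> = (\<Sum>n. \<integral>\<^sup>+t. f t * indicator (?I n) t \<partial>lborel)"
    by (rule nn_integral_suminf) measurable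
  also have "\<dots> = (\<Sum>n. \<integral>\<^sup>+t. f (t + ?d n) * indicator {0..<1} t \<partial>lborel)"
  proof (rule arg_cong[where f=suminf], rule ext)
    fix n
    have "(\<integral>\<^sup>+t. f t * indicator (?I n) t \<partial>lborel) = (\<integral>\<^sup>+t. f (?d n + 1 * t) * indicator (?I n) (?d n + 1 * t) \<partial>lborel)"
      by (subst nn_integral_real_affine[where c=1 and t="?d n"]) auto
    also have "\<dots> = (\<integral>\<^sup>+t. f (t + ?d n) * indicator {0..<1} t \<partial>lborel)"
      by (rule nn_integral_cong) (auto simp: indicator_def add.commute)
    finally show "(\<integral>\<^sup>+t. f t * indicator (?I n) t \<partial>lborel) = (\<integral>\<^sup>+t. f (t + ?d n) * indicator {0..<1} t \<partial>lborel)" .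
  qed
  finally show ?thesis .
qed

text \<open>\<open>R\<close> is positive so that it can serve as a dilation factor.\<close>

definition bounded_support :: "(real \<Rightarrow> complex) \<Rightarrow> bool" where
  "bounded_support f \<longleftrightarrow> (\<exists>R>0. \<forall>x. R < \<bar>x\<bar> \<longrightarrow> f x = 0)"

lemma L2_lborel_borel: "f \<in> L2 lborel \<Longrightarrow> f \<in> borel_measurable borel"
  using L2_borel by fastforce

text \<open>On a bounded interval L2 is contained in L1: \<open>f\<close> is its own product with
  the indicator of \<open>{-R..R}\<close>, which is in L2.\<close>

lemma bounded_support_integrable:
  assumes f: "f \<in> L2 lborel" and "bounded_support f"
  shows "integrable lborel f"
proof -
  obtain R where R: "\<And>x. R < \<bar>x\<bar> \<Longrightarrow> f x = 0" using assms(2) by (auto simp: bounded_support_def)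
  have "(indicator {-R..R} :: real \<Rightarrow> complex) \<in> L2 lborel"
  proof -
    have "integrable lborel (indicat_real {-R..R})"
      by (rule integrable_real_indicator) (auto simp: emeasure_lborel_Icc_eq)
    moreover have "(cmod (indicator {-R..R} x))\<^sup>2 = indicat_real {-R..R} x" for x by (simp add: indicator_def)
    ultimately show ?thesis by (simp add: L2_def)
  qed
  from L2_mult_integrable[OF f this]
  have "integrable lborel (\<lambda>x. f x * cnj (indicator {-R..R} x))" .
  moreover have "f x * cnj (indicator {-R..R} x) = f x" for x
    using R[of x] by (cases "R < \<bar>x\<bar>") (auto simp: indicator_def abs_le_iff not_less)
  ultimately show ?thesis by simp
qed

lemma fourier_L1_measurable:
  assumes [measurable]: "f \<in> borel_measurable borel"
  shows "fourier_L1 f \<in> borel_measurable borel"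
proof -
  have "(\<lambda>t. LINT x|lborel. cis (- (x * t)) * f x) \<in> borel_measurable borel"
    by (rule lborel.borel_measurable_lebesgue_integral) measurable
  then show ?thesis unfolding fourier_L1_def by measurable
qed

lemma integrable_cis_mult:
  assumes f: "integrable lborel f"
  shows "integrable lborel (\<lambda>x. cis (- (x * t)) * f x)"
  by (rule Bochner_Integration.integrable_bound[OF f])
     (use borel_measurable_integrable[OF f] in \<open>auto simp: norm_mult\<close>)

lemma fourier_L1_diff:
  assumes "integrable lborel f" "integrable lborel g"
  shows "fourier_L1 (\<lambda>x. f x - g x) t = fourier_L1 f t - fourier_L1 g t"
  unfolding fourier_L1_def
  by (simp add: right_diff_distrib integrable_cis_mult assms diff_divide_distrib)

lemma fourier_L1_add:
  assumes "integrable lborel f" "integrable lborel g"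
  shows "fourier_L1 (\<lambda>x. f x + g x) t = fourier_L1 f t + fourier_L1 g t"
  unfolding fourier_L1_def
  by (simp add: distrib_left integrable_cis_mult assms add_divide_distrib)

lemma fourier_L1_cmult: "fourier_L1 (\<lambda>x. c * f x) t = c * fourier_L1 f t"
proof -
  have "(LINT x|lborel. cis (- (x * t)) * (c * f x)) = (LINT x|lborel. c * (cis (- (x * t)) * f x))"
    by (simp add: mult_ac)
  then show ?thesis unfolding fourier_L1_def by simp
qed

text \<open>For \<open>f\<close> supported in \<open>[-1, 1]\<close>, the samples of its transform on \<open>s + \<int>\<close> are, up to a
  constant, the Fourier coefficients of \<open>x \<mapsto> cis (- x s) * f x\<close> on the circle.\<close>

lemma fourier_L1_samples:
  assumes f: "f \<in> L2 lborel" and supp: "\<And>x. 1 < \<bar>x\<bar> \<Longrightarrow> f x = 0"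
  shows "(\<lambda>n. (cmod (fourier_L1 f (s + of_int (int_decode n))))\<^sup>2) sums (L2_norm lborel f)\<^sup>2"
proof -
  note [measurable] = L2_lborel_borel[OF f]
  define h where "h x = cis (- (x * s)) * f x" for x
  \<comment> \<open>On the open interval from \<open>-pi\<close> to \<open>pi\<close>,
    \<open>- Arg z\<close> inverts \<open>t \<mapsto> cis (- t)\<close>. The support
    \<open>[-1, 1]\<close> lies well inside, so \<open>F\<close> vanishes at the cut
    \<open>z = -1\<close>.\<close>
  define F where "F z = h (- Arg z)" for z
  have [measurable]: "h \<in> borel_measurable borel" unfolding h_def by measurable
  have F_borel: "F \<in> borel_measurable borel" unfolding F_def by measurable
  have supp_h: "h x = 0" if "1 < \<bar>x\<bar>" for x using supp[OF that] by (simp add: h_def)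
  \<comment> \<open>\<open>G\<close> will be the identity or the squared modulus. The condition
    \<open>G 0 = 0\<close> settles the endpoints and the points outside the interval.\<close>
  have F_cis: "indicator {-pi..pi} x *\<^sub>R G (F (cis (- x))) = G (h x)" if "G 0 = 0" for x and G :: "complex \<Rightarrow> 'z::real_vector"
  proof (cases "x \<in> {-pi<..<pi}")
    case True
    then have "F (cis (- x)) = h x" unfolding F_def by (subst Arg_cis) auto
    then show ?thesis using True by simp
  next
    case False
    then have hx: "h x = 0" using pi_gt3 by (intro supp_h) (auto simp: not_less)
    have F1: "F (-1) = 0" unfolding F_def using pi_gt3 Arg_eq_pi[of "-1"] by (intro supp_h) simp
    have "x = pi \<or> x = -pi" if "x \<in> {-pi..pi}" using that False by auto
    moreover have "cis pi = -1" "cis (- pi) = -1" by (simp_all add: complex_eq_iff)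
    ultimately have "F (cis (- x)) = 0" if "x \<in> {-pi..pi}" using that F1 by auto
    then show ?thesis using hx that by (auto simp: indicator_def)
  qed
  have F_L2: "F \<in> L2 haar_circle" and F_norm: "(L2_norm haar_circle F)\<^sup>2 = (L2_norm lborel f)\<^sup>2 / (2*pi)"
  proof -
    have F: "F \<in> borel_measurable haar_circle" by (rule borel_measurable_haarI[OF F_borel])
    then have F2: "(\<lambda>z. (cmod (F z))\<^sup>2) \<in> borel_measurable haar_circle" by measurable
    have eq: "(indicator {-pi..pi} x / (2*pi)) *\<^sub>R (cmod (F (cis (- x))))\<^sup>2 = (cmod (f x))\<^sup>2 / (2*pi)" for x
      using F_cis[of "\<lambda>w. (cmod w)\<^sup>2" x] by (simp add: h_def norm_mult)
    show "F \<in> L2 haar_circle"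
      unfolding L2_def using F L2_integrable[OF f] by (simp add: integrable_haar_iff[OF F2] eq del: real_scaleR_def)
    show "(L2_norm haar_circle F)\<^sup>2 = (L2_norm lborel f)\<^sup>2 / (2*pi)"
      unfolding L2_norm_sq by (simp add: integral_haar[OF F2] eq del: real_scaleR_def)
  qed
  \<comment> \<open>The index is \<open>- k\<close> because \<open>z = cis (- x)\<close> reverses
    orientation. Haar measure contributes \<open>1 / (2 * pi)\<close>, of which one factor
    \<open>1 / sqrt (2 * pi)\<close> is absorbed by the transform.\<close>
  have coeff: "L2_inner haar_circle F (\<lambda>z. z powi (- k)) = fourier_L1 f (s + of_int k) / of_real (sqrt (2*pi))" for k
  proof -
    have m: "(\<lambda>z. F z * cnj (z powi (- k))) \<in> borel_measurable haar_circle"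
      by (intro borel_measurable_times borel_measurable_cnj borel_measurable_haarI[OF F_borel]) measurable
    have eq: "(indicator {-pi..pi} x / (2*pi)) *\<^sub>R (F (cis (- x)) * cnj (cis (- x) powi (- k))) =
        cis (- (x * (s + of_int k))) * f x / of_real (2*pi)" for x
    proof -
      have "(indicator {-pi..pi} x / (2*pi)) *\<^sub>R (F (cis (- x)) * cnj (cis (- x) powi (- k)))
         = (indicator {-pi..pi} x *\<^sub>R F (cis (- x))) * cis (- (of_int k * x)) / of_real (2*pi)"
        by (simp add: cis_power_int cis_cnj scaleR_conv_of_real)
      also have "\<dots> = h x * cis (- (of_int k * x)) / of_real (2*pi)"
        using F_cis[of "\<lambda>w. w" x] by simp
      also have "h x * cis (- (of_int k * x)) = cis (- (x * (s + of_int k))) * f x"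
        by (simp add: h_def cis_mult mult_ac distrib_left)
      finally show ?thesis .
    qed
    have "L2_inner haar_circle F (\<lambda>z. z powi (- k)) = (LINT x|lborel. cis (- (x * (s + of_int k))) * f x / of_real (2*pi))"
      unfolding L2_inner_def integral_haar[OF m] by (rule Bochner_Integration.integral_cong[OF refl eq])
    also have "\<dots> = (LINT x|lborel. cis (- (x * (s + of_int k))) * f x) / of_real (sqrt (2*pi) * sqrt (2*pi))"
      by simp
    also have "\<dots> = fourier_L1 f (s + of_int k) / of_real (sqrt (2*pi))"
      by (simp only: fourier_L1_def of_real_mult divide_divide_eq_left)
    finally show ?thesis .
  qed
  \<comment> \<open>Parseval's unordered sum over the integers becomes a series along the
    enumeration \<open>- int_decode n\<close>, which also undoes the sign of the index.\<close>
  have bij: "bij_betw (\<lambda>n. - int_decode n) UNIV UNIV"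
    using bij_betw_trans[OF bij_int_decode bij_uminus] by (simp add: o_def)
  have "((\<lambda>n. (cmod (L2_inner haar_circle F (\<lambda>z. z powi (- int_decode n))))\<^sup>2) has_sum (L2_norm haar_circle F)\<^sup>2) UNIV"
    using has_sum_reindex_bij_betw[OF bij, of "\<lambda>k. (cmod (L2_inner haar_circle F (\<lambda>z. z powi k)))\<^sup>2"] Parseval[OF F_L2]
    by simp
  then have "(\<lambda>n. (cmod (L2_inner haar_circle F (\<lambda>z. z powi (- int_decode n))))\<^sup>2) sums ((L2_norm lborel f)\<^sup>2 / (2*pi))"
    unfolding F_norm by (rule has_sum_imp_sums)
  then have "(\<lambda>n. (2*pi) * (cmod (fourier_L1 f (s + of_int (int_decode n)) / of_real (sqrt (2*pi))))\<^sup>2) sums ((2*pi) * ((L2_norm lborel f)\<^sup>2 / (2*pi)))"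
    unfolding coeff by (rule sums_mult)
  moreover have "(2*pi) * (cmod (w / of_real (sqrt (2*pi))))\<^sup>2 = (cmod w)\<^sup>2" for w
    by (simp add: norm_divide power_divide del: of_real_mult)
  ultimately show ?thesis by simp
qed

lemma fourier_L1_isometry_unit:
  assumes f: "f \<in> L2 lborel" and supp: "\<And>x. 1 < \<bar>x\<bar> \<Longrightarrow> f x = 0"
  shows "fourier_L1 f \<in> L2 lborel" "L2_norm lborel (fourier_L1 f) = L2_norm lborel f"
proof -
  note m [measurable] = fourier_L1_measurable[OF L2_lborel_borel[OF f]]
  let ?g = "\<lambda>t. ennreal ((cmod (fourier_L1 f t))\<^sup>2)"
  have "(\<integral>\<^sup>+t. ?g t \<partial>lborel) = (\<Sum>n. \<integral>\<^sup>+t. ?g (t + of_int (int_decode n)) * indicator {0..<1} t \<partial>lborel)"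
    by (rule nn_integral_periodize) measurable
  also have "\<dots> = (\<integral>\<^sup>+t. (\<Sum>n. ?g (t + of_int (int_decode n)) * indicator {0..<1} t) \<partial>lborel)"
    by (rule nn_integral_suminf[symmetric]) measurable
  also have "\<dots> = (\<integral>\<^sup>+t. (\<Sum>n. ?g (t + of_int (int_decode n))) * indicator {0..<1} t \<partial>lborel)"
    unfolding ennreal_suminf_multc ..
  also have "\<dots> = (\<integral>\<^sup>+t. ennreal ((L2_norm lborel f)\<^sup>2) * indicator {0..<(1::real)} t \<partial>lborel)"
    by (simp only: suminf_ennreal_eq[OF zero_le_power2 fourier_L1_samples[OF f supp]])
  also have "\<dots> = ennreal ((L2_norm lborel f)\<^sup>2)"
    by (simp add: nn_integral_cmult)
  finally have *: "(\<integral>\<^sup>+t. ?g t \<partial>lborel) = ennreal ((L2_norm lborel f)\<^sup>2)" .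
  show "fourier_L1 f \<in> L2 lborel" "L2_norm lborel (fourier_L1 f) = L2_norm lborel f"
    by (rule L2_norm_eq_nn_integral[OF _ *]; use m in simp)+
qed

section \<open>Dilations, and the isometry for bounded supports\<close>

text \<open>Real factors put the integer powers of \<open>dilate N\<close> and their Fourier
  counterparts, the dilations by \<open>1 / s\<close>, into one family.\<close>

definition dil :: "real \<Rightarrow> (real \<Rightarrow> complex) \<Rightarrow> real \<Rightarrow> complex" where
  "dil s f x = f (x / s) / of_real (sqrt s)"

lemma dilate_eq_dil: "dilate N = dil (real N)"
  by (simp add: fun_eq_iff dilate_def dil_def)

lemma dil_1 [simp]: "dil 1 f = f"
  by (simp add: dil_def fun_eq_iff)

lemma dil_dil: "0 < r \<Longrightarrow> 0 < s \<Longrightarrow> dil r (dil s f) = dil (r * s) f"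
  by (simp add: dil_def fun_eq_iff real_sqrt_mult mult.commute)

lemma dil_integral:
  assumes s: "0 < s"
  shows "(LINT x|lborel. dil s f x * cnj (dil s g x)) = (LINT x|lborel. f x * cnj (g x))"
proof -
  have ss: "complex_of_real (sqrt s) * complex_of_real (sqrt s) = of_real s"
    using s by (simp flip: of_real_mult)
  have "(LINT x|lborel. dil s f x * cnj (dil s g x)) = \<bar>s\<bar> *\<^sub>R (LINT x|lborel. dil s f (0 + s * x) * cnj (dil s g (0 + s * x)))"
    by (rule lborel_integral_real_affine) (use s in auto)
  also have "\<dots> = s *\<^sub>R (LINT x|lborel. (f x * cnj (g x)) / of_real s)"
    using s by (simp add: dil_def ss)
  also have "\<dots> = (LINT x|lborel. f x * cnj (g x))"
    using s by (simp add: scaleR_conv_of_real)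
  finally show ?thesis .
qed

lemma dil_inner: "0 < s \<Longrightarrow> L2_inner lborel (dil s f) (dil s g) = L2_inner lborel f g"
  by (simp add: L2_inner_def dil_integral)

lemma dil_L2:
  assumes s: "0 < s" and f: "f \<in> L2 lborel"
  shows "dil s f \<in> L2 lborel"
proof -
  note [measurable] = L2_lborel_borel[OF f]
  have m: "dil s f \<in> borel_measurable borel" unfolding dil_def by measurable
  have "integrable lborel (\<lambda>x. (cmod (f (0 + (1/s) * x)))\<^sup>2)"
    by (rule lborel_integrable_real_affine[OF L2_integrable[OF f]]) (use s in auto)
  then have "integrable lborel (\<lambda>x. (cmod (f (x / s)))\<^sup>2 / s)" by simp
  moreover have "(cmod (dil s f x))\<^sup>2 = (cmod (f (x / s)))\<^sup>2 / s" for x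
    using s by (simp add: dil_def norm_divide power_divide)
  ultimately show ?thesis using m by (simp add: L2_def)
qed

lemma dil_norm: "0 < s \<Longrightarrow> L2_norm lborel (dil s f) = L2_norm lborel f"
proof -
  assume s: "0 < s"
  have "complex_of_real ((L2_norm lborel (dil s f))\<^sup>2) = of_real ((L2_norm lborel f)\<^sup>2)"
    unfolding L2_inner_self[symmetric] by (rule dil_inner[OF s])
  then show ?thesis by (simp only: of_real_eq_iff) (simp add: power2_eq_iff_nonneg)
qed

lemma dil_diff: "dil s (\<lambda>x. f x - g x) = (\<lambda>x. dil s f x - dil s g x)"
  by (simp add: dil_def fun_eq_iff diff_divide_distrib)

lemma fourier_L1_dil:
  assumes s: "0 < s"
  shows "fourier_L1 (dil s f) = dil (1 / s) (fourier_L1 f)"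
proof (rule ext)
  fix t
  have "(LINT x|lborel. cis (- (x * t)) * dil s f x) = \<bar>s\<bar> *\<^sub>R (LINT x|lborel. cis (- ((0 + s * x) * t)) * dil s f (0 + s * x))"
    by (rule lborel_integral_real_affine) (use s in auto)
  also have "\<dots> = s *\<^sub>R (LINT x|lborel. (cis (- (x * (t * s))) * f x) / of_real (sqrt s))"
    using s by (simp add: dil_def mult_ac)
  also have "\<dots> = of_real (s / sqrt s) * (LINT x|lborel. cis (- (x * (t * s))) * f x)"
    by (simp add: scaleR_conv_of_real)
  also have "s / sqrt s = 1 / sqrt (1 / s)"
    using s by (simp add: real_div_sqrt real_sqrt_divide)
  finally show "fourier_L1 (dil s f) t = dil (1 / s) (fourier_L1 f) t"
    by (simp add: fourier_L1_def dil_def)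
qed

text \<open>Dilation by \<open>1 / R\<close> moves the support into \<open>[-1, 1]\<close>. The
  transform turns it into dilation by \<open>R\<close>, and dilations preserve the norm on both
  sides.\<close>

lemma fourier_L1_isometry:
  assumes f: "f \<in> L2 lborel" and supp: "bounded_support f"
  shows "fourier_L1 f \<in> L2 lborel" "L2_norm lborel (fourier_L1 f) = L2_norm lborel f"
proof -
  obtain R where R: "0 < R" "\<And>x. R < \<bar>x\<bar> \<Longrightarrow> f x = 0" using supp by (auto simp: bounded_support_def)
  let ?g = "dil (1 / R) f"
  have g: "?g \<in> L2 lborel" using R by (intro dil_L2 f) auto
  have fg: "f = dil R ?g" using R by (simp add: dil_dil)
  have supp_g: "?g x = 0" if "1 < \<bar>x\<bar>" for x
  proof -
    have "R < \<bar>x / (1 / R)\<bar>" using that R by (simp add: abs_mult)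
    then show ?thesis unfolding dil_def by (subst R(2)) auto
  qed
  note I = fourier_L1_isometry_unit[OF g supp_g]
  show "fourier_L1 f \<in> L2 lborel"
    by (subst fg, subst fourier_L1_dil) (use R I in \<open>auto intro: dil_L2\<close>)
  have "L2_norm lborel (fourier_L1 f) = L2_norm lborel (dil (1 / R) (fourier_L1 ?g))"
    by (subst fg, subst fourier_L1_dil) (use R in auto)
  also have "\<dots> = L2_norm lborel ?g" using R I by (simp add: dil_norm)
  also have "\<dots> = L2_norm lborel f" using R by (simp add: dil_norm)
  finally show "L2_norm lborel (fourier_L1 f) = L2_norm lborel f" .
qed

section \<open>Extension of the Fourier transform to all of L2\<close>

definition trunc :: "nat \<Rightarrow> (real \<Rightarrow> complex) \<Rightarrow> real \<Rightarrow> complex" where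
  "trunc n f x = indicator {- real n..real n} x * f x"

lemma trunc_bounded_support: "bounded_support (trunc n f)"
  unfolding bounded_support_def trunc_def
  by (intro exI[of _ "real n + 1"]) (auto simp: indicator_def)

lemma trunc_L2:
  assumes f: "f \<in> L2 lborel"
  shows "trunc n f \<in> L2 lborel"
proof -
  note [measurable] = L2_lborel_borel[OF f]
  have [measurable]: "trunc n f \<in> borel_measurable borel" unfolding trunc_def by measurable
  have "integrable lborel (\<lambda>x. (cmod (trunc n f x))\<^sup>2)"
    by (rule Bochner_Integration.integrable_bound[OF L2_integrable[OF f]])
       (auto simp: trunc_def indicator_def)
  then show ?thesis by (simp add: L2_def)
qed

lemma trunc_lim:
  assumes f: "f \<in> L2 lborel"
  shows "L2_lim lborel (\<lambda>n. trunc n f) f sequentially"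
  unfolding L2_lim_def
proof (intro conjI allI trunc_L2 f)
  note [measurable] = L2_lborel_borel[OF f] L2_lborel_borel[OF trunc_L2[OF f]]
  have "(\<lambda>n. LINT x|lborel. (cmod (trunc n f x - f x))\<^sup>2) \<longlonglongrightarrow> (LINT x::real|lborel. 0)"
  proof (rule integral_dominated_convergence)
    show "AE x in lborel. (\<lambda>n. (cmod (trunc n f x - f x))\<^sup>2) \<longlonglongrightarrow> 0"
    proof (rule AE_I2)
      fix x :: real
      obtain n where "\<bar>x\<bar> < real n" using reals_Archimedean2 by blast
      then have "\<forall>\<^sub>F k in sequentially. (cmod (trunc k f x - f x))\<^sup>2 = 0"
        unfolding eventually_sequentially by (intro exI[of _ n]) (auto simp: trunc_def indicator_def)
      then show "(\<lambda>n. (cmod (trunc n f x - f x))\<^sup>2) \<longlonglongrightarrow> 0" by (rule tendsto_eventually)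
    qed
    show "AE x in lborel. norm ((cmod (trunc n f x - f x))\<^sup>2) \<le> (cmod (f x))\<^sup>2" for n
      by (rule AE_I2) (auto simp: trunc_def indicator_def)
  qed (use L2_integrable[OF f] in simp_all)
  then show "(\<lambda>n. L2_norm lborel (\<lambda>x. trunc n f x - f x)) \<longlonglongrightarrow> 0"
    unfolding L2_norm_def using tendsto_real_sqrt by fastforce
qed

lemma bounded_support_diff:
  assumes "bounded_support f" "bounded_support g"
  shows "bounded_support (\<lambda>x. f x - g x)"
proof -
  obtain R S where "0 < R" "\<And>x. R < \<bar>x\<bar> \<Longrightarrow> f x = 0" "0 < S" "\<And>x. S < \<bar>x\<bar> \<Longrightarrow> g x = 0"
    using assms by (auto simp: bounded_support_def)
  then show ?thesis unfolding bounded_support_def by (intro exI[of _ "max R S"]) auto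
qed

lemma fourier_L1_norm_diff:
  assumes "f \<in> L2 lborel" "bounded_support f" "g \<in> L2 lborel" "bounded_support g"
  shows "L2_norm lborel (\<lambda>t. fourier_L1 f t - fourier_L1 g t) = L2_norm lborel (\<lambda>x. f x - g x)"
proof -
  have "fourier_L1 (\<lambda>x. f x - g x) = (\<lambda>t. fourier_L1 f t - fourier_L1 g t)"
    by (rule ext) (simp add: fourier_L1_diff bounded_support_integrable assms)
  then show ?thesis
    using fourier_L1_isometry(2)[OF L2_diff[OF assms(1,3)] bounded_support_diff[OF assms(2,4)]] by simp
qed

text \<open>This makes the choice in \<open>fourier\<close> meaningful: the truncations are Cauchy,
  the transform preserves their distances, and L2 is complete.\<close>

lemma fourier_lim_exists:
  assumes f: "f \<in> L2 lborel"
  shows "\<exists>g. L2_lim lborel (\<lambda>n. fourier_L1 (trunc n f)) g sequentially"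
proof (rule L2_complete)
  show "fourier_L1 (trunc n f) \<in> L2 lborel" for n
    by (intro fourier_L1_isometry trunc_L2 f trunc_bounded_support)
  fix e :: real assume e: "0 < e"
  have "\<forall>\<^sub>F n in sequentially. L2_norm lborel (\<lambda>x. trunc n f x - f x) < e/2"
    using L2_limD(3)[OF trunc_lim[OF f]] by (rule order_tendstoD) (use e in simp)
  then obtain K where K: "\<And>n. K \<le> n \<Longrightarrow> L2_norm lborel (\<lambda>x. trunc n f x - f x) < e/2"
    by (auto simp: eventually_sequentially)
  have "L2_norm lborel (\<lambda>t. fourier_L1 (trunc m f) t - fourier_L1 (trunc n f) t) < e" if "K \<le> m" "K \<le> n" for m n
  proof -
    have "L2_norm lborel (\<lambda>t. fourier_L1 (trunc m f) t - fourier_L1 (trunc n f) t) = L2_norm lborel (\<lambda>x. trunc m f x - trunc n f x)"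
      by (intro fourier_L1_norm_diff trunc_L2 f trunc_bounded_support)
    also have "\<dots> \<le> L2_norm lborel (\<lambda>x. trunc m f x - f x) + L2_norm lborel (\<lambda>x. f x - trunc n f x)"
      by (intro L2_triangle_diff trunc_L2 f)
    also have "L2_norm lborel (\<lambda>x. f x - trunc n f x) = L2_norm lborel (\<lambda>x. trunc n f x - f x)"
      by (rule L2_norm_minus)
    finally show ?thesis using K[OF that(1)] K[OF that(2)] by simp
  qed
  then show "\<exists>K. \<forall>m\<ge>K. \<forall>n\<ge>K. L2_norm lborel (\<lambda>x. fourier_L1 (trunc m f) x - fourier_L1 (trunc n f) x) < e" by blast
qed

lemma fourier_lim:
  assumes f: "f \<in> L2 lborel"
  shows "L2_lim lborel (\<lambda>n. fourier_L1 (trunc n f)) (fourier f) sequentially"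
  using someI_ex[OF fourier_lim_exists[OF f]] unfolding fourier_def trunc_def .

lemma fourier_L2 [simp]: "f \<in> L2 lborel \<Longrightarrow> fourier f \<in> L2 lborel"
  using L2_limD(2)[OF fourier_lim] .

lemma fourier_borel: "f \<in> L2 lborel \<Longrightarrow> fourier f \<in> borel_measurable borel"
  by (intro L2_lborel_borel fourier_L2)

theorem Plancherel:
  assumes f: "f \<in> L2 lborel"
  shows "L2_norm lborel (fourier f) = L2_norm lborel f"
proof (rule LIMSEQ_unique)
  show "(\<lambda>n. L2_norm lborel (trunc n f)) \<longlonglongrightarrow> L2_norm lborel f"
    by (rule L2_lim_norm[OF trunc_lim[OF f]])
  show "(\<lambda>n. L2_norm lborel (trunc n f)) \<longlonglongrightarrow> L2_norm lborel (fourier f)"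
    using L2_lim_norm[OF fourier_lim[OF f]]
    by (simp add: fourier_L1_isometry(2) trunc_L2 f trunc_bounded_support)
qed

text \<open>The values of \<open>fourier\<close> at \<open>f\<close>, \<open>g\<close> and their sum
  are chosen independently of each other, so additivity can hold only almost everywhere; it comes
  from uniqueness of the limit.\<close>

lemma fourier_add:
  assumes f: "f \<in> L2 lborel" and g: "g \<in> L2 lborel"
  shows "AE t in lborel. fourier (\<lambda>x. f x + g x) t = fourier f t + fourier g t"
proof (rule L2_lim_unique)
  have "trunc n (\<lambda>x. f x + g x) = (\<lambda>x. trunc n f x + trunc n g x)" for n
    by (simp add: trunc_def fun_eq_iff distrib_left)
  then have "fourier_L1 (trunc n (\<lambda>x. f x + g x)) = (\<lambda>t. fourier_L1 (trunc n f) t + fourier_L1 (trunc n g) t)" for n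
    by (intro ext) (simp add: fourier_L1_add bounded_support_integrable trunc_L2 trunc_bounded_support f g)
  then show "L2_lim lborel (\<lambda>n t. fourier_L1 (trunc n f) t + fourier_L1 (trunc n g) t) (fourier (\<lambda>x. f x + g x)) sequentially"
    using fourier_lim[OF L2_add[OF f g]] by simp
  show "L2_lim lborel (\<lambda>n t. fourier_L1 (trunc n f) t + fourier_L1 (trunc n g) t) (\<lambda>t. fourier f t + fourier g t) sequentially"
    by (intro L2_lim_add fourier_lim f g)
qed simp

lemma fourier_cmult:
  assumes f: "f \<in> L2 lborel"
  shows "AE t in lborel. fourier (\<lambda>x. c * f x) t = c * fourier f t"
proof (rule L2_lim_unique)
  have "trunc n (\<lambda>x. c * f x) = (\<lambda>x. c * trunc n f x)" for n
    by (simp add: trunc_def fun_eq_iff mult_ac)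
  then have "fourier_L1 (trunc n (\<lambda>x. c * f x)) = (\<lambda>t. c * fourier_L1 (trunc n f) t)" for n
    by (intro ext) (simp add: fourier_L1_cmult)
  then show "L2_lim lborel (\<lambda>n t. c * fourier_L1 (trunc n f) t) (fourier (\<lambda>x. c * f x)) sequentially"
    using fourier_lim[OF L2_cmult[OF f], of c] by (simp only:)
  show "L2_lim lborel (\<lambda>n t. c * fourier_L1 (trunc n f) t) (\<lambda>t. c * fourier f t) sequentially"
    by (intro L2_lim_cmult fourier_lim f)
qed simp

lemma fourier_diff:
  assumes f: "f \<in> L2 lborel" and g: "g \<in> L2 lborel"
  shows "AE t in lborel. fourier (\<lambda>x. f x - g x) t = fourier f t - fourier g t"
  using fourier_add[OF f L2_cmult[OF g, of "-1"]] fourier_cmult[OF g, of "-1"] by eventually_elim simp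

lemma fourier_norm_diff:
  assumes f: "f \<in> L2 lborel" and g: "g \<in> L2 lborel"
  shows "L2_norm lborel (\<lambda>t. fourier f t - fourier g t) = L2_norm lborel (\<lambda>x. f x - g x)"
proof -
  note [measurable] = fourier_borel[OF f] fourier_borel[OF g] fourier_borel[OF L2_diff[OF f g]]
  have "L2_norm lborel (\<lambda>t. fourier f t - fourier g t) = L2_norm lborel (fourier (\<lambda>x. f x - g x))"
    by (rule L2_norm_cong_AE) (use fourier_diff[OF f g] in auto)
  then show ?thesis by (simp add: Plancherel[OF L2_diff[OF f g]])
qed

lemma fourier_L2_lim:
  assumes "L2_lim lborel F f net"
  shows "L2_lim lborel (\<lambda>n. fourier (F n)) (fourier f) net"
  using L2_limD[OF assms] by (simp add: L2_lim_def fourier_norm_diff)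

lemma Re_L2_inner:
  assumes "f \<in> L2 M" "g \<in> L2 M"
  shows "Re (L2_inner M f g) = ((L2_norm M (\<lambda>x. f x + g x))\<^sup>2 - (L2_norm M f)\<^sup>2 - (L2_norm M g)\<^sup>2) / 2"
  by (simp add: L2_norm_add_sq[OF assms])

text \<open>Polarisation: norms determine the real part of the inner product, and replacing
  \<open>f\<close> by \<open>\<i> * f\<close> gives the imaginary part.\<close>

theorem Parseval_Plancherel:
  assumes f: "f \<in> L2 lborel" and g: "g \<in> L2 lborel"
  shows "L2_inner lborel (fourier f) (fourier g) = L2_inner lborel f g"
proof -
  have Re_eq: "Re (L2_inner lborel (fourier f) (fourier g)) = Re (L2_inner lborel f g)"
    if f: "f \<in> L2 lborel" and g: "g \<in> L2 lborel" for f g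
  proof -
    note [measurable] = fourier_borel[OF f] fourier_borel[OF g] fourier_borel[OF L2_add[OF f g]]
    have "L2_norm lborel (\<lambda>t. fourier f t + fourier g t) = L2_norm lborel (fourier (\<lambda>x. f x + g x))"
      by (rule L2_norm_cong_AE) (use fourier_add[OF f g] in auto)
    then show ?thesis
      by (simp add: Re_L2_inner f g Plancherel L2_add)
  qed
  have "Im (L2_inner lborel (fourier f) (fourier g)) = - Re (\<i> * L2_inner lborel (fourier f) (fourier g))" by simp
  also have "\<i> * L2_inner lborel (fourier f) (fourier g) = L2_inner lborel (fourier (\<lambda>x. \<i> * f x)) (fourier g)"
  proof -
    note [measurable] = fourier_borel[OF f] fourier_borel[OF g] fourier_borel[OF L2_cmult[OF f]]
    show ?thesis
      unfolding L2_inner_cmult_left[symmetric]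
      by (rule L2_inner_cong_AE) (use fourier_cmult[OF f, of \<i>] in auto)
  qed
  also have "Re \<dots> = Re (\<i> * L2_inner lborel f g)"
    by (simp add: Re_eq L2_cmult f g L2_inner_cmult_left)
  also have "- \<dots> = Im (L2_inner lborel f g)" by simp
  finally show ?thesis using Re_eq[OF f g] by (simp add: complex_eq_iff)
qed

lemma fourier_eq_fourier_L1:
  assumes f: "f \<in> L2 lborel" and supp: "bounded_support f"
  shows "AE t in lborel. fourier f t = fourier_L1 f t"
proof (rule L2_lim_unique[OF fourier_lim[OF f]])
  obtain R where R: "\<And>x. R < \<bar>x\<bar> \<Longrightarrow> f x = 0" using supp by (auto simp: bounded_support_def)
  obtain n where n: "R < real n" using reals_Archimedean2 by blast
  have "trunc k f = f" if "n \<le> k" for k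
  proof (rule ext)
    fix x show "trunc k f x = f x"
      using R[of x] n that
      by (cases "R < \<bar>x\<bar>") (auto simp: trunc_def indicator_def abs_le_iff not_less)
  qed
  then have "\<forall>\<^sub>F k in sequentially. L2_norm lborel (\<lambda>t. fourier_L1 (trunc k f) t - fourier_L1 f t) = 0"
    unfolding eventually_sequentially by (intro exI[of _ n]) auto
  then have "(\<lambda>k. L2_norm lborel (\<lambda>t. fourier_L1 (trunc k f) t - fourier_L1 f t)) \<longlonglongrightarrow> 0"
    by (rule tendsto_eventually)
  then show "L2_lim lborel (\<lambda>k. fourier_L1 (trunc k f)) (fourier_L1 f) sequentially"
    by (simp add: L2_lim_def fourier_L1_isometry f supp trunc_L2 trunc_bounded_support)
qed simp

text \<open>Any approximating sequence with bounded supports may replace the truncations. This is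
  needed because a dilated or shifted truncation is cut off at a different interval than
  \<open>trunc n\<close> prescribes.\<close>

lemma fourier_eqI:
  assumes F: "L2_lim lborel F f sequentially" and supp: "\<And>n. bounded_support (F n)"
    and lim: "L2_lim lborel (\<lambda>n. fourier_L1 (F n)) g sequentially"
  shows "AE t in lborel. fourier f t = g t"
proof (rule L2_lim_unique[OF _ lim])
  note L = L2_limD[OF F]
  have "L2_norm lborel (\<lambda>t. fourier_L1 (F n) t - fourier f t) = L2_norm lborel (\<lambda>x. F n x - f x)" for n
  proof -
    note [measurable] = fourier_borel[OF L(1)[of n]] fourier_borel[OF L(2)] fourier_L1_measurable[OF L2_lborel_borel[OF L(1)[of n]]]
    have "L2_norm lborel (\<lambda>t. fourier_L1 (F n) t - fourier f t) = L2_norm lborel (\<lambda>t. fourier (F n) t - fourier f t)"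
      by (rule L2_norm_cong_AE) (use fourier_eq_fourier_L1[OF L(1) supp, of n] in auto)
    then show ?thesis by (simp add: fourier_norm_diff L)
  qed
  then show "L2_lim lborel (\<lambda>n. fourier_L1 (F n)) (fourier f) sequentially"
    using L by (simp add: L2_lim_def fourier_L1_isometry supp)
qed simp

lemma dil_L2_lim: "0 < s \<Longrightarrow> L2_lim lborel F f net \<Longrightarrow> L2_lim lborel (\<lambda>n. dil s (F n)) (dil s f) net"
  by (simp add: L2_lim_def dil_L2 dil_norm flip: dil_diff)

lemma fourier_dil:
  assumes s: "0 < s" and f: "f \<in> L2 lborel"
  shows "AE t in lborel. fourier (dil s f) t = dil (1 / s) (fourier f) t"
proof (rule fourier_eqI)
  show "L2_lim lborel (\<lambda>n. dil s (trunc n f)) (dil s f) sequentially"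
    by (rule dil_L2_lim[OF s trunc_lim[OF f]])
  show "bounded_support (dil s (trunc n f))" for n
  proof -
    obtain R where R: "0 < R" "\<And>x. R < \<bar>x\<bar> \<Longrightarrow> trunc n f x = 0"
      using trunc_bounded_support[of n f] by (auto simp: bounded_support_def)
    have "dil s (trunc n f) x = 0" if "s * R < \<bar>x\<bar>" for x
    proof -
      have "R < \<bar>x / s\<bar>" using that s by (simp add: field_simps)
      then show ?thesis unfolding dil_def by (subst R(2)) auto
    qed
    then show ?thesis unfolding bounded_support_def using s R by (intro exI[of _ "s * R"]) auto
  qed
  show "L2_lim lborel (\<lambda>n. fourier_L1 (dil s (trunc n f))) (dil (1 / s) (fourier f)) sequentially"
    unfolding fourier_L1_dil[OF s] using s by (intro dil_L2_lim fourier_lim f) simp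
qed

definition shift :: "real \<Rightarrow> (real \<Rightarrow> complex) \<Rightarrow> real \<Rightarrow> complex" where
  "shift a f x = f (x - a)"

lemma shift_L2:
  assumes f: "f \<in> L2 lborel"
  shows "shift a f \<in> L2 lborel"
proof -
  note [measurable] = L2_lborel_borel[OF f]
  have "integrable lborel (\<lambda>x. (cmod (f (- a + 1 * x)))\<^sup>2)"
    by (rule lborel_integrable_real_affine[OF L2_integrable[OF f]]) simp
  moreover have "shift a f \<in> borel_measurable borel" unfolding shift_def by measurable
  ultimately show ?thesis by (simp add: L2_def) (simp add: shift_def)
qed

lemma shift_norm: "L2_norm lborel (shift a f) = L2_norm lborel f"
proof -
  have "(LINT x|lborel. (cmod (f x))\<^sup>2) = \<bar>1\<bar> *\<^sub>R (LINT x|lborel. (cmod (f (- a + 1 * x)))\<^sup>2)"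
    by (rule lborel_integral_real_affine) simp
  then show ?thesis by (simp add: L2_norm_def shift_def)
qed

lemma shift_L2_lim: "L2_lim lborel F f net \<Longrightarrow> L2_lim lborel (\<lambda>n. shift a (F n)) (shift a f) net"
proof -
  have "L2_norm lborel (\<lambda>x. shift a (F n) x - shift a f x) = L2_norm lborel (\<lambda>x. F n x - f x)" for n
    using shift_norm[of a "\<lambda>x. F n x - f x"] by (simp add: shift_def[abs_def])
  then show "L2_lim lborel F f net \<Longrightarrow> L2_lim lborel (\<lambda>n. shift a (F n)) (shift a f) net"
    by (simp add: L2_lim_def shift_L2)
qed

lemma cis_mult_L2:
  assumes f: "f \<in> L2 lborel"
  shows "(\<lambda>t. cis (a * t) * f t) \<in> L2 lborel"
  using f L2_lborel_borel[OF f] by (simp add: L2_def norm_mult)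

lemma cis_mult_L2_lim:
  assumes "L2_lim lborel F f net"
  shows "L2_lim lborel (\<lambda>n t. cis (a * t) * F n t) (\<lambda>t. cis (a * t) * f t) net"
proof -
  have "L2_norm lborel (\<lambda>t. cis (a * t) * F n t - cis (a * t) * f t) = L2_norm lborel (\<lambda>t. F n t - f t)" for n
    by (simp add: L2_norm_def norm_mult flip: right_diff_distrib)
  then show ?thesis using assms by (simp add: L2_lim_def cis_mult_L2)
qed

lemma fourier_L1_shift: "fourier_L1 (shift a f) t = cis (- a * t) * fourier_L1 f t"
proof -
  have "(LINT x|lborel. cis (- (x * t)) * shift a f x) = \<bar>1\<bar> *\<^sub>R (LINT x|lborel. cis (- ((a + 1 * x) * t)) * shift a f (a + 1 * x))"
    by (rule lborel_integral_real_affine) simp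
  also have "\<dots> = (LINT x|lborel. cis (- a * t) * (cis (- (x * t)) * f x))"
    by (simp add: shift_def cis_mult algebra_simps flip: mult.assoc)
  also have "\<dots> = cis (- a * t) * (LINT x|lborel. cis (- (x * t)) * f x)" by simp
  finally show ?thesis by (simp add: fourier_L1_def)
qed

lemma fourier_shift:
  assumes f: "f \<in> L2 lborel"
  shows "AE t in lborel. fourier (shift a f) t = cis (- a * t) * fourier f t"
proof (rule fourier_eqI)
  show "L2_lim lborel (\<lambda>n. shift a (trunc n f)) (shift a f) sequentially"
    by (rule shift_L2_lim[OF trunc_lim[OF f]])
  show "bounded_support (shift a (trunc n f))" for n
    unfolding bounded_support_def shift_def trunc_def
    by (intro exI[of _ "real n + \<bar>a\<bar> + 1"]) (auto simp: indicator_def)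
  show "L2_lim lborel (\<lambda>n. fourier_L1 (shift a (trunc n f))) (\<lambda>t. cis (- a * t) * fourier f t) sequentially"
    unfolding fourier_L1_shift by (rule cis_mult_L2_lim[OF fourier_lim[OF f]])
qed

section \<open>The shift-invariant space of an orthonormal generator\<close>

text \<open>The image of Lebesgue measure under multiplication by \<open>c\<close> has a constant
  density, so null sets stay null. It permits almost everywhere identities to be read at
  \<open>N * t\<close>.\<close>

lemma AE_lborel_scale:
  assumes c: "0 < c" and P: "AE x in lborel. P (x::real)"
  shows "AE x in lborel. P (c * x)"
proof -
  have "AE x in distr lborel borel ((*) c). P x"
    unfolding lborel_distr_mult[OF less_imp_neq[OF c, symmetric]]
    by (subst AE_density) (use P in auto)
  then show ?thesis by (rule AE_distrD[rotated]) measurable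
qed

locale orthonormal_translates =
  fixes \<phi> :: "real \<Rightarrow> complex"
  assumes \<phi>_L2: "\<phi> \<in> L2 lborel"
    and orthonormal: "\<And>k l::int. L2_inner lborel (shift (of_int k) \<phi>) (shift (of_int l) \<phi>) = (if k = l then 1 else 0)"
begin

lemma fourier_\<phi>_borel [measurable]: "fourier \<phi> \<in> borel_measurable borel"
  by (rule fourier_borel[OF \<phi>_L2])

text \<open>The measure form of the classical identity that the sum over \<open>k\<close> of
  \<open>|fourier \<phi> (t + 2 * pi * k)|\<^sup>2\<close> is \<open>1 / (2 * pi)\<close> for almost
  all \<open>t\<close>.\<close>

lemma haar_eq_energy:
  "distr (density lborel (\<lambda>t. ennreal ((cmod (fourier \<phi> t))\<^sup>2))) haar_circle (\<lambda>t. cis (- t)) = haar_circle"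
proof (rule haar_eqI)
  let ?D = "density lborel (\<lambda>t. ennreal ((cmod (fourier \<phi> t))\<^sup>2))"
  have fin: "finite_measure ?D"
  proof
    have "emeasure ?D (space ?D) = (\<integral>\<^sup>+t. ennreal ((cmod (fourier \<phi> t))\<^sup>2) \<partial>lborel)"
      by (simp add: emeasure_density)
    then show "emeasure ?D (space ?D) \<noteq> \<infinity>"
      by (simp add: nn_integral_L2[OF fourier_L2[OF \<phi>_L2]])
  qed
  then interpret D: finite_measure ?D .
  have m: "(\<lambda>t. cis (- t)) \<in> ?D \<rightarrow>\<^sub>M haar_circle" by measurable
  show "finite_measure (distr ?D haar_circle (\<lambda>t. cis (- t)))"
    by (rule D.finite_measure_distr[OF m])
  show "sets (distr ?D haar_circle (\<lambda>t. cis (- t))) = sets haar_circle" by simp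
  fix k :: int
  have [measurable]: "(\<lambda>t. cis (- t) powi k) \<in> borel_measurable borel"
    unfolding cis_power_int by measurable
  have "(LINT z|distr ?D haar_circle (\<lambda>t. cis (- t)). z powi k) = (LINT t|?D. cis (- t) powi k)"
    by (rule integral_distr[OF m]) measurable
  also have "\<dots> = (LINT t|lborel. (cmod (fourier \<phi> t))\<^sup>2 *\<^sub>R cis (- t) powi k)"
    by (rule integral_density) auto
  also have "\<dots> = L2_inner lborel (\<lambda>t. cis (- of_int k * t) * fourier \<phi> t) (fourier \<phi>)"
    unfolding L2_inner_def
    by (rule Bochner_Integration.integral_cong)
       (simp_all add: scaleR_conv_of_real complex_norm_square cis_power_int del: of_real_power)
  also have "\<dots> = L2_inner lborel (fourier (shift (of_int k) \<phi>)) (fourier \<phi>)"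
  proof (rule L2_inner_cong_AE)
    show "AE t in lborel. cis (- of_int k * t) * fourier \<phi> t = fourier (shift (of_int k) \<phi>) t"
      using fourier_shift[OF \<phi>_L2, of "of_int k"] by eventually_elim simp
    show "fourier (shift (of_int k) \<phi>) \<in> borel_measurable lborel"
      using fourier_borel[OF shift_L2[OF \<phi>_L2]] by simp
  qed auto
  also have "\<dots> = L2_inner lborel (shift (of_int k) \<phi>) (shift (of_int 0) \<phi>)"
    by (simp add: Parseval_Plancherel shift_L2 \<phi>_L2) (simp add: shift_def[abs_def])
  finally show "(LINT z|distr ?D haar_circle (\<lambda>t. cis (- t)). z powi k) = (if k = 0 then 1 else 0)"
    by (simp only: orthonormal)
qed

lemma energy_integral:
  assumes g: "g \<in> borel_measurable haar_circle"
  shows "(LINT t|lborel. (cmod (fourier \<phi> t))\<^sup>2 *\<^sub>R g (cis (- t))) = (LINT z|haar_circle. (g z :: 'b::{banach, second_countable_topology}))"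
    "integrable lborel (\<lambda>t. (cmod (fourier \<phi> t))\<^sup>2 *\<^sub>R g (cis (- t))) \<longleftrightarrow> integrable haar_circle g"
proof -
  let ?D = "density lborel (\<lambda>t. ennreal ((cmod (fourier \<phi> t))\<^sup>2))"
  note [measurable] = borel_measurable_haar_cis[OF g]
  have m: "(\<lambda>t. cis (- t)) \<in> ?D \<rightarrow>\<^sub>M haar_circle" by measurable
  have "(LINT z|haar_circle. g z) = (LINT t|?D. g (cis (- t)))"
    by (subst haar_eq_energy[symmetric]) (rule integral_distr[OF m g])
  also have "\<dots> = (LINT t|lborel. (cmod (fourier \<phi> t))\<^sup>2 *\<^sub>R g (cis (- t)))"
    by (rule integral_density) auto
  finally show "(LINT t|lborel. (cmod (fourier \<phi> t))\<^sup>2 *\<^sub>R g (cis (- t))) = (LINT z|haar_circle. g z)" ..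
  have "integrable haar_circle g \<longleftrightarrow> integrable ?D (\<lambda>t. g (cis (- t)))"
    by (subst haar_eq_energy[symmetric]) (rule integrable_distr_eq[OF m g])
  also have "\<dots> \<longleftrightarrow> integrable lborel (\<lambda>t. (cmod (fourier \<phi> t))\<^sup>2 *\<^sub>R g (cis (- t)))"
    by (rule integrable_density) auto
  finally show "integrable lborel (\<lambda>t. (cmod (fourier \<phi> t))\<^sup>2 *\<^sub>R g (cis (- t))) \<longleftrightarrow> integrable haar_circle g" ..
qed

definition spec :: "(complex \<Rightarrow> complex) \<Rightarrow> real \<Rightarrow> complex" where
  "spec f t = f (cis (- t)) * fourier \<phi> t"

lemma spec_L2:
  assumes f: "f \<in> L2 haar_circle"
  shows "spec f \<in> L2 lborel"
proof -
  note [measurable] = borel_measurable_haar_cis[OF L2_borel[OF f]]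
  have "spec f \<in> borel_measurable borel" unfolding spec_def by measurable
  moreover have "integrable lborel (\<lambda>t. (cmod (fourier \<phi> t))\<^sup>2 *\<^sub>R (cmod (f (cis (- t))))\<^sup>2)"
    using energy_integral(2)[of "\<lambda>z. (cmod (f z))\<^sup>2"] L2_integrable[OF f] by auto
  then have "integrable lborel (\<lambda>t. (cmod (spec f t))\<^sup>2)"
    by (simp add: spec_def norm_mult power_mult_distrib mult.commute)
  ultimately show ?thesis by (simp add: L2_def)
qed

lemma spec_inner:
  assumes f: "f \<in> L2 haar_circle" and g: "g \<in> L2 haar_circle"
  shows "L2_inner lborel (spec f) (spec g) = L2_inner haar_circle f g"
proof -
  have "(\<lambda>z. f z * cnj (g z)) \<in> borel_measurable haar_circle"
    using L2_mult_integrable[OF f g] by (rule borel_measurable_integrable)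
  from energy_integral(1)[OF this] show ?thesis
    unfolding L2_inner_def spec_def
    by (simp add: scaleR_conv_of_real complex_norm_square mult_ac del: of_real_power)
qed

lemma spec_norm:
  assumes f: "f \<in> L2 haar_circle"
  shows "L2_norm lborel (spec f) = L2_norm haar_circle f"
proof -
  have "complex_of_real ((L2_norm lborel (spec f))\<^sup>2) = of_real ((L2_norm haar_circle f)\<^sup>2)"
    unfolding L2_inner_self[symmetric] by (rule spec_inner[OF f f])
  then show ?thesis by (simp only: of_real_eq_iff) (simp add: power2_eq_iff_nonneg)
qed

section \<open>Symbols of functions in the shift-invariant space\<close>

text \<open>A relation and not a function, as \<open>f\<close> is determined only almost everywhere.
  Membership in L2 on both sides is included so that norms and inner products transfer without side
  conditions.\<close>

definition has_symbol :: "(real \<Rightarrow> complex) \<Rightarrow> (complex \<Rightarrow> complex) \<Rightarrow> bool" where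
  "has_symbol \<xi> f \<longleftrightarrow> \<xi> \<in> L2 lborel \<and> f \<in> L2 haar_circle \<and> (AE t in lborel. fourier \<xi> t = spec f t)"

lemma has_symbolD:
  assumes "has_symbol \<xi> f"
  shows "\<xi> \<in> L2 lborel" "f \<in> L2 haar_circle" "AE t in lborel. fourier \<xi> t = spec f t"
  using assms by (auto simp: has_symbol_def)

lemma symbol_inner:
  assumes "has_symbol \<xi> f" "has_symbol \<eta> g"
  shows "L2_inner lborel \<xi> \<eta> = L2_inner haar_circle f g"
proof -
  note F = has_symbolD[OF assms(1)] and G = has_symbolD[OF assms(2)]
  have "L2_inner lborel \<xi> \<eta> = L2_inner lborel (fourier \<xi>) (fourier \<eta>)"
    by (simp add: Parseval_Plancherel F G)
  also have "\<dots> = L2_inner lborel (spec f) (spec g)"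
    by (rule L2_inner_cong_AE[OF F(3) G(3)]) (intro L2_borel fourier_L2 spec_L2 F G)+
  also have "\<dots> = L2_inner haar_circle f g" by (rule spec_inner[OF F(2) G(2)])
  finally show ?thesis .
qed

lemma symbol_norm:
  assumes "has_symbol \<xi> f"
  shows "L2_norm lborel \<xi> = L2_norm haar_circle f"
proof -
  have "complex_of_real ((L2_norm lborel \<xi>)\<^sup>2) = of_real ((L2_norm haar_circle f)\<^sup>2)"
    unfolding L2_inner_self[symmetric] by (rule symbol_inner[OF assms assms])
  then show ?thesis by (simp only: of_real_eq_iff) (simp add: power2_eq_iff_nonneg)
qed

lemma symbol_cmult:
  assumes "has_symbol \<xi> f"
  shows "has_symbol (\<lambda>x. c * \<xi> x) (\<lambda>z. c * f z)"
proof -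
  note F = has_symbolD[OF assms]
  have "AE t in lborel. fourier (\<lambda>x. c * \<xi> x) t = spec (\<lambda>z. c * f z) t"
    using F(3) fourier_cmult[OF F(1), of c] by eventually_elim (simp add: spec_def)
  then show ?thesis using F by (simp add: has_symbol_def L2_cmult)
qed

lemma symbol_add:
  assumes "has_symbol \<xi> f" "has_symbol \<eta> g"
  shows "has_symbol (\<lambda>x. \<xi> x + \<eta> x) (\<lambda>z. f z + g z)"
proof -
  note F = has_symbolD[OF assms(1)] and G = has_symbolD[OF assms(2)]
  have "AE t in lborel. fourier (\<lambda>x. \<xi> x + \<eta> x) t = spec (\<lambda>z. f z + g z) t"
    using F(3) G(3) fourier_add[OF F(1) G(1)] by eventually_elim (simp add: spec_def distrib_right)
  then show ?thesis using F G by (simp add: has_symbol_def L2_add)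
qed

lemma symbol_diff:
  assumes "has_symbol \<xi> f" "has_symbol \<eta> g"
  shows "has_symbol (\<lambda>x. \<xi> x - \<eta> x) (\<lambda>z. f z - g z)"
  using symbol_add[OF assms(1) symbol_cmult[OF assms(2), of "-1"]] by simp

lemma symbol_zero: "has_symbol (\<lambda>x. 0) (\<lambda>z. 0)"
proof -
  have "AE t in lborel. fourier (\<lambda>x. 0) t = 0"
    using fourier_cmult[OF L2_zero, of 0] by simp
  then show ?thesis by (simp add: has_symbol_def spec_def)
qed

lemma symbol_sum:
  "(\<And>i. i \<in> I \<Longrightarrow> has_symbol (F i) (f i)) \<Longrightarrow> has_symbol (\<lambda>x. \<Sum>i\<in>I. F i x) (\<lambda>z. \<Sum>i\<in>I. f i z)"
  by (induction I rule: infinite_finite_induct) (auto intro: symbol_add symbol_zero)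

lemma symbol_shift: "has_symbol (shift (of_int k) \<phi>) (\<lambda>z. z powi k)"
proof -
  have "AE t in lborel. fourier (shift (of_int k) \<phi>) t = spec (\<lambda>z. z powi k) t"
    using fourier_shift[OF \<phi>_L2, of "of_int k"] by eventually_elim (simp add: spec_def cis_power_int)
  then show ?thesis by (simp add: has_symbol_def shift_L2 \<phi>_L2)
qed

lemma symbol_trig_poly: "has_symbol (\<lambda>x. \<Sum>k\<in>X. c k * shift (of_int k) \<phi> x) (trig_poly X c)"
  unfolding trig_poly_def[abs_def] by (intro symbol_sum symbol_cmult symbol_shift)

lemma symbol_unique:
  assumes "has_symbol \<xi> f" "has_symbol \<xi> g"
  shows "AE z in haar_circle. f z = g z"
proof -
  have "L2_norm haar_circle (\<lambda>z. f z - g z) = 0"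
    using symbol_norm[OF symbol_diff[OF assms]] by simp
  then have "AE z in haar_circle. f z - g z = 0"
    by (rule L2_norm_eq_0[rotated]) (intro L2_diff has_symbolD(2)[OF assms(1)] has_symbolD(2)[OF assms(2)])
  then show ?thesis by simp
qed

text \<open>\<open>spec\<close> and \<open>fourier\<close> are isometries, so convergence of
  functions and of symbols gives two limits of the same transforms, which must agree.\<close>

lemma symbol_lim:
  assumes F: "L2_lim lborel F \<xi> net" and f: "L2_lim haar_circle f g net"
    and s: "\<And>n. has_symbol (F n) (f n)" and net: "net \<noteq> bot"
  shows "has_symbol \<xi> g"
proof -
  note LF = L2_limD[OF F] and Lf = L2_limD[OF f]
  have "L2_lim lborel (\<lambda>n. fourier (F n)) (spec g) net"
  proof -
    have "L2_norm lborel (\<lambda>t. fourier (F n) t - spec g t) = L2_norm haar_circle (\<lambda>z. f n z - g z)" for n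
    proof -
      have "L2_norm lborel (\<lambda>t. fourier (F n) t - spec g t) = L2_norm lborel (spec (\<lambda>z. f n z - g z))"
      proof (rule L2_norm_cong_AE)
        show "AE t in lborel. fourier (F n) t - spec g t = spec (\<lambda>z. f n z - g z) t"
          using has_symbolD(3)[OF s[of n]] by eventually_elim (simp add: spec_def left_diff_distrib)
        show "(\<lambda>t. fourier (F n) t - spec g t) \<in> borel_measurable lborel"
          by (intro L2_borel L2_diff fourier_L2 spec_L2 LF Lf)
        show "spec (\<lambda>z. f n z - g z) \<in> borel_measurable lborel"
          by (intro L2_borel spec_L2 L2_diff Lf)
      qed
      then show ?thesis by (simp add: spec_norm L2_diff Lf)
    qed
    then show ?thesis using LF Lf by (simp add: L2_lim_def spec_L2)
  qed
  from L2_lim_unique[OF fourier_L2_lim[OF F] this net] show ?thesis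
    by (simp add: has_symbol_def LF Lf)
qed

text \<open>The range of an isometry on a complete space is closed: the symbols of approximants form
  a Cauchy sequence and converge on the circle.\<close>

lemma symbol_closed:
  assumes \<xi>: "\<xi> \<in> L2 lborel"
    and approx: "\<And>e. 0 < e \<Longrightarrow> \<exists>\<eta> f. has_symbol \<eta> f \<and> L2_norm lborel (\<lambda>x. \<xi> x - \<eta> x) < e"
  shows "\<exists>f. has_symbol \<xi> f"
proof -
  have "\<exists>\<eta> f. has_symbol \<eta> f \<and> L2_norm lborel (\<lambda>x. \<xi> x - \<eta> x) < inverse (real (Suc n))" for n
    by (rule approx) simp
  then obtain F f where F: "\<And>n. has_symbol (F n) (f n)"
    "\<And>n. L2_norm lborel (\<lambda>x. \<xi> x - F n x) < inverse (real (Suc n))"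
    by metis
  note FD = has_symbolD[OF F(1)]
  have lim: "(\<lambda>n. L2_norm lborel (\<lambda>x. F n x - \<xi> x)) \<longlonglongrightarrow> 0"
  proof (rule Lim_null_comparison[OF always_eventually LIMSEQ_inverse_real_of_nat], rule allI)
    fix n show "norm (L2_norm lborel (\<lambda>x. F n x - \<xi> x)) \<le> inverse (real (Suc n))"
      using F(2)[of n] unfolding L2_norm_minus[of lborel \<xi> "F n"] by simp
  qed
  then have FL: "L2_lim lborel F \<xi> sequentially" using FD \<xi> by (simp add: L2_lim_def)
  have "\<exists>g. L2_lim haar_circle f g sequentially"
  proof (rule L2_complete)
    fix e :: real assume e: "0 < e"
    have "\<forall>\<^sub>F n in sequentially. L2_norm lborel (\<lambda>x. F n x - \<xi> x) < e/2"
      using lim by (rule order_tendstoD) (use e in simp)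
    then obtain K where K: "\<And>n. K \<le> n \<Longrightarrow> L2_norm lborel (\<lambda>x. F n x - \<xi> x) < e/2"
      by (auto simp: eventually_sequentially)
    have "L2_norm haar_circle (\<lambda>z. f p z - f q z) < e" if "K \<le> p" "K \<le> q" for p q
    proof -
      have "L2_norm haar_circle (\<lambda>z. f p z - f q z) = L2_norm lborel (\<lambda>x. F p x - F q x)"
        by (rule symbol_norm[OF symbol_diff[OF F(1) F(1)], symmetric])
      also have "\<dots> \<le> L2_norm lborel (\<lambda>x. F p x - \<xi> x) + L2_norm lborel (\<lambda>x. \<xi> x - F q x)"
        by (intro L2_triangle_diff FD \<xi>)
      also have "L2_norm lborel (\<lambda>x. \<xi> x - F q x) = L2_norm lborel (\<lambda>x. F q x - \<xi> x)"
        by (rule L2_norm_minus)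
      finally show ?thesis using K[OF that(1)] K[OF that(2)] by simp
    qed
    then show "\<exists>K. \<forall>p\<ge>K. \<forall>q\<ge>K. L2_norm haar_circle (\<lambda>z. f p z - f q z) < e" by blast
  qed (rule FD)
  then obtain g where "L2_lim haar_circle f g sequentially" by blast
  from symbol_lim[OF FL this F(1)] show ?thesis by auto
qed

text \<open>\<open>closed_span\<close> attaches coefficients to functions and not to indices;
  distinctness of the translates lets a coefficient \<open>c k\<close> be recovered from the
  function that carries it.\<close>

lemma inj_shift: "inj (\<lambda>k::int. shift (of_int k) \<phi>)"
proof (rule injI)
  fix k l :: int assume eq: "shift (of_int k) \<phi> = shift (of_int l) \<phi>"
  show "k = l" using orthonormal[of k k] orthonormal[of k l] eq by (auto split: if_splits)
qed

text \<open>From left to right, finite combinations of translates have symbols and this survives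
  limits; from right to left, approximation of the symbol by trigonometric polynomials is carried
  back by the isometry.\<close>

theorem V0_iff: "\<xi> \<in> V0 \<phi> \<longleftrightarrow> (\<exists>f. has_symbol \<xi> f)"
proof
  have V0: "V0 \<phi> = closed_span lborel (range (\<lambda>k::int. shift (of_int k) \<phi>))"
    by (simp add: V0_def shift_def[abs_def])
  {
    assume "\<xi> \<in> V0 \<phi>"
    then have \<xi>: "\<xi> \<in> L2 lborel"
      and ap: "\<And>e. 0 < e \<Longrightarrow> \<exists>X c. finite X \<and> X \<subseteq> range (\<lambda>k::int. shift (of_int k) \<phi>) \<and>
        L2_norm lborel (\<lambda>x. \<xi> x - (\<Sum>b\<in>X. c b * b x)) < e"
      unfolding V0 closed_span_def by auto
    show "\<exists>f. has_symbol \<xi> f"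
    proof (rule symbol_closed[OF \<xi>])
      fix e :: real assume "0 < e"
      then obtain X c where X: "X \<subseteq> range (\<lambda>k::int. shift (of_int k) \<phi>)"
        "L2_norm lborel (\<lambda>x. \<xi> x - (\<Sum>b\<in>X. c b * b x)) < e" using ap by blast
      have "\<exists>f. has_symbol b f" if "b \<in> X" for b using X(1) that symbol_shift by blast
      then obtain f where "\<And>b. b \<in> X \<Longrightarrow> has_symbol b (f b)" by metis
      then have "has_symbol (\<lambda>x. \<Sum>b\<in>X. c b * b x) (\<lambda>z. \<Sum>b\<in>X. c b * f b z)"
        by (intro symbol_sum symbol_cmult)
      with X show "\<exists>\<eta> f. has_symbol \<eta> f \<and> L2_norm lborel (\<lambda>x. \<xi> x - \<eta> x) < e" by blast
    qed
  next
    assume "\<exists>f. has_symbol \<xi> f"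
    then obtain f where f: "has_symbol \<xi> f" ..
    note fD = has_symbolD[OF f]
    have "\<exists>X c. finite X \<and> X \<subseteq> range (\<lambda>k::int. shift (of_int k) \<phi>) \<and>
        L2_norm lborel (\<lambda>x. \<xi> x - (\<Sum>b\<in>X. c b * b x)) < e" if e: "0 < e" for e
    proof -
      obtain X c where X: "finite X" "L2_norm haar_circle (\<lambda>z. f z - trig_poly X c z) < e"
        using haar_trig_poly_dense[OF fD(2) e] by blast
      let ?s = "\<lambda>k::int. shift (of_int k) \<phi>"
      have "L2_norm lborel (\<lambda>x. \<xi> x - (\<Sum>k\<in>X. c k * ?s k x)) < e"
        using symbol_norm[OF symbol_diff[OF f symbol_trig_poly]] X(2) by simp
      moreover have "(\<Sum>b\<in>?s ` X. c (inv ?s b) * b x) = (\<Sum>k\<in>X. c k * ?s k x)" for x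
        by (subst sum.reindex) (use inj_shift in \<open>auto intro: inj_on_subset simp: inv_f_f[OF inj_shift]\<close>)
      ultimately have "L2_norm lborel (\<lambda>x. \<xi> x - (\<Sum>b\<in>?s ` X. c (inv ?s b) * b x)) < e" by simp
      then show ?thesis using X(1) by (intro exI[of _ "?s ` X"] exI[of _ "\<lambda>b. c (inv ?s b)"]) auto
    qed
    then show "\<xi> \<in> V0 \<phi>" unfolding V0 closed_span_def using fD by auto
  }
qed

end

section \<open>Wavelets\<close>

text \<open>\<open>f\<close> is embedded as the generator of a group indexed by the integers. The
  group law supplies its inverse, so the \<open>inv\<close> in \<open>int_funpow\<close> becomes
  \<open>G (-1)\<close>.\<close>

lemma int_funpow_eqI:
  assumes G0: "\<And>x. G 0 x = x" and G1: "f = G 1" and add: "\<And>i j x. G i (G j x) = G (i + j) x"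
  shows "int_funpow f k = G k"
proof -
  have inv: "inv (G 1) = G (-1)"
    by (rule inv_equality) (simp_all add: add G0)
  have "(G i ^^ n) x = G (int n * i) x" for i n x
    by (induction n) (simp_all add: G0 add algebra_simps)
  then show ?thesis
    unfolding int_funpow_def G1 inv by (auto simp: fun_eq_iff)
qed

lemma int_funpow_translate: "int_funpow translate k = shift (of_int k)"
  by (rule int_funpow_eqI[where G="\<lambda>k. shift (of_int k)"])
     (simp_all add: shift_def translate_def fun_eq_iff algebra_simps)

lemma int_funpow_dilate:
  assumes "0 < N"
  shows "int_funpow (dilate N) j = dil (real N powi j)"
  by (rule int_funpow_eqI[where G="\<lambda>j. dil (real N powi j)"])
     (use assms in \<open>simp_all add: dilate_eq_dil dil_dil power_int_add\<close>)

locale wavelet_system = orthonormal_translates \<phi> + filter_bank N m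
  for N :: nat and \<phi> :: "real \<Rightarrow> complex" and m :: "nat \<Rightarrow> complex \<Rightarrow> complex" +
  fixes \<psi> :: "nat \<Rightarrow> real \<Rightarrow> complex"
  assumes symbol_father: "has_symbol (dil (real N) \<phi>) (m 0)"
    and \<psi>_L2: "\<And>i. i \<in> {1..<N} \<Longrightarrow> \<psi> i \<in> L2 lborel"
    and fourier_\<psi>: "\<And>i. i \<in> {1..<N} \<Longrightarrow>
      AE t in lborel. of_real (sqrt (real N)) * fourier (\<psi> i) (real N * t) = m i (cis (- t)) * fourier \<phi> t"
begin

lemma m0_bounded: "bounded_haar (m 0)"
  using m_bounded N_pos by blast

text \<open>Dilation evaluates the transform at \<open>N * t\<close>, where
  \<open>cis (- (N * t)) = cis (- t) ^ N\<close>. The remaining factor, the transform of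
  \<open>\<phi>\<close> at \<open>N * t\<close>, is replaced through the refinement equation, which
  contributes \<open>m 0\<close>.\<close>

lemma symbol_dil:
  assumes "has_symbol \<xi> f"
  shows "has_symbol (dil (real N) \<xi>) (S_op N (m 0) f)"
proof -
  note F = has_symbolD[OF assms]
  have N: "0 < real N" using N_pos by simp
  have "AE t in lborel. fourier (dil (real N) \<xi>) t = spec (S_op N (m 0) f) t"
    using fourier_dil[OF N F(1)] AE_lborel_scale[OF N F(3)] fourier_dil[OF N \<phi>_L2] has_symbolD(3)[OF symbol_father]
  proof eventually_elim
    case (elim t)
    have "fourier (dil (real N) \<xi>) t = f (cis (- (real N * t))) * dil (1 / real N) (fourier \<phi>) t"
      using elim(1,2) by (simp add: dil_def spec_def mult.commute)
    also have "dil (1 / real N) (fourier \<phi>) t = m 0 (cis (- t)) * fourier \<phi> t"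
      using elim(3,4) by (simp add: spec_def)
    also have "cis (- (real N * t)) = cis (- t) ^ N" by (simp add: Complex.DeMoivre)
    finally show ?case by (simp add: spec_def S_op_def)
  qed
  then show ?thesis
    using F N by (simp add: has_symbol_def dil_L2 S_op_L2 N_pos m0_bounded)
qed

lemma symbol_dil_power:
  assumes "has_symbol \<xi> f"
  shows "has_symbol (dil (real N ^ n) \<xi>) ((S_op N (m 0) ^^ n) f)"
proof (induction n)
  case (Suc n)
  have "dil (real N ^ Suc n) \<xi> = dil (real N) (dil (real N ^ n) \<xi>)"
    using N_pos by (simp add: dil_dil)
  then show ?case using symbol_dil[OF Suc] by simp
qed (use assms in simp)

text \<open>One dilation brings the translates of \<open>\<psi> i\<close> into
  \<open>V0 \<phi>\<close>: the translation by \<open>k\<close> becomes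
  \<open>(z ^ N) powi k\<close>, and the defining equation of \<open>\<psi> i\<close> contributes
  \<open>m i\<close>.\<close>

lemma symbol_mother:
  assumes i: "i \<in> {1..<N}"
  shows "has_symbol (dil (real N) (shift (of_int k) (\<psi> i))) (S_op N (m i) (\<lambda>z. z powi k))"
proof -
  have N: "0 < real N" using N_pos by simp
  note \<psi> = \<psi>_L2[OF i]
  have "AE t in lborel. fourier (dil (real N) (shift (of_int k) (\<psi> i))) t = spec (S_op N (m i) (\<lambda>z. z powi k)) t"
    using fourier_dil[OF N shift_L2[OF \<psi>, of "of_int k"]] AE_lborel_scale[OF N fourier_shift[OF \<psi>, of "of_int k"]] fourier_\<psi>[OF i]
  proof eventually_elim
    case (elim t)
    have "fourier (dil (real N) (shift (of_int k) (\<psi> i))) t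
        = of_real (sqrt (real N)) * fourier (shift (of_int k) (\<psi> i)) (real N * t)"
      using elim(1) by (simp add: dil_def real_sqrt_divide mult.commute)
    also have "\<dots> = cis (- of_int k * (real N * t)) * (m i (cis (- t)) * fourier \<phi> t)"
      using elim(2,3) by simp
    also have "cis (- of_int k * (real N * t)) = (cis (- t) ^ N) powi k"
      by (simp add: Complex.DeMoivre cis_power_int)
    finally show ?case by (simp add: spec_def S_op_def)
  qed
  moreover have "S_op N (m i) (\<lambda>z. z powi k) \<in> L2 haar_circle"
    using i by (intro S_op_L2 N_pos m_bounded) auto
  ultimately show ?thesis
    using N \<psi> by (simp add: has_symbol_def dil_L2 shift_L2)
qed

section \<open>Orthonormality of the wavelets\<close>

abbreviation "w \<equiv> wavelet N \<psi>"

lemma wavelet_eq: "w i j k = dil (real N powi j) (shift (of_int k) (\<psi> i))"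
  by (simp add: wavelet_def int_funpow_translate int_funpow_dilate N_pos)

lemma wavelet_L2: "i \<in> {1..<N} \<Longrightarrow> w i j k \<in> L2 lborel"
  unfolding wavelet_eq using N_pos by (intro dil_L2 shift_L2 \<psi>_L2) simp

lemma dil_wavelet: "dil (real N powi l) (w i j k) = w i (l + j) k"
  using N_pos by (simp add: wavelet_eq dil_dil power_int_add)

text \<open>The scale is written as \<open>int n + 1\<close>: of its \<open>n + 1\<close> dilations
  the first is spent on \<open>S_op N (m i)\<close> and the others give \<open>n\<close> factors
  \<open>S_op N (m 0)\<close>.\<close>

lemma symbol_wavelet:
  assumes i: "i \<in> {1..<N}"
  shows "has_symbol (w i (int n + 1) k) ((S_op N (m 0) ^^ n) (S_op N (m i) (\<lambda>z. z powi k)))"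
proof -
  have "w i (int n + 1) k = dil (real N ^ n) (dil (real N) (shift (of_int k) (\<psi> i)))"
    using dil_wavelet[of "int n" i 1 k] by (simp add: wavelet_eq)
  then show ?thesis using symbol_dil_power[OF symbol_mother[OF i]] by simp
qed

text \<open>For positive \<open>n\<close> the outermost factor belongs to \<open>m 0\<close>, whose
  range is orthogonal to that of \<open>m i\<close> with \<open>i\<close> at least 1. Orthogonality
  across scales and the vanishing of coefficients on \<open>V0 \<phi>\<close> both rest on
  this.\<close>

lemma inner_S_op_funpow:
  assumes i: "i \<in> {1..<N}" and f: "f \<in> L2 haar_circle" and n: "0 < n"
  shows "L2_inner haar_circle ((S_op N (m 0) ^^ n) f) (S_op N (m i) (\<lambda>z. z powi k)) = 0"
proof -
  obtain n' where n': "n = Suc n'" using n by (cases n) auto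
  have "(S_op N (m 0) ^^ n') f \<in> L2 haar_circle"
    by (intro S_op_funpow_L2 N_pos m0_bounded f)
  then show ?thesis
    unfolding n' funpow.simps o_def using i by (subst S_op_inner) auto
qed

lemma inner_dil_wavelet: "L2_inner lborel \<xi> (w i j k) = L2_inner lborel (dil (real N powi l) \<xi>) (w i (l + j) k)"
  using N_pos by (simp add: dil_inner flip: dil_wavelet)

text \<open>Dilating both wavelets by \<open>1 - j\<close> scales puts the coarser index at 1, where
  both have symbols; the difference of scales survives as a power of
  \<open>S_op N (m 0)\<close>.\<close>

lemma inner_wavelet_le:
  assumes i: "i \<in> {1..<N}" and i': "i' \<in> {1..<N}" and le: "j \<le> j'"
  shows "L2_inner lborel (w i' j' k') (w i j k) = (if (i', j', k') = (i, j, k) then 1 else 0)"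
proof -
  define n where "n = nat (j' - j)"
  have "L2_inner lborel (w i' j' k') (w i j k) = L2_inner lborel (w i' (int n + 1) k') (w i (int 0 + 1) k)"
    using inner_dil_wavelet[of "w i' j' k'" i j k "1 - j"] le by (simp add: dil_wavelet n_def algebra_simps)
  also have "\<dots> = L2_inner haar_circle ((S_op N (m 0) ^^ n) (S_op N (m i') (\<lambda>z. z powi k'))) (S_op N (m i) (\<lambda>z. z powi k))"
    using symbol_inner[OF symbol_wavelet[OF i'] symbol_wavelet[OF i, of 0]] by simp
  also have "\<dots> = (if (i', j', k') = (i, j, k) then 1 else 0)"
  proof (cases "n = 0")
    case True
    then have "j' = j" using le by (simp add: n_def)
    then show ?thesis using True i i' by (simp add: S_op_inner inner_power_int)
  next
    case False
    then have "j' \<noteq> j" by (auto simp: n_def)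
    moreover have "S_op N (m i') (\<lambda>z. z powi k') \<in> L2 haar_circle"
      using i' by (intro S_op_L2 N_pos m_bounded) auto
    ultimately show ?thesis using inner_S_op_funpow[OF i] False by simp
  qed
  finally show ?thesis .
qed

lemma inner_wavelet:
  assumes i: "i \<in> {1..<N}" and i': "i' \<in> {1..<N}"
  shows "L2_inner lborel (w i' j' k') (w i j k) = (if (i', j', k') = (i, j, k) then 1 else 0)"
proof (cases "j \<le> j'")
  case True
  then show ?thesis by (rule inner_wavelet_le[OF i i'])
next
  case False
  then have "L2_inner lborel (w i j k) (w i' j' k') = 0"
    by (subst inner_wavelet_le[OF i' i]) auto
  then show ?thesis using False L2_inner_commute[of lborel "w i' j' k'" "w i j k"] by auto
qed

section \<open>Coefficients of the wavelet expansion\<close>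

lemma expansion_lim:
  assumes "wavelet_expansion N \<psi> \<xi> a"
  shows "L2_lim lborel (\<lambda>X x. \<Sum>(i, j, k)\<in>X. a i j k * w i j k x) \<xi> (finite_subsets_at_top ({1..<N} \<times> UNIV \<times> UNIV))"
  using assms by (simp add: wavelet_expansion_def L2_has_sum_def case_prod_unfold)

text \<open>By orthonormality every finite partial sum containing the index \<open>(i, j, k)\<close>
  already pairs with that wavelet to \<open>a i j k\<close>, so the net of pairings is eventually
  constant.\<close>

lemma expansion_coeff:
  assumes exp: "wavelet_expansion N \<psi> \<xi> a" and i: "i \<in> {1..<N}"
  shows "a i j k = L2_inner lborel \<xi> (w i j k)"
proof -
  let ?I = "{1..<N} \<times> (UNIV :: int set) \<times> (UNIV :: int set)"
  let ?S = "\<lambda>X x. \<Sum>(i, j, k)\<in>X. a i j k * w i j k x"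
  have lim: "((\<lambda>X. L2_inner lborel (?S X) (w i j k)) \<longlongrightarrow> L2_inner lborel \<xi> (w i j k)) (finite_subsets_at_top ?I)"
    by (rule L2_lim_inner[OF expansion_lim[OF exp] wavelet_L2[OF i]])
  have "\<forall>\<^sub>F X in finite_subsets_at_top ?I. L2_inner lborel (?S X) (w i j k) = a i j k"
    unfolding eventually_finite_subsets_at_top
  proof (intro exI[of _ "{(i, j, k)}"] conjI allI impI)
    fix X assume X: "finite X \<and> {(i, j, k)} \<subseteq> X \<and> X \<subseteq> ?I"
    have "L2_inner lborel (?S X) (w i j k) = (\<Sum>p\<in>X. L2_inner lborel (case p of (i, j, k) \<Rightarrow> \<lambda>x. a i j k * w i j k x) (w i j k))"
    proof -
      have "?S X = (\<lambda>x. \<Sum>p\<in>X. (case p of (i, j, k) \<Rightarrow> \<lambda>x. a i j k * w i j k x) x)"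
        by (simp add: case_prod_unfold)
      then show ?thesis using X i
        by (simp only:) (intro L2_inner_sum_left; auto intro!: L2_cmult wavelet_L2)
    qed
    also have "\<dots> = (\<Sum>p\<in>X. if p = (i, j, k) then a i j k else 0)"
    proof (rule sum.cong[OF refl])
      fix p assume p: "p \<in> X"
      obtain i' j' k' where p': "p = (i', j', k')" by (cases p)
      then have "i' \<in> {1..<N}" using p X by auto
      then show "L2_inner lborel (case p of (i, j, k) \<Rightarrow> \<lambda>x. a i j k * w i j k x) (w i j k) = (if p = (i, j, k) then a i j k else 0)"
        unfolding p' prod.case L2_inner_cmult_left by (subst inner_wavelet[OF i]) auto
    qed
    also have "\<dots> = a i j k" using X by (simp add: sum.delta)
    finally show "L2_inner lborel (?S X) (w i j k) = a i j k" .
  qed (use i in auto)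
  then have "((\<lambda>X. L2_inner lborel (?S X) (w i j k)) \<longlongrightarrow> a i j k) (finite_subsets_at_top ?I)"
    by (rule tendsto_eventually)
  from tendsto_unique[OF finite_subsets_at_top_neq_bot this lim] show ?thesis .
qed

text \<open>Dilation by \<open>1 - j\<close> scales moves the wavelet to scale 1 and puts
  \<open>1 - j\<close> factors \<open>S_op N (m 0)\<close>, at least one, in front of the symbol of
  \<open>\<xi>\<close>.\<close>

lemma coeff_eq_zero:
  assumes \<xi>: "\<xi> \<in> V0 \<phi>" and i: "i \<in> {1..<N}" and j: "j \<le> 0"
  shows "L2_inner lborel \<xi> (w i j k) = 0"
proof -
  obtain f where f: "has_symbol \<xi> f" using \<xi> V0_iff by blast
  define n where "n = nat (1 - j)"
  have "L2_inner lborel \<xi> (w i j k) = L2_inner lborel (dil (real N ^ n) \<xi>) (w i (int 0 + 1) k)"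
  proof -
    have "int n + j = int 0 + 1" using j by (simp add: n_def)
    then show ?thesis using inner_dil_wavelet[of \<xi> i j k "int n"] by (simp only: power_int_of_nat)
  qed
  also have "\<dots> = L2_inner haar_circle ((S_op N (m 0) ^^ n) f) (S_op N (m i) (\<lambda>z. z powi k))"
    using symbol_inner[OF symbol_dil_power[OF f] symbol_wavelet[OF i, of 0]] by simp
  also have "\<dots> = 0" using j by (intro inner_S_op_funpow i has_symbolD(2)[OF f]) (simp add: n_def)
  finally show ?thesis .
qed

text \<open>The surviving terms of each partial sum have scale at least 1 and hence symbols;
  \<open>symbol_closed\<close> carries this to the limit.\<close>

lemma in_V0_if_coeff_zero:
  assumes exp: "wavelet_expansion N \<psi> \<xi> a" and zero: "\<And>i j k. i \<in> {1..<N} \<Longrightarrow> j \<le> 0 \<Longrightarrow> a i j k = 0"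
  shows "\<xi> \<in> V0 \<phi>"
  unfolding V0_iff
proof (rule symbol_closed)
  let ?I = "{1..<N} \<times> (UNIV :: int set) \<times> (UNIV :: int set)"
  let ?S = "\<lambda>X x. \<Sum>(i, j, k)\<in>X. a i j k * w i j k x"
  note L = L2_limD[OF expansion_lim[OF exp]]
  show "\<xi> \<in> L2 lborel" by (rule L(2))
  fix e :: real assume "0 < e"
  then have "\<forall>\<^sub>F X in finite_subsets_at_top ?I. L2_norm lborel (\<lambda>x. ?S X x - \<xi> x) < e"
    using L(3) by (rule order_tendstoD(2)[rotated])
  then obtain X where X: "X \<subseteq> ?I" "L2_norm lborel (\<lambda>x. ?S X x - \<xi> x) < e"
    unfolding eventually_finite_subsets_at_top by blast
  have "\<exists>f. has_symbol (case p of (i, j, k) \<Rightarrow> \<lambda>x. a i j k * w i j k x) f" if "p \<in> X" for p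
  proof -
    obtain i j k where p: "p = (i, j, k)" by (cases p)
    then have i: "i \<in> {1..<N}" using that X by auto
    show ?thesis
    proof (cases "j \<le> 0")
      case True
      then show ?thesis using zero[OF i] symbol_zero by (auto simp: p)
    next
      case False
      then have "int (nat (j - 1)) + 1 = j" by simp
      then show ?thesis using symbol_cmult[OF symbol_wavelet[OF i, of "nat (j - 1)" k], of "a i j k"]
        by (auto simp: p)
    qed
  qed
  then have "\<forall>p\<in>X. \<exists>f. has_symbol (case p of (i, j, k) \<Rightarrow> \<lambda>x. a i j k * w i j k x) f" ..
  from bchoice[OF this] obtain f
    where "\<And>p. p \<in> X \<Longrightarrow> has_symbol (case p of (i, j, k) \<Rightarrow> \<lambda>x. a i j k * w i j k x) (f p)" by blast
  then have "has_symbol (\<lambda>x. \<Sum>p\<in>X. (case p of (i, j, k) \<Rightarrow> \<lambda>x. a i j k * w i j k x) x) (\<lambda>z. \<Sum>p\<in>X. f p z)"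
    by (rule symbol_sum)
  then have "has_symbol (?S X) (\<lambda>z. \<Sum>p\<in>X. f p z)" by (simp add: case_prod_unfold)
  moreover have "L2_norm lborel (\<lambda>x. \<xi> x - ?S X x) < e"
    using X(2) unfolding L2_norm_minus[of lborel \<xi> "?S X"] .
  ultimately show "\<exists>\<eta> f. has_symbol \<eta> f \<and> L2_norm lborel (\<lambda>x. \<xi> x - \<eta> x) < e" by blast
qed

text \<open>In the wavelet's symbol the operator of \<open>m i\<close> acts first and those of
  \<open>m 0\<close> afterwards. Adjoints reverse this, so the \<open>j - 1\<close> adjoints for
  \<open>m 0\<close> reach \<open>f\<close> before the one for \<open>m i\<close>.\<close>

lemma coeff_formula:
  assumes f: "has_symbol \<xi> f" and i: "i \<in> {1..<N}" and j: "1 \<le> j"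
  shows "L2_inner lborel \<xi> (w i j k) = circle_coeff (S_adj N (m i) ((S_adj N (m 0) ^^ nat (j - 1)) f)) k"
proof -
  define n where "n = nat (j - 1)"
  have j': "j = int n + 1" using j by (simp add: n_def)
  let ?e = "\<lambda>z::complex. z powi k"
  have mi: "bounded_haar (m i)" using i by (intro m_bounded) auto
  have u: "bounded_haar (S_op N (m i) ?e)" by (intro S_op_bounded N_pos mi bounded_haar_power_int)
  have f1: "integrable haar_circle f" by (rule L2_haar_integrable[OF has_symbolD(2)[OF f]])
  note adj0 = S_adj_funpow_adjoint[OF N_pos f1 m0_bounded u, of n]
  note adj1 = S_adj_adjoint[OF N_pos adj0(1) mi bounded_haar_power_int]
  have "L2_inner lborel \<xi> (w i j k) = L2_inner haar_circle f ((S_op N (m 0) ^^ n) (S_op N (m i) ?e))"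
    unfolding j' by (rule symbol_inner[OF f symbol_wavelet[OF i]])
  also have "\<dots> = (LINT z|haar_circle. f z * cnj ((S_op N (m 0) ^^ n) (S_op N (m i) ?e) z))"
    unfolding L2_inner_def ..
  also have "\<dots> = (LINT z|haar_circle. (S_adj N (m 0) ^^ n) f z * cnj (S_op N (m i) ?e z))"
    by (rule adj0(2)[symmetric])
  also have "\<dots> = (LINT z|haar_circle. S_adj N (m i) ((S_adj N (m 0) ^^ n) f) z * cnj (z powi k))"
    by (rule adj1(2)[symmetric])
  also have "\<dots> = circle_coeff (S_adj N (m i) ((S_adj N (m 0) ^^ n) f)) k"
    by (rule circle_coeff_eq[OF borel_measurable_integrable[OF adj1(1)], symmetric])
  finally show ?thesis unfolding n_def .
qed

end

lemma wavelet_systemI: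
  assumes N: "2 \<le> N" and father: "father_function N \<phi>"
    and filter: "father_filter N \<phi> (m 0)" and mother: "mother_functions N \<phi> m \<psi>"
  shows "wavelet_system N \<phi> m \<psi>"
proof -
  interpret orthonormal_translates \<phi>
    using father by unfold_locales (simp_all add: father_function_def shift_def[abs_def])
  obtain a where a: "L2_lim lborel (\<lambda>X x. \<Sum>k\<in>X. a k * shift (of_int k) \<phi> x) (dilate N \<phi>) (finite_subsets_at_top UNIV)"
    "L2_lim haar_circle (\<lambda>X. trig_poly X a) (m 0) (finite_subsets_at_top UNIV)"
    using filter unfolding father_filter_def L2_has_sum_def shift_def trig_poly_def[abs_def] by blast
  have m: "m i \<in> borel_measurable haar_circle" if "i < N" for i
    using that mother L2_borel[OF L2_limD(2)[OF a(2)]]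
    by (cases "i = 0") (auto simp: mother_functions_def)
  \<comment> \<open>The series for \<open>dilate N \<phi>\<close> and for \<open>m 0\<close> share
    coefficients and index net, and corresponding partial sums are matched by
    \<open>symbol_trig_poly\<close>.\<close>
  have sym: "has_symbol (dilate N \<phi>) (m 0)"
    by (rule symbol_lim[OF a symbol_trig_poly]) simp
  show ?thesis
    using N mother m sym
    by unfold_locales (auto simp: mother_functions_def dilate_eq_dil)
qed

text \<open>Since \<open>f\<close> is a class of functions, existence and almost everywhere
  uniqueness are stated for representatives, and the coefficient formula is asserted for each of
  them.\<close>

theorem corollary10p4:
  fixes N :: nat
    and \<phi> \<xi> :: "real \<Rightarrow> complex"
    and m :: "nat \<Rightarrow> complex \<Rightarrow> complex"
    and \<psi> :: "nat \<Rightarrow> real \<Rightarrow> complex"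
    and a :: "nat \<Rightarrow> int \<Rightarrow> int \<Rightarrow> complex"
  assumes "2 \<le> N"
    and "father_function N \<phi>"
    and "father_filter N \<phi> (m 0)"
    and "mother_functions N \<phi> m \<psi>"
    and "\<xi> \<in> L2 lborel"
    and "wavelet_expansion N \<psi> \<xi> a"
  shows "(\<xi> \<in> V0 \<phi> \<longleftrightarrow> (\<forall>i\<in>{1..<N}. \<forall>j\<le>0. \<forall>k. a i j k = 0)) \<and>
    (\<xi> \<in> V0 \<phi> \<longrightarrow>
      (\<exists>f\<in>L2 haar_circle. AE t in lborel. fourier \<xi> t = f (cis (- t)) * fourier \<phi> t) \<and>
      (\<forall>f\<in>L2 haar_circle. (AE t in lborel. fourier \<xi> t = f (cis (- t)) * fourier \<phi> t) \<longrightarrow>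
        (\<forall>g\<in>L2 haar_circle. (AE t in lborel. fourier \<xi> t = g (cis (- t)) * fourier \<phi> t) \<longrightarrow>
          (AE z in haar_circle. g z = f z)) \<and>
        (\<forall>i\<in>{1..<N}. \<forall>j\<ge>1. \<forall>k.
          a i j k = circle_coeff (S_adj N (m i) ((S_adj N (m 0) ^^ nat (j - 1)) f)) k)))"
proof -
  interpret wavelet_system N \<phi> m \<psi>
    by (rule wavelet_systemI) fact+
  have symbol: "has_symbol \<xi> f \<longleftrightarrow> f \<in> L2 haar_circle \<and> (AE t in lborel. fourier \<xi> t = f (cis (- t)) * fourier \<phi> t)" for f
    using assms(5) by (simp add: has_symbol_def spec_def)
  have coeff: "a i j k = L2_inner lborel \<xi> (w i j k)" if "i \<in> {1..<N}" for i j k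
    using expansion_coeff[OF assms(6) that] .
  have "\<xi> \<in> V0 \<phi> \<longleftrightarrow> (\<forall>i\<in>{1..<N}. \<forall>j\<le>0. \<forall>k. a i j k = 0)"
    using coeff coeff_eq_zero in_V0_if_coeff_zero[OF assms(6)] by auto
  moreover have "\<exists>f\<in>L2 haar_circle. AE t in lborel. fourier \<xi> t = f (cis (- t)) * fourier \<phi> t" if "\<xi> \<in> V0 \<phi>"
    using that V0_iff symbol by blast
  moreover have "AE z in haar_circle. g z = f z" if "has_symbol \<xi> f" "has_symbol \<xi> g" for f g
    using symbol_unique[OF that(2,1)] .
  moreover have "a i j k = circle_coeff (S_adj N (m i) ((S_adj N (m 0) ^^ nat (j - 1)) f)) k"
    if "has_symbol \<xi> f" "i \<in> {1..<N}" "1 \<le> j" for f i j k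
    using coeff_formula[OF that] coeff[OF that(2)] by simp
  ultimately show ?thesis unfolding symbol by blast
qed

end
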